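(* Let $n\ge 2$ be an integer. Consider the differential system, for unknown functions $z\mapsto (r(z),\theta(z))$, \[ \frac{dr}{dz} = -\tan\theta,\qquad \frac{d\theta}{dz} = (n-1)\Bigl(\frac{z}{\cos\theta}-\frac{1}{r}\Bigr), \] with values in the domain $r>0$, $\theta\in(-\pi/2,\pi/2)$. There exists a unique solution $z\mapsto (r(z),\theta(z))$ of this system that is defined on the whole interval $(0,+\infty)$. Moreover, this solution satisfies $r(z)\sim 1/z$ and $\theta(z)\to 0$ as $z\to+\infty$.
   Context: This system is the axisymmetric capillary equation $(n-1)\frac{\cos\theta}{r}+\cos\theta\,\frac{d\theta}{dz}=\kappa z$ with $\kappa=n-1$, for a hypersurface of $\mathbb{R}^{n+1}$ axisymmetric about the $z$-axis, where $r$ is the distance to the axis and $\theta$ is the angle of the profile curve. *)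

theory Defs
  imports "HOL-Analysis.Analysis" "HOL-Library.Landau_Symbols"
begin

definition capillary_solution :: "nat \<Rightarrow> (real \<Rightarrow> real) \<Rightarrow> (real \<Rightarrow> real) \<Rightarrow> bool" where
  "capillary_solution n r \<theta> \<longleftrightarrow>
     (\<forall>z>0. r z > 0 \<and> - (pi/2) < \<theta> z \<and> \<theta> z < pi/2 \<and>
        (r has_real_derivative (- tan (\<theta> z))) (at z) \<and>
        (\<theta> has_real_derivative ((real n - 1) * (z / cos (\<theta> z) - 1 / r z))) (at z))"

end

theory Submission
  imports Defs
begin

text \<open>Let \<open>m = n - 1\<close> and \<open>R = z * r\<close>. The system is Hamiltonian with Hamiltonian
  \<open>H = m * z * r^(m + 1) / (m + 1) - r^m * cos \<theta>\<close>, which is nondecreasing in \<open>z\<close>. If \<open>H\<close> becomes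
  nonnegative, then \<open>\<theta>' \<ge> z / 2\<close> from then on and the solution breaks down; so \<open>H < 0\<close> along a global
  solution. Conversely, \<open>H < 0\<close> confines a solution and lets it extend backwards down to \<open>0\<close>.

  The scaled energy \<open>z^m * H\<close> exceeds its minimum by \<open>excess\<close>, which oscillates. A correction by virial
  terms of relative order \<open>1 / z\<^sup>2\<close> turns it into a Lyapunov function \<open>\<psi>\<close> with
  \<open>\<psi>' \<ge> \<kappa> * \<psi> / z - O(z^(-5))\<close>. As the excess is bounded along a solution with \<open>H < 0\<close>, it is
  \<open>O(z^(-4))\<close>, whence \<open>R - 1\<close> and \<open>\<theta>\<close> are \<open>O(z^(-2))\<close>. The same estimate is uniform for
  the solutions starting backwards from \<open>(1 / N, 0)\<close> at \<open>z = N\<close>, so these subconverge to a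
  global solution. For uniqueness, a quadratic form in the difference of two global solutions, with a cubic
  correction, satisfies \<open>D' \<ge> - O(z^(-3)) * D\<close> and tends to \<open>0\<close>; hence \<open>D = 0\<close>.\<close>

section \<open>The Hamiltonian\<close>

text \<open>At \<open>R = 1\<close>, \<open>\<theta> = 0\<close> the linearised system for
  \<open>x = R - 1\<close> and \<open>t = tan \<theta>\<close> is \<open>x' = x / z - z * t\<close>,
  \<open>t' = m * z * x\<close>: a rotation of frequency proportional to \<open>z\<close> whose
  amplitude grows only like the square root of \<open>z\<close>. Perturbations are thus amplified
  forwards, which isolates a global solution, and damped backwards, which lets it be reached from
  data at large \<open>z\<close>. The obstacle is that this growth, of order \<open>1 / z\<close>,
  is weaker than the rotation by a factor of order \<open>z^2\<close>: the derivatives of the excess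
  and of the quadratic form in the differences have no sign pointwise, and growth shows only after
  averaging over the rotation. The virial and cubic corrections perform this averaging. The point
  \<open>R = 1\<close>, \<open>\<theta> = 0\<close> does not solve the system, since
  \<open>R' = 1 / z\<close> there; this forcing keeps deviations at order \<open>z^(-2)\<close>.
  Hence, in the comparison of two solutions, the quadratic terms of the system have coefficients of
  size \<open>z * z^(-2)\<close>, as large as the growth itself, and expansions must be carried to
  second order.\<close>

lemma nondecreasing_if_deriv_nonneg:
  fixes f f' :: "real \<Rightarrow> real"
  assumes "\<And>z. z \<in> {a..b} \<Longrightarrow> (f has_real_derivative f' z) (at z within {a..b})"
    and "\<And>z. z \<in> {a..b} \<Longrightarrow> 0 \<le> f' z"
    and "a \<le> x" "x \<le> y" "y \<le> b"
  shows "f x \<le> f y"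
  using \<open>x \<le> y\<close>
proof (rule DERIV_nonneg_imp_increasing_open)
  show "continuous_on {x..y} f"
    by (rule continuous_on_subset[OF DERIV_continuous_on[OF assms(1)]]) (use assms in auto)
  fix z assume z: "x < z" "z < y"
  then have "at z within {a..b} = at z"
    using assms by (intro at_within_Icc_at) auto
  with assms(1)[of z] assms(2)[of z] z assms(3-5)
  show "\<exists>d. DERIV f z :> d \<and> 0 \<le> d" by auto
qed

text \<open>Derivatives are taken within the closed interval, hence one-sided at its endpoints, so
  that solutions from Picard iteration and their limits fit without enlarging the interval.\<close>

definition capillary_on :: "nat \<Rightarrow> real \<Rightarrow> real \<Rightarrow> (real \<Rightarrow> real) \<Rightarrow> (real \<Rightarrow> real) \<Rightarrow> bool" where
  "capillary_on m a b r \<theta> \<longleftrightarrow>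
     (\<forall>z\<in>{a..b}. r z > 0 \<and> - (pi/2) < \<theta> z \<and> \<theta> z < pi/2 \<and>
        (r has_real_derivative (- tan (\<theta> z))) (at z within {a..b}) \<and>
        (\<theta> has_real_derivative (real m * (z / cos (\<theta> z) - 1 / r z))) (at z within {a..b}))"

lemma capillary_onD:
  assumes "capillary_on m a b r \<theta>" "z \<in> {a..b}"
  shows "r z > 0" "- (pi/2) < \<theta> z" "\<theta> z < pi/2" "cos (\<theta> z) > 0"
    "(r has_real_derivative (- tan (\<theta> z))) (at z within {a..b})"
    "(\<theta> has_real_derivative (real m * (z / cos (\<theta> z) - 1 / r z))) (at z within {a..b})"
  using assms by (auto simp: capillary_on_def intro!: cos_gt_zero_pi)

lemma capillary_on_subset:
  assumes "capillary_on m a b r \<theta>" "a \<le> a'" "b' \<le> b"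
  shows "capillary_on m a' b' r \<theta>"
proof -
  have "{a'..b'} \<subseteq> {a..b}" using assms by auto
  with assms(1) show ?thesis
    unfolding capillary_on_def by (blast intro: DERIV_subset)
qed

lemma capillary_solution_imp_on:
  assumes "capillary_solution (Suc m) r \<theta>" "0 < a"
  shows "capillary_on m a b r \<theta>"
  unfolding capillary_on_def
proof
  fix z assume "z \<in> {a..b}"
  then have "z > 0" using assms(2) by simp
  then show "0 < r z \<and> - (pi/2) < \<theta> z \<and> \<theta> z < pi/2 \<and>
     (r has_real_derivative - tan (\<theta> z)) (at z within {a..b}) \<and>
     (\<theta> has_real_derivative real m * (z / cos (\<theta> z) - 1 / r z)) (at z within {a..b})"
    using assms(1) unfolding capillary_solution_def by (auto intro: has_field_derivative_at_within)
qed

text \<open>With \<open>z\<close> as time, this is the Hamiltonian of the Lagrangian "area minus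
  weighted volume", \<open>r^m * sqrt (1 + r'^2) - m * z * r^(m + 1) / (m + 1)\<close>. The momentum
  conjugate to \<open>r\<close> is \<open>- r^m * sin \<theta>\<close>.\<close>

definition hamiltonian :: "nat \<Rightarrow> real \<Rightarrow> real \<Rightarrow> real \<Rightarrow> real" where
  "hamiltonian m z r \<theta> = real m * z * r ^ Suc m / (real m + 1) - r ^ m * cos \<theta>"

text \<open>Writing \<open>f z ^ m / f z\<close> for \<open>f z ^ (m - 1)\<close> leaves
  \<open>f z ^ m\<close> as the only power, so that later identities can treat it as one unknown in
  field arithmetic, with no truncated subtraction at \<open>m = 0\<close>.\<close>

lemma DERIV_power_quotient:
  fixes f :: "real \<Rightarrow> real"
  assumes "(f has_real_derivative d) (at z within S)" "f z \<noteq> 0"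
  shows "((\<lambda>z. f z ^ m) has_real_derivative (real m * f z ^ m / f z * d)) (at z within S)"
proof -
  have "real m * f z ^ (m - 1) * d = real m * f z ^ m / f z * d"
    using assms(2) by (cases m) auto
  with DERIV_power[OF assms(1), of m] show ?thesis
    by (simp add: algebra_simps)
qed

text \<open>As for every Hamiltonian, only the explicit dependence on time contributes along the
  flow.\<close>

lemma hamiltonian_deriv:
  assumes "capillary_on m a b r \<theta>" "z \<in> {a..b}"
  shows "((\<lambda>z. hamiltonian m z (r z) (\<theta> z)) has_real_derivative
            real m * r z ^ Suc m / (real m + 1)) (at z within {a..b})"
proof -
  note D = capillary_onD[OF assms]
  have eq: "\<mu> * ((\<mu> + 1) * (P * \<rho>) / \<rho> * (- (s / c)) * z + P * \<rho>) / (\<mu> + 1)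
      - (\<mu> * P / \<rho> * (- (s / c)) * c + P * (- s * (\<mu> * (z / c - 1 / \<rho>)))) = \<mu> * (P * \<rho>) / (\<mu> + 1)"
    if "c > 0" "\<rho> > 0" "\<mu> \<ge> 0" for \<mu> P \<rho> s c :: real
  proof -
    have "\<mu> + 1 \<noteq> 0" using that by linarith
    with that show ?thesis by (simp add: divide_simps) (simp add: algebra_simps)
  qed
  have r: "((\<lambda>z. r z ^ k) has_real_derivative (real k * r z ^ k / r z * (- tan (\<theta> z)))) (at z within {a..b})" for k
    using D by (intro DERIV_power_quotient) auto
  have c: "((\<lambda>z. cos (\<theta> z)) has_real_derivative
      (- sin (\<theta> z) * (real m * (z / cos (\<theta> z) - 1 / r z)))) (at z within {a..b})"
    by (rule derivative_eq_intros D refl)+ 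
  note d = DERIV_diff[OF DERIV_cdivide[OF DERIV_mult[OF DERIV_cmult_Id[of "real m"] r[of "Suc m"]]]
      DERIV_mult[OF r[of m] c], of "real m + 1"]
  show ?thesis unfolding hamiltonian_def
    by (rule DERIV_cong[OF d])
      (use eq[of "cos (\<theta> z)" "r z" "real m" "r z ^ m" "sin (\<theta> z)"] D
       in \<open>simp add: tan_def algebra_simps\<close>)
qed

lemma hamiltonian_mono:
  assumes "capillary_on m a b r \<theta>" "a \<le> x" "x \<le> y" "y \<le> b"
  shows "hamiltonian m x (r x) (\<theta> x) \<le> hamiltonian m y (r y) (\<theta> y)"
proof (rule nondecreasing_if_deriv_nonneg[OF hamiltonian_deriv[OF assms(1)]])
  fix z assume "z \<in> {a..b}"
  then have "r z > 0" using assms(1) capillary_onD by blast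
  then show "0 \<le> real m * r z ^ Suc m / (real m + 1)"
    by (auto intro!: divide_nonneg_nonneg mult_nonneg_nonneg)
qed (use assms in auto)

section \<open>The scaled energy\<close>

text \<open>The constant \<open>1 / (m + 1)\<close> makes the minimum over \<open>R \<ge> 0\<close>,
  \<open>c \<le> 1\<close> equal to zero, attained at \<open>R = c = 1\<close>. Negativity of the
  Hamiltonian thus reads \<open>excess < 1 / (m + 1)\<close>.\<close>

definition excess :: "nat \<Rightarrow> real \<Rightarrow> real \<Rightarrow> real" where
  "excess m R c = 1 / (real m + 1) - R ^ m * c + real m * R ^ Suc m / (real m + 1)"

lemma hamiltonian_eq_excess:
  assumes "0 < z"
  shows "hamiltonian m z \<rho> \<theta> = (excess m (z * \<rho>) (cos \<theta>) - 1 / (real m + 1)) / z ^ m"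
proof -
  have "real m + 1 \<noteq> 0" by linarith
  then show ?thesis
    using assms by (simp add: hamiltonian_def excess_def divide_simps power_mult_distrib)
      (simp add: algebra_simps)
qed

text \<open>The polynomial has a double root at \<open>x = 1\<close>, and the quotient has the
  positive coefficients \<open>1, ..., m\<close>. This makes the radial part of the excess visibly
  nonnegative for \<open>R \<ge> 0\<close>.\<close>

lemma square_factor_identity:
  fixes x :: real
  shows "1 - (real m + 1) * x ^ m + real m * x ^ Suc m = (x - 1)\<^sup>2 * (\<Sum>i<m. (real i + 1) * x ^ i)"
proof (induction m)
  case (Suc m)
  have "1 - (real (Suc m) + 1) * x ^ Suc m + real (Suc m) * x ^ Suc (Suc m)
      = (1 - (real m + 1) * x ^ m + real m * x ^ Suc m) + (x - 1)\<^sup>2 * ((real m + 1) * x ^ m)"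
    by (simp add: algebra_simps power2_eq_square)
  with Suc show ?case by (simp add: algebra_simps)
qed auto

lemma excess_decomposition:
  "excess m R c = R ^ m * (1 - c) + (R - 1)\<^sup>2 * (\<Sum>i<m. (real i + 1) * R ^ i) / (real m + 1)"
proof -
  have "real m + 1 \<noteq> 0" by linarith
  then show ?thesis
    unfolding excess_def square_factor_identity[symmetric] by (simp add: divide_simps) (simp add: algebra_simps)
qed

lemma excess_lower_bounds:
  assumes "0 < m" "0 \<le> R" "c \<le> 1"
  shows "(R - 1)\<^sup>2 \<le> (real m + 1) * excess m R c" "R ^ m * (1 - c) \<le> excess m R c"
proof -
  let ?S = "\<Sum>i<m. (real i + 1) * R ^ i"
  have "(\<Sum>i\<in>{0}. (real i + 1) * R ^ i) \<le> ?S"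
    using assms by (intro sum_mono2) auto
  then have S: "1 \<le> ?S" by simp
  have "0 \<le> R ^ m * (1 - c)" using assms by simp
  moreover have "(R - 1)\<^sup>2 * 1 \<le> (R - 1)\<^sup>2 * ?S" using S by (intro mult_left_mono) auto
  ultimately show "(R - 1)\<^sup>2 \<le> (real m + 1) * excess m R c"
    using mult_nonneg_nonneg[of "real m + 1" "R ^ m * (1 - c)"]
    by (simp add: excess_decomposition distrib_left del: mult_nonneg_nonneg)
  show "R ^ m * (1 - c) \<le> excess m R c"
    using S by (simp add: excess_decomposition)
qed

lemma excess_upper_bound:
  assumes "0 \<le> R" "R \<le> 2" "c \<le> 1"
  shows "excess m R c \<le> 2 ^ m * (1 - c) + (\<Sum>i<m. (real i + 1) * 2 ^ i) * (R - 1)\<^sup>2"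
proof -
  let ?S = "\<lambda>R::real. \<Sum>i<m. (real i + 1) * R ^ i"
  have "?S R \<le> ?S 2"
    using assms by (intro sum_mono mult_left_mono power_mono) auto
  moreover have "0 \<le> ?S R" using assms by (intro sum_nonneg) auto
  moreover have "?S R / (real m + 1) \<le> ?S R / 1"
    using calculation by (intro divide_left_mono) auto
  ultimately have "?S R / (real m + 1) \<le> ?S 2" by linarith
  then have "(R - 1)\<^sup>2 * (?S R / (real m + 1)) \<le> (R - 1)\<^sup>2 * ?S 2"
    by (intro mult_left_mono) auto
  moreover have "R ^ m * (1 - c) \<le> 2 ^ m * (1 - c)"
    using assms by (intro mult_right_mono power_mono) auto
  ultimately show ?thesis by (simp add: excess_decomposition mult.commute)
qed

text \<open>The angular part of the excess has weight \<open>R ^ m\<close>, which is lost at the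
  axis. For \<open>R \<le> 1/2\<close> the radial part alone is at least
  \<open>1 / (4 * (m + 1))\<close>, while \<open>s\<^sup>2 \<le> 1\<close>; for
  \<open>R > 1/2\<close> the weight is at least \<open>(1/2) ^ m\<close>. The two entries of
  \<open>K\<close> come from these cases.\<close>

lemma sin_squared_le_excess:
  assumes "0 < m"
  obtains K where "0 < K" "\<And>R c s. 0 < R \<Longrightarrow> 0 < c \<Longrightarrow> c \<le> 1 \<Longrightarrow> s\<^sup>2 + c\<^sup>2 = 1 \<Longrightarrow> s\<^sup>2 \<le> K * excess m R c"
proof
  define K where "K = max (2 ^ Suc m) (4 * (real m + 1))"
  show "0 < K" by (simp add: K_def less_max_iff_disj)
  fix R c s :: real
  assume *: "0 < R" "0 < c" "c \<le> 1" "s\<^sup>2 + c\<^sup>2 = 1"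
  note lb = excess_lower_bounds[OF assms less_imp_le[OF *(1)] *(3)]
  have "0 \<le> R ^ m * (1 - c)" using * by simp
  then have pos: "0 \<le> excess m R c" using lb by linarith
  show "s\<^sup>2 \<le> K * excess m R c"
  proof (cases "R \<le> 1/2")
    case True
    have "(1/2)\<^sup>2 \<le> (1 - R)\<^sup>2" using True by (intro power_mono) auto
    then have "1/4 \<le> (real m + 1) * excess m R c"
      using lb(1) by (simp add: power2_commute power_divide)
    moreover have "s\<^sup>2 \<le> 1" using *(4) zero_le_power2[of c] by linarith
    moreover have "4 * (real m + 1) * excess m R c \<le> K * excess m R c"
      using pos by (intro mult_right_mono) (auto simp: K_def)
    ultimately show ?thesis by linarith
  next
    case False
    have "(1/2) ^ m * (1 - c) \<le> R ^ m * (1 - c)"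
      using False * by (intro mult_right_mono power_mono) auto
    with lb(2) have "(1/2) ^ m * (1 - c) \<le> excess m R c" by linarith
    then have "1 - c \<le> 2 ^ m * excess m R c"
      by (simp add: power_divide divide_le_eq mult.commute)
    moreover have "s\<^sup>2 = (1 - c) * (1 + c)" using * by (simp add: algebra_simps power2_eq_square)
    moreover have "(1 - c) * (1 + c) \<le> (1 - c) * 2" using * by (intro mult_left_mono) auto
    moreover have "2 ^ Suc m * excess m R c \<le> K * excess m R c"
      using pos by (intro mult_right_mono) (auto simp: K_def)
    ultimately show ?thesis by simp
  qed
qed

text \<open>Along the flow the excess changes at the rate \<open>m * R ^ m * (R - c) / z\<close>,
  which has no sign. Subtracting \<open>R ^ Suc m * s / z\<^sup>2\<close> trades it, up to lower
  order, for the first summand over \<open>z\<close>, which is nonnegative but does not see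
  \<open>R - 1\<close> when \<open>s = 0\<close>. Adding
  \<open>\<epsilon> * R * (R - 1) * s / z\<^sup>2\<close> supplies the term that controls
  \<open>R - 1\<close>.\<close>

definition dissipation :: "nat \<Rightarrow> real \<Rightarrow> real \<Rightarrow> real \<Rightarrow> real \<Rightarrow> real" where
  "dissipation m \<epsilon> R c s = (real m + 1) * R ^ m * s\<^sup>2 / c
     + \<epsilon> * (real m * (R - 1) * (R - c) - (2 * R - 1) * s\<^sup>2 / c)"

text \<open>Near the axis (\<open>R \<le> \<delta>\<close>) the factor \<open>R ^ m\<close> degenerates and the \<open>\<epsilon>\<close>-term alone is coercive;
  elsewhere the first term absorbs what is negative in the \<open>\<epsilon>\<close>-term.\<close>

lemma dissipation_ge_excess:
  assumes m: "0 < m"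
  obtains \<epsilon> k where "0 < \<epsilon>" "0 < k"
    "\<And>R c s. 0 < R \<Longrightarrow> R \<le> 2 \<Longrightarrow> 0 < c \<Longrightarrow> c \<le> 1 \<Longrightarrow> s\<^sup>2 + c\<^sup>2 = 1 \<Longrightarrow> excess m R c \<le> 1
       \<Longrightarrow> k * excess m R c \<le> dissipation m \<epsilon> R c s"
proof
  define \<mu> where "\<mu> = real m"
  have \<mu>: "\<mu> \<ge> 1" using m by (simp add: \<mu>_def)
  \<comment> \<open>For \<open>R \<le> \<delta>\<close> the bracket multiplied by
    \<open>\<epsilon>\<close> is at least \<open>1 - (\<mu> + 2) * R\<close>, so this
    \<open>\<delta>\<close> keeps it above \<open>1/2\<close>.\<close>
  define \<delta> where "\<delta> = 1 / (2 * (\<mu> + 2))"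
  have \<delta>: "0 < \<delta>" "\<delta> < 1/2" "(\<mu> + 2) * \<delta> = 1/2" using \<mu> by (auto simp: \<delta>_def field_simps)
  \<comment> \<open>For \<open>R > \<delta>\<close> the negative part of the
    \<open>\<epsilon>\<close>-term is at most \<open>(\<mu> + 3) * \<epsilon> * X\<close>. With this
    \<open>\<epsilon>\<close> that is no more than half of the first term, and the other half
    remains.\<close>
  define \<epsilon> where "\<epsilon> = (\<mu> + 1) * \<delta> ^ m / 2 / (\<mu> + 3)"
  have cancel: "x * (y / x) = y" if "x \<noteq> 0" for x y :: real using that by simp
  have \<epsilon>: "0 < \<epsilon>" "(\<mu> + 3) * \<epsilon> = (\<mu> + 1) * \<delta> ^ m / 2" using \<mu> \<delta>(1) cancel[of "\<mu> + 3"] by (auto simp: \<epsilon>_def simp del: divide_divide_eq_left)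
  define M where "M = (\<Sum>i<m. (real i + 1) * 2 ^ i) + 1"
  have "0 \<le> (\<Sum>i<m. (real i + 1) * 2 ^ i :: real)" by (intro sum_nonneg) auto
  then have M: "M > 0" by (simp add: M_def)
  \<comment> \<open>The entries serve the region near the axis, where the excess is only known to be
    at most \<open>1\<close>, and then the angular and the radial part of the excess away from
    it.\<close>
  define k where "k = min (\<epsilon> / 2) (min ((\<mu> + 3) * \<epsilon> / 2 ^ m) (\<epsilon> * \<mu> / M))"
  show "0 < \<epsilon>" by fact
  show "0 < k" using \<epsilon>(1) M \<mu> by (simp add: k_def)
  fix R c s :: real
  assume *: "0 < R" "R \<le> 2" "0 < c" "c \<le> 1" "s\<^sup>2 + c\<^sup>2 = 1" "excess m R c \<le> 1"
  have s2: "s\<^sup>2 = 1 - c\<^sup>2" using * by simp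
  define X where "X = s\<^sup>2 / c"
  have sc: "X = 1 / c - c" using * by (simp add: X_def s2 field_simps power2_eq_square)
  have c1: "1 / c \<ge> 1" using * by simp
  have sc0: "0 \<le> X" using * by (simp add: X_def)
  have sc1: "1 - c \<le> X" using c1 sc by linarith
  have "0 \<le> R ^ m * (1 - c)" using * by simp
  then have pos: "0 \<le> excess m R c"
    using excess_lower_bounds(2)[OF m, of R c] * by linarith
  have diss: "dissipation m \<epsilon> R c s = (\<mu> + 1) * R ^ m * X
      + \<epsilon> * (\<mu> * (R - 1) * (R - c) - (2 * R - 1) * X)"
    by (simp add: dissipation_def \<mu>_def X_def)
  show "k * excess m R c \<le> dissipation m \<epsilon> R c s"
  proof (cases "R \<le> \<delta>")
    case True
    have "(\<mu> + 2) * R \<le> (\<mu> + 2) * \<delta>" using True \<mu> by (intro mult_left_mono) auto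
    then have R: "(\<mu> + 2) * R \<le> 1/2" using \<delta> by simp
    have "\<mu> * R \<ge> R" using \<mu> * mult_right_mono[of 1 \<mu> R] by simp
    have "(1 - 2 * R) * 1 \<le> (1 - 2 * R) * (\<mu> * c + 1 / c - c)"
    proof (rule mult_left_mono)
      have "\<mu> * c \<ge> c" using \<mu> * mult_right_mono[of 1 \<mu> c] by simp
      then show "1 \<le> \<mu> * c + 1 / c - c" using c1 by linarith
      show "0 \<le> 1 - 2 * R" using True \<delta> by linarith
    qed
    moreover have "\<mu> * (R - 1) * (R - c) - (2 * R - 1) * (1 / c - c)
       = (1 - 2 * R) * (\<mu> * c + 1 / c - c) - \<mu> * R + \<mu> * R * R + \<mu> * R * c"
      by (simp add: algebra_simps)
    moreover have "0 \<le> \<mu> * R * R + \<mu> * R * c" using \<mu> * by simp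
    ultimately have "1/2 \<le> \<mu> * (R - 1) * (R - c) - (2 * R - 1) * (1 / c - c)"
      using R by (simp add: algebra_simps)
    then have "\<epsilon> * (1/2) \<le> \<epsilon> * (\<mu> * (R - 1) * (R - c) - (2 * R - 1) * X)"
      unfolding sc using \<epsilon> by (intro mult_left_mono) auto
    moreover have "0 \<le> (\<mu> + 1) * R ^ m * X" using * sc0 \<mu> by auto
    ultimately have "\<epsilon> / 2 \<le> dissipation m \<epsilon> R c s" unfolding diss by linarith
    moreover have "k \<le> \<epsilon> / 2" unfolding k_def by linarith
    then have "k * excess m R c \<le> \<epsilon> / 2 * 1"
      using pos * \<epsilon> by (intro mult_mono) auto
    ultimately show ?thesis by linarith
  next
    case False
    have RR: "(R - 1) * (1 - c) \<ge> - X" 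
    proof -
      have "(1 - R) * (1 - c) \<le> 1 * (1 - c)" using * by (intro mult_right_mono) auto
      then show ?thesis using sc1 by (simp add: algebra_simps)
    qed
    have "(2 * R - 1) * X \<le> 3 * X" using * sc0 by (intro mult_right_mono) auto
    moreover have "\<mu> * - X \<le> \<mu> * ((R - 1) * (1 - c))" using RR \<mu> by (intro mult_left_mono) auto
    moreover have "\<mu> * (R - 1) * (R - c) = \<mu> * (R - 1)\<^sup>2 + \<mu> * ((R - 1) * (1 - c))"
      by (simp add: power2_eq_square algebra_simps)
    moreover have "(\<mu> + 3) * X = \<mu> * X + 3 * X"
      by (simp only: distrib_right)
    moreover have "\<mu> * - X = - (\<mu> * X)" by (rule mult_minus_right)
    ultimately have "\<mu> * (R - 1)\<^sup>2 - (\<mu> + 3) * X \<le> \<mu> * (R - 1) * (R - c) - (2 * R - 1) * X"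
      by linarith
    then have 1: "\<epsilon> * (\<mu> * (R - 1)\<^sup>2 - (\<mu> + 3) * X)
        \<le> \<epsilon> * (\<mu> * (R - 1) * (R - c) - (2 * R - 1) * X)"
      using \<epsilon> by (intro mult_left_mono) auto
    have "2 * ((\<mu> + 3) * \<epsilon>) * X \<le> (\<mu> + 1) * R ^ m * X"
    proof (rule mult_right_mono)
      have "(\<mu> + 1) * \<delta> ^ m \<le> (\<mu> + 1) * R ^ m"
        using False \<delta> \<mu> by (intro mult_left_mono power_mono) auto
      then show "2 * ((\<mu> + 3) * \<epsilon>) \<le> (\<mu> + 1) * R ^ m" unfolding \<epsilon>(2) by simp
    qed (rule sc0)
    with 1 have "\<epsilon> * \<mu> * (R - 1)\<^sup>2 + (\<mu> + 3) * \<epsilon> * X \<le> dissipation m \<epsilon> R c s"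
      unfolding diss by (simp add: algebra_simps)
    moreover have "(\<mu> + 3) * \<epsilon> * (1 - c) \<le> (\<mu> + 3) * \<epsilon> * X"
      using sc1 \<mu> \<epsilon>(1) by (intro mult_left_mono) auto
    moreover have "k * excess m R c \<le> k * (2 ^ m * (1 - c) + M * (R - 1)\<^sup>2)"
    proof (rule mult_left_mono)
      show "excess m R c \<le> 2 ^ m * (1 - c) + M * (R - 1)\<^sup>2"
        using excess_upper_bound[of R c m] * zero_le_power2[of "R - 1"] unfolding M_def distrib_right by linarith
    qed (use \<open>0 < k\<close> in simp)
    moreover have "k * 2 ^ m * (1 - c) \<le> (\<mu> + 3) * \<epsilon> * (1 - c)"
    proof (rule mult_right_mono)
      have "k \<le> (\<mu> + 3) * \<epsilon> / 2 ^ m" unfolding k_def by linarith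
      then show "k * 2 ^ m \<le> (\<mu> + 3) * \<epsilon>" by (simp add: field_simps)
    qed (use * in simp)
    moreover have "k * M * (R - 1)\<^sup>2 \<le> \<epsilon> * \<mu> * (R - 1)\<^sup>2"
    proof (rule mult_right_mono)
      have "k \<le> \<epsilon> * \<mu> / M" unfolding k_def by linarith
      then show "k * M \<le> \<epsilon> * \<mu>" using M by (simp add: field_simps)
    qed simp
    ultimately show ?thesis by (simp add: algebra_simps)
  qed
qed

section \<open>Growth of the excess\<close>

definition lyapunov :: "nat \<Rightarrow> real \<Rightarrow> real \<Rightarrow> real \<Rightarrow> real \<Rightarrow> real \<Rightarrow> real" where
  "lyapunov m \<epsilon> z R c s = excess m R c - (R ^ Suc m * s - \<epsilon> * (R * (R - 1) * s)) / z\<^sup>2"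

text \<open>The fast part of the flow, of size \<open>z\<close>, acts on the corrections over
  \<open>z\<^sup>2\<close> and yields the terms of order \<open>1 / z\<close>. The slow part
  \<open>R / z\<close> of \<open>R'\<close> and the derivative of \<open>1 / z\<^sup>2\<close> are
  smaller by \<open>z\<^sup>2\<close> and make up the last summand.\<close>

lemma lyapunov_deriv:
  assumes "capillary_on m a b r \<theta>" "0 < a" "z \<in> {a..b}"
  defines "R \<equiv> \<lambda>z. z * r z"
  shows "((\<lambda>z. lyapunov m \<epsilon> z (R z) (cos (\<theta> z)) (sin (\<theta> z))) has_real_derivative
            dissipation m \<epsilon> (R z) (cos (\<theta> z)) (sin (\<theta> z)) / z
            + sin (\<theta> z) * R z / z ^ 3 * (\<epsilon> - (real m - 1) * R z ^ m)) (at z within {a..b})"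
proof -
  note D = capillary_onD[OF assms(1,3)]
  have z: "z > 0" using assms by auto
  have Rz: "R z > 0" using z D by (simp add: R_def)
  define c s \<rho> where "c = cos (\<theta> z)" and "s = sin (\<theta> z)" and "\<rho> = R z"
  have pos: "c > 0" "\<rho> > 0" using D Rz by (auto simp: c_def \<rho>_def)
  define d where "d = real m * (z / c - z / \<rho>)"
  have R: "(R has_real_derivative (\<rho> / z - z * (s / c))) (at z within {a..b})"
    unfolding R_def using z
    by (intro DERIV_cong[OF DERIV_mult[OF DERIV_ident D(5)]])
      (simp add: \<rho>_def R_def tan_def s_def c_def)
  have "1 / r z = z / \<rho>" using z by (simp add: \<rho>_def R_def)
  then have T: "(\<theta> has_real_derivative d) (at z within {a..b})"
    using D(6) by (simp add: d_def c_def)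
  have S: "((\<lambda>z. sin (\<theta> z)) has_real_derivative (c * d)) (at z within {a..b})"
    unfolding c_def by (rule DERIV_cong[OF DERIV_chain2[OF DERIV_sin T]]) simp
  have C: "((\<lambda>z. cos (\<theta> z)) has_real_derivative (- s * d)) (at z within {a..b})"
    unfolding s_def by (rule DERIV_cong[OF DERIV_chain2[OF DERIV_cos T]]) simp
  have P: "((\<lambda>z. R z ^ k) has_real_derivative (real k * \<rho> ^ k / \<rho> * (\<rho> / z - z * (s / c)))) (at z within {a..b})" for k
    using DERIV_power_quotient[OF R] Rz by (simp add: \<rho>_def)
  have Z: "((\<lambda>z. z\<^sup>2) has_real_derivative (2 * z)) (at z within {a..b})"
    by (rule DERIV_cong[OF DERIV_pow]) simp
  have z2: "z\<^sup>2 \<noteq> 0" using z by simp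
  note d1 = DERIV_add[OF DERIV_diff[OF DERIV_const DERIV_mult[OF P[of m] C]]
      DERIV_cdivide[OF DERIV_cmult[OF P[of "Suc m"], of "real m"], of "real m + 1"], of "1 / (real m + 1)"]
  note d2 = DERIV_divide[OF DERIV_diff[OF DERIV_mult[OF P[of "Suc m"] S]
      DERIV_cmult[OF DERIV_mult[OF DERIV_mult[OF R DERIV_diff[OF R DERIV_const]] S]]] Z z2]
  have excess_rate: "0 - (\<mu> * P / \<rho> * (\<rho> / z - z * (s / c)) * c + (- s * (\<mu> * (z / c - z / \<rho>))) * P)
         + \<mu> * ((\<mu> + 1) * (P * \<rho>) / \<rho> * (\<rho> / z - z * (s / c))) / (\<mu> + 1) = \<mu> * P * (\<rho> - c) / z"
    if "\<mu> \<ge> 0" for \<mu> P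
  proof -
    have "\<mu> + 1 \<noteq> 0" using that by linarith
    with pos z show ?thesis by (simp add: divide_simps) (simp add: algebra_simps)
  qed
  \<comment> \<open>The unsigned term \<open>\<mu> * P * (\<rho> - c) / z\<close> of
    \<open>excess_rate\<close> reappears here and cancels in the difference; \<open>P\<close> stands
    for \<open>\<rho> ^ m\<close>.\<close>
  have shift_rate: "((((\<mu> + 1) * (P * \<rho>) / \<rho> * (\<rho> / z - z * (s / c)) * s + c * (\<mu> * (z / c - z / \<rho>)) * (P * \<rho>))
       - \<epsilon> * (((\<rho> / z - z * (s / c)) * (\<rho> - 1) + (\<rho> / z - z * (s / c) - 0) * \<rho>) * s
           + c * (\<mu> * (z / c - z / \<rho>)) * (\<rho> * (\<rho> - 1)))) * z\<^sup>2
       - (P * \<rho> * s - \<epsilon> * (\<rho> * (\<rho> - 1) * s)) * (2 * z)) / (z\<^sup>2 * z\<^sup>2)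
     = \<mu> * P * (\<rho> - c) / z
       - (((\<mu> + 1) * P * s\<^sup>2 / c + \<epsilon> * (\<mu> * (\<rho> - 1) * (\<rho> - c) - (2 * \<rho> - 1) * s\<^sup>2 / c)) / z
          + s * \<rho> / z ^ 3 * (\<epsilon> - (\<mu> - 1) * P))" for \<mu> P
    using pos z by (simp add: divide_simps) (simp add: algebra_simps eval_nat_numeral)
  note d3 = DERIV_diff[OF d1 d2]
  show ?thesis
    unfolding lyapunov_def excess_def dissipation_def
    by (rule DERIV_cong[OF d3])
      (use excess_rate[of "real m" "\<rho> ^ m"] shift_rate[of "real m" "\<rho> ^ m"] in
        \<open>simp add: c_def[symmetric] s_def[symmetric] \<rho>_def[symmetric] d_def mult.commute add.commute\<close>)
qed

text \<open>\<open>C / z ^ 4\<close> satisfies the differential inequality with equality, which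
  explains the factor \<open>4 + \<kappa>\<close>. Hence the difference
  \<open>\<psi> - C / z ^ 4\<close> grows at least like \<open>z powr \<kappa>\<close>, that is, its
  product with \<open>z powr (-\<kappa>)\<close> is nondecreasing.\<close>

lemma exponential_growth_bound:
  fixes \<psi> \<psi>' :: "real \<Rightarrow> real"
  assumes "\<And>z. z \<in> {a..b} \<Longrightarrow> (\<psi> has_real_derivative \<psi>' z) (at z within {a..b})"
    and "\<And>z. z \<in> {a..b} \<Longrightarrow> \<kappa> * \<psi> z / z - (4 + \<kappa>) * C / z ^ 5 \<le> \<psi>' z"
    and "0 < a" "a \<le> b"
  shows "\<psi> a - C / a ^ 4 \<le> (a / b) powr \<kappa> * (\<psi> b - C / b ^ 4)"
proof -
  have "a powr (-\<kappa>) * (\<psi> a - C / a ^ 4) \<le> b powr (-\<kappa>) * (\<psi> b - C / b ^ 4)"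
  proof (rule nondecreasing_if_deriv_nonneg[where a = a and b = b and x = a and y = b
        and f = "\<lambda>z. z powr (-\<kappa>) * (\<psi> z - C / z ^ 4)" and f' = "\<lambda>z. z powr (-\<kappa>) * (\<psi>' z - (\<kappa> * \<psi> z / z - (4 + \<kappa>) * C / z ^ 5))"])
    fix z assume z: "z \<in> {a..b}"
    then have "z > 0" using assms by auto
    have p: "((\<lambda>z. z powr (-\<kappa>)) has_real_derivative (-\<kappa> * z powr (-\<kappa>) / z)) (at z within {a..b})"
      using \<open>z > 0\<close>
      by (intro has_field_derivative_at_within[OF DERIV_cong[OF has_real_derivative_powr'[OF DERIV_ident DERIV_const]]]) auto
    have "(0 * z ^ 4 - C * (real 4 * z ^ (4 - Suc 0))) / (z ^ 4 * z ^ 4) = - 4 * C / z ^ 5"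
      using \<open>z > 0\<close> by (simp add: divide_simps)
    then have q: "((\<lambda>z. C / z ^ 4) has_real_derivative (- 4 * C / z ^ 5)) (at z within {a..b})"
      using \<open>z > 0\<close> by (intro DERIV_cong[OF DERIV_divide[OF DERIV_const DERIV_pow]]) auto
    have rate: "- \<kappa> * p / z * (y - C / z ^ 4) + (y' - - 4 * C / z ^ 5) * p
        = p * (y' - (\<kappa> * y / z - (4 + \<kappa>) * C / z ^ 5))" for p y y'
    proof -
      have quintic: "C / z ^ 4 / z = C / z ^ 5" using \<open>z > 0\<close> by (simp add: eval_nat_numeral)
      have "- \<kappa> * p / z * (y - C / z ^ 4) = - \<kappa> * p * y / z + \<kappa> * p * (C / z ^ 4 / z)"
        by (simp add: algebra_simps)
      then show ?thesis unfolding quintic by (simp add: algebra_simps add_divide_distrib)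
    qed
    show "((\<lambda>z. z powr (-\<kappa>) * (\<psi> z - C / z ^ 4)) has_real_derivative
        z powr (-\<kappa>) * (\<psi>' z - (\<kappa> * \<psi> z / z - (4 + \<kappa>) * C / z ^ 5))) (at z within {a..b})"
      by (rule DERIV_cong[OF DERIV_mult[OF p DERIV_diff[OF assms(1)[OF z] q]] rate])
    show "0 \<le> z powr (-\<kappa>) * (\<psi>' z - (\<kappa> * \<psi> z / z - (4 + \<kappa>) * C / z ^ 5))"
      using assms(2)[OF z] by simp
  qed (use assms in auto)
  then have "a powr \<kappa> * (a powr (-\<kappa>) * (\<psi> a - C / a ^ 4)) \<le> a powr \<kappa> * (b powr (-\<kappa>) * (\<psi> b - C / b ^ 4))"
    by (rule mult_left_mono) simp
  moreover have "a powr \<kappa> * a powr (-\<kappa>) = 1" using assms by (simp add: powr_minus)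
  moreover have "a powr \<kappa> * b powr (-\<kappa>) = (a / b) powr \<kappa>"
    using assms by (simp add: powr_divide powr_minus_divide)
  ultimately show ?thesis
    by (simp only: mult.assoc[symmetric] mult_1)
qed

text \<open>Cancelling \<open>\<rho> ^ m\<close> in \<open>hamiltonian < 0\<close> gives the first
  bound; the second follows because \<open>(m + 1) / m \<le> 2\<close>. These bounds put
  \<open>R\<close> and the excess in the range where the dissipation is coercive.\<close>

lemma neg_hamiltonian_imp:
  assumes "hamiltonian m z \<rho> \<theta> < 0" "0 < m" "0 < z" "0 < \<rho>"
  shows "real m * (z * \<rho>) < (real m + 1) * cos \<theta>" "z * \<rho> \<le> 2"
    "excess m (z * \<rho>) (cos \<theta>) \<le> 1"
proof -
  have "real m * z * (\<rho> * \<rho> ^ m) / (real m + 1) < \<rho> ^ m * cos \<theta>"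
    using assms(1) by (simp add: hamiltonian_def)
  then have "\<rho> ^ m * (real m * (z * \<rho>)) < \<rho> ^ m * ((real m + 1) * cos \<theta>)"
    by (simp add: pos_divide_less_eq algebra_simps)
  then show *: "real m * (z * \<rho>) < (real m + 1) * cos \<theta>"
    using assms by (simp add: mult_less_cancel_left_pos)
  have "(real m + 1) * cos \<theta> \<le> (real m + 1) * 1"
    by (intro mult_left_mono) auto
  also have "\<dots> \<le> real m * 2" using assms(2) by simp
  finally have "real m * (z * \<rho>) \<le> real m * 2" using * by linarith
  then show "z * \<rho> \<le> 2" using assms(2) by simp
  have "excess m (z * \<rho>) (cos \<theta>) < 1 / (real m + 1)"
    using assms(1,3) by (simp add: hamiltonian_eq_excess divide_less_0_iff)
  also have "\<dots> \<le> 1" by simp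
  finally show "excess m (z * \<rho>) (cos \<theta>) \<le> 1" by simp
qed

text \<open>The constants depend on \<open>m\<close> only. This uniformity serves both the
  approximating solutions, whose final excess is zero, and global solutions, for which
  \<open>b\<close> is sent to infinity.\<close>

theorem excess_decay:
  assumes m: "0 < m"
  obtains \<kappa> C where "0 < \<kappa>" "0 < C"
    "\<And>a b r \<theta>. capillary_on m a b r \<theta> \<Longrightarrow> 0 < a \<Longrightarrow> a \<le> b \<Longrightarrow> hamiltonian m b (r b) (\<theta> b) < 0 \<Longrightarrow>
      excess m (a * r a) (cos (\<theta> a)) \<le> C / a ^ 4 + 3 * (a / b) powr \<kappa> * excess m (b * r b) (cos (\<theta> b))"
proof -
  obtain \<epsilon> k where \<epsilon>: "0 < \<epsilon>" and k: "0 < k"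
    and diss: "\<And>R c s. 0 < R \<Longrightarrow> R \<le> 2 \<Longrightarrow> 0 < c \<Longrightarrow> c \<le> 1 \<Longrightarrow> s\<^sup>2 + c\<^sup>2 = 1 \<Longrightarrow> excess m R c \<le> 1
       \<Longrightarrow> k * excess m R c \<le> dissipation m \<epsilon> R c s"
    using dissipation_ge_excess[OF m] by metis
  obtain K where K: "0 < K"
    and sinK: "\<And>R c s. 0 < R \<Longrightarrow> 0 < c \<Longrightarrow> c \<le> 1 \<Longrightarrow> s\<^sup>2 + c\<^sup>2 = 1 \<Longrightarrow> s\<^sup>2 \<le> K * excess m R c"
    using sin_squared_le_excess[OF m] by metis
  \<comment> \<open>Half of the dissipation, \<open>k / 2 * e / z\<close>, survives the error terms,
    and \<open>\<psi> \<le> 3/2 * e\<close> up to \<open>C2 / z ^ 4\<close>; the quotient of the two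
    factors is \<open>k / 3\<close>.\<close>
  define \<kappa> where "\<kappa> = k / 3"
  \<comment> \<open>For \<open>0 < R \<le> 2\<close>, \<open>L1\<close> bounds the coefficient of
    \<open>s / z ^ 3\<close> in the derivative of \<open>\<psi>\<close>, and \<open>L2\<close> that
    of \<open>s / z\<^sup>2\<close> in \<open>\<psi> - e\<close>.\<close>
  define L1 where "L1 = 2 * (\<epsilon> + real m * 2 ^ m)"
  define L2 where "L2 = 2 ^ Suc m + 2 * \<epsilon>"
  define C1 where "C1 = L1\<^sup>2 * K / (2 * k)"
  define C2 where "C2 = L2\<^sup>2 * K / 2"
  define C3 where "C3 = (C1 + \<kappa> * C2) / (4 + \<kappa>)"
  have pos: "0 < \<kappa>" "0 \<le> C1" "0 \<le> C2" "0 \<le> C3" "0 < L1" "0 < L2"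
    using k K \<epsilon> by (auto simp: \<kappa>_def C1_def C2_def C3_def L1_def L2_def add_pos_nonneg)
  \<comment> \<open>Both inequalities complete a square. The weights are such that, by
    \<open>s\<^sup>2 \<le> K * e\<close>, the first consumes half of the dissipation and the second
    half of the excess.\<close>
  have amgm1: "L1 * \<bar>s\<bar> / z ^ 3 \<le> k / (2 * K) * s\<^sup>2 / z + C1 / z ^ 5" if "z > 0" for s z :: real
  proof -
    have "0 \<le> (k / K * \<bar>s\<bar> * z\<^sup>2 - L1)\<^sup>2 * (K / (2 * k * z ^ 5))"
      using that k K by simp
    also have "\<dots> = k / (2 * K) * s\<^sup>2 / z + C1 / z ^ 5 - L1 * \<bar>s\<bar> / z ^ 3"
      using that k K unfolding C1_def power2_abs[of s, symmetric]
      by (simp add: divide_simps) (simp add: algebra_simps eval_nat_numeral)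
    finally show ?thesis by simp
  qed
  have amgm2: "L2 * \<bar>s\<bar> / z\<^sup>2 \<le> s\<^sup>2 / (2 * K) + C2 / z ^ 4" if "z > 0" for s z :: real
  proof -
    have "0 \<le> (\<bar>s\<bar> * z\<^sup>2 - L2 * K)\<^sup>2 / (2 * K * z ^ 4)"
      using that K by simp
    also have "\<dots> = s\<^sup>2 / (2 * K) + C2 / z ^ 4 - L2 * \<bar>s\<bar> / z\<^sup>2"
      using that K unfolding C2_def power2_abs[of s, symmetric]
      by (simp add: divide_simps) (simp add: algebra_simps eval_nat_numeral)
    finally show ?thesis by simp
  qed
  show ?thesis
  \<comment> \<open>From \<open>e \<le> 2 * \<psi> + 2 * C2 / a ^ 4\<close> and an error
    \<open>(C2 + C3) / a ^ 4\<close> for \<open>\<psi>\<close>; the summand \<open>1\<close> makes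
    the constant positive. The factor \<open>3\<close> of the final term is
    \<open>2 * (3/2)\<close>.\<close>
  proof (rule that[of \<kappa> "2 * C3 + 4 * C2 + 1"])
    fix a b r \<theta>
    assume sol: "capillary_on m a b r \<theta>" and ab: "0 < a" "a \<le> b" and neg: "hamiltonian m b (r b) (\<theta> b) < 0"
    define e where "e z = excess m (z * r z) (cos (\<theta> z))" for z
    define \<psi> where "\<psi> z = lyapunov m \<epsilon> z (z * r z) (cos (\<theta> z)) (sin (\<theta> z))" for z
    define \<psi>' where "\<psi>' z = dissipation m \<epsilon> (z * r z) (cos (\<theta> z)) (sin (\<theta> z)) / z
            + sin (\<theta> z) * (z * r z) / z ^ 3 * (\<epsilon> - (real m - 1) * (z * r z) ^ m)" for z
    have bounds: "\<bar>\<psi> z - e z\<bar> \<le> e z / 2 + C2 / z ^ 4 \<and> k / 2 * e z / z - C1 / z ^ 5 \<le> \<psi>' z \<and> 0 \<le> e z"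
      if z: "z \<in> {a..b}" for z
    proof -
      note D = capillary_onD[OF sol z]
      have "z > 0" using z ab by auto
      have "hamiltonian m z (r z) (\<theta> z) < 0"
        using hamiltonian_mono[OF sol, of z b] neg z by auto
      note H = neg_hamiltonian_imp[OF this m \<open>z > 0\<close> D(1)]
      define R c s where "R = z * r z" and "c = cos (\<theta> z)" and "s = sin (\<theta> z)"
      have R: "0 < R" "R \<le> 2" "excess m R c \<le> 1" using H D \<open>z > 0\<close> by (auto simp: R_def c_def)
      have c: "0 < c" "c \<le> 1" "s\<^sup>2 + c\<^sup>2 = 1" using D by (auto simp: c_def s_def)
      have ez: "e z = excess m R c" by (simp add: e_def R_def c_def)
      note dk = diss[OF R(1,2) c R(3)] and sk = sinK[OF R(1) c]
      have Rm: "0 \<le> R ^ m" "R ^ m \<le> 2 ^ m" using R by (auto intro: power_mono)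
      have "0 \<le> K * e z" using sk unfolding ez by (rule order_trans[OF zero_le_power2])
      then have e0: "0 \<le> e z" using K by (simp add: zero_le_mult_iff)
      have sk': "s\<^sup>2 / (2 * K) \<le> e z / 2" using sk K ez by (simp add: field_simps)
      have "\<bar>R ^ Suc m - \<epsilon> * (R * (R - 1))\<bar> \<le> L2"
      proof -
        have "R * R ^ m \<le> 2 * 2 ^ m" using R Rm by (intro mult_mono) auto
        moreover have "\<bar>R * (R - 1)\<bar> \<le> 2 * 1" unfolding abs_mult using R by (intro mult_mono) auto
        then have "\<bar>\<epsilon> * (R * (R - 1))\<bar> \<le> \<epsilon> * 2" 
          unfolding abs_mult using \<epsilon> by (intro mult_mono) (auto simp: abs_mult)
        moreover have "0 \<le> R * R ^ m" using R by auto
        ultimately show ?thesis unfolding L2_def power_Suc by linarith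
      qed
      moreover have "\<psi> z - e z = - ((R ^ Suc m - \<epsilon> * (R * (R - 1))) * s / z\<^sup>2)"
        by (simp add: \<psi>_def e_def lyapunov_def R_def c_def s_def algebra_simps)
      then have "\<bar>\<psi> z - e z\<bar> = \<bar>R ^ Suc m - \<epsilon> * (R * (R - 1))\<bar> * (\<bar>s\<bar> / z\<^sup>2)"
        by (simp only: abs_minus_cancel abs_mult abs_divide) (simp add: abs_mult)
      ultimately have "\<bar>\<psi> z - e z\<bar> \<le> L2 * (\<bar>s\<bar> / z\<^sup>2)"
        by (simp add: mult_right_mono divide_right_mono)
      then have 1: "\<bar>\<psi> z - e z\<bar> \<le> e z / 2 + C2 / z ^ 4"
        using amgm2[OF \<open>z > 0\<close>, of s] sk' by simp
      have "\<bar>R * (\<epsilon> - (real m - 1) * R ^ m)\<bar> \<le> L1"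
      proof -
        have "(real m - 1) * R ^ m \<le> real m * 2 ^ m" using Rm m by (intro mult_mono) auto
        moreover have "0 \<le> (real m - 1) * R ^ m" using Rm m by auto
        ultimately have "\<bar>\<epsilon> - (real m - 1) * R ^ m\<bar> \<le> \<epsilon> + real m * 2 ^ m"
          using \<epsilon> by linarith
        then show ?thesis unfolding L1_def abs_mult using R by (intro mult_mono) auto
      qed
      then have "\<bar>R * (\<epsilon> - (real m - 1) * R ^ m)\<bar> * (\<bar>s\<bar> / z ^ 3) \<le> L1 * (\<bar>s\<bar> / z ^ 3)"
        using \<open>z > 0\<close> by (intro mult_right_mono) auto
      moreover have "\<bar>s * R / z ^ 3 * (\<epsilon> - (real m - 1) * R ^ m)\<bar>
          = \<bar>R * (\<epsilon> - (real m - 1) * R ^ m)\<bar> * (\<bar>s\<bar> / z ^ 3)"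
        using \<open>z > 0\<close> by (simp add: abs_mult)
      ultimately have "\<bar>s * R / z ^ 3 * (\<epsilon> - (real m - 1) * R ^ m)\<bar> \<le> L1 * (\<bar>s\<bar> / z ^ 3)"
        by presburger
      then have "s * R / z ^ 3 * (\<epsilon> - (real m - 1) * R ^ m) \<ge> - (L1 * \<bar>s\<bar> / z ^ 3)"
        by (simp only: times_divide_eq_right abs_le_iff) linarith
      moreover have "k * e z / z \<le> dissipation m \<epsilon> R c s / z"
        using dk ez \<open>z > 0\<close> by (simp add: divide_right_mono)
      moreover have "k / (2 * K) * s\<^sup>2 / z \<le> k / 2 * e z / z"
      proof -
        have "k * (s\<^sup>2 / (2 * K)) \<le> k * (e z / 2)" using sk' k by (intro mult_left_mono) auto
        then have "k * (s\<^sup>2 / (2 * K)) / z \<le> k * (e z / 2) / z" using \<open>z > 0\<close> by (intro divide_right_mono) auto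
        then show ?thesis by simp
      qed
      moreover have "k * e z / z = k / 2 * e z / z + k / 2 * e z / z" by simp
      moreover have "y - v \<le> d + x" if "- t \<le> x" "w \<le> d" "u \<le> y" "w = y + y" "t \<le> u + v" for d t u v w x y :: real
        using that by linarith
      ultimately have 2: "k / 2 * e z / z - C1 / z ^ 5 \<le> \<psi>' z"
        using amgm1[OF \<open>z > 0\<close>, of s] unfolding \<psi>'_def R_def[symmetric] c_def[symmetric] s_def[symmetric]
        by blast
      from 1 2 e0 show ?thesis by blast
    qed
    have "\<psi> a - C3 / a ^ 4 \<le> (a / b) powr \<kappa> * (\<psi> b - C3 / b ^ 4)"
    proof (rule exponential_growth_bound[OF _ _ ab])
      fix z assume z: "z \<in> {a..b}"
      then have "z > 0" using ab by auto
      show "(\<psi> has_real_derivative \<psi>' z) (at z within {a..b})"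
        unfolding \<psi>_def \<psi>'_def by (rule lyapunov_deriv[OF sol ab(1) z])
      have "\<psi> z \<le> 3 / 2 * e z + C2 / z ^ 4" using bounds[OF z] by linarith
      then have "\<kappa> * \<psi> z / z \<le> \<kappa> * (3 / 2 * e z + C2 / z ^ 4) / z"
        using pos \<open>z > 0\<close> by (intro divide_right_mono mult_left_mono) auto
      also have "\<dots> = k / 2 * e z / z + \<kappa> * C2 / z ^ 5"
        using \<open>z > 0\<close> by (simp add: \<kappa>_def field_simps eval_nat_numeral)
      also have "\<dots> \<le> \<psi>' z + (4 + \<kappa>) * C3 / z ^ 5"
      proof -
        have "(4 + \<kappa>) * C3 = C1 + \<kappa> * C2" using pos by (simp add: C3_def)
        then show ?thesis using bounds[OF z] by (simp add: add_divide_distrib)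
      qed
      finally show "\<kappa> * \<psi> z / z - (4 + \<kappa>) * C3 / z ^ 5 \<le> \<psi>' z" by simp
    qed
    also have "\<dots> \<le> (a / b) powr \<kappa> * (3 / 2 * e b + C2 / b ^ 4)"
    proof (rule mult_left_mono)
      have "0 \<le> C3 / b ^ 4" using pos ab by simp
      then show "\<psi> b - C3 / b ^ 4 \<le> 3 / 2 * e b + C2 / b ^ 4" using bounds[of b] ab by auto
    qed simp
    also have "\<dots> \<le> (a / b) powr \<kappa> * (3 / 2 * e b) + C2 / a ^ 4"
    proof -
      have "(a / b) powr \<kappa> \<le> 1" using ab pos by (intro powr_le1) auto
      moreover have "C2 / b ^ 4 \<le> C2 / a ^ 4" using ab pos by (intro divide_left_mono power_mono) auto
      ultimately have "(a / b) powr \<kappa> * (C2 / b ^ 4) \<le> 1 * (C2 / a ^ 4)"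
        using pos ab by (intro mult_mono) auto
      then show ?thesis by (simp add: distrib_left)
    qed
    finally have "\<psi> a \<le> (a / b) powr \<kappa> * (3 / 2 * e b) + (C2 + C3) / a ^ 4"
      unfolding add_divide_distrib by linarith
    moreover have "e a \<le> 2 * \<psi> a + 2 * C2 / a ^ 4" using bounds[of a] ab by auto
    moreover have "0 \<le> 1 / a ^ 4" by simp
    moreover have "y \<le> (2 * C3 + 4 * C2 + 1) / a ^ 4 + 3 * p * q"
      if "x \<le> p * (3 / 2 * q) + (C2 + C3) / a ^ 4" "y \<le> 2 * x + 2 * C2 / a ^ 4" "0 \<le> 1 / a ^ 4" for p q x y
      using that unfolding add_divide_distrib by linarith
    ultimately have "e a \<le> (2 * C3 + 4 * C2 + 1) / a ^ 4 + 3 * (a / b) powr \<kappa> * e b"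
      by blast
    then show "excess m (a * r a) (cos (\<theta> a)) \<le> (2 * C3 + 4 * C2 + 1) / a ^ 4
        + 3 * (a / b) powr \<kappa> * excess m (b * r b) (cos (\<theta> b))"
      by (simp add: e_def)
  qed (use pos in auto)
qed

section \<open>Backward initial value problems by Picard iteration\<close>

text \<open>\<open>has_derivative_sequence\<close> provides some limit function with the right
  derivative; uniqueness of pointwise limits identifies it with \<open>g\<close>.\<close>

lemma has_vector_derivative_uniform_limit:
  fixes f :: "nat \<Rightarrow> real \<Rightarrow> 'a::banach"
  assumes deriv: "\<And>n t. t \<in> {a..b} \<Longrightarrow> (f n has_vector_derivative f' n t) (at t within {a..b})"
    and unif: "uniform_limit {a..b} f' g' sequentially"
    and lim: "\<And>t. t \<in> {a..b} \<Longrightarrow> (\<lambda>n. f n t) \<longlonglongrightarrow> g t"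
    and t: "t \<in> {a..b}"
  shows "(g has_vector_derivative g' t) (at t within {a..b})"
proof -
  have "\<exists>g0. \<forall>t\<in>{a..b}. (\<lambda>n. f n t) \<longlonglongrightarrow> g0 t \<and> (g0 has_derivative (\<lambda>h. h *\<^sub>R g' t)) (at t within {a..b})"
  proof (rule has_derivative_sequence)
    show "(f n has_derivative (\<lambda>h. h *\<^sub>R f' n t)) (at t within {a..b})" if "t \<in> {a..b}" for n t
      using deriv[OF that] by (simp add: has_vector_derivative_def)
    fix e :: real assume "e > 0"
    then have "\<forall>\<^sub>F n in sequentially. \<forall>t\<in>{a..b}. dist (f' n t) (g' t) < e"
      using unif by (simp add: uniform_limit_iff)
    then show "\<forall>\<^sub>F n in sequentially. \<forall>t\<in>{a..b}. \<forall>h. norm (h *\<^sub>R f' n t - h *\<^sub>R g' t) \<le> e * norm h"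
    proof (rule eventually_mono, intro ballI allI)
      fix n s h
      assume "\<forall>t\<in>{a..b}. dist (f' n t) (g' t) < e" "s \<in> {a..b}"
      then have "\<bar>h\<bar> * norm (f' n s - g' s) \<le> \<bar>h\<bar> * e"
        by (intro mult_left_mono) (auto simp: dist_norm less_imp_le)
      then show "norm (h *\<^sub>R f' n s - h *\<^sub>R g' s) \<le> e * norm h"
        by (simp add: scaleR_right_diff_distrib[symmetric] mult.commute)
    qed
  qed (use t lim[OF t] in auto)
  then obtain g0 where g0: "\<And>t. t \<in> {a..b} \<Longrightarrow> (\<lambda>n. f n t) \<longlonglongrightarrow> g0 t"
      "\<And>t. t \<in> {a..b} \<Longrightarrow> (g0 has_vector_derivative g' t) (at t within {a..b})"
    unfolding has_vector_derivative_def by blast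
  have "g0 t = g t" if "t \<in> {a..b}" for t
    using LIMSEQ_unique[OF g0(1)[OF that] lim[OF that]] .
  then show ?thesis
    using has_vector_derivative_transform[OF t _ g0(2)[OF t], of g] by auto
qed

text \<open>The contraction is measured in the weighted norm
  \<open>sup (norm (y t) * exp (-2 * L * (b - t)))\<close>.\<close>

theorem picard_lindelof_backward:
  fixes f :: "real \<Rightarrow> 'a::banach \<Rightarrow> 'a" and x0 :: 'a
  assumes cont: "\<And>y. continuous_on {a..b} y \<Longrightarrow> continuous_on {a..b} (\<lambda>t. f t (y t))"
    and lip: "\<And>t x y. t \<in> {a..b} \<Longrightarrow> norm (f t x - f t y) \<le> L * norm (x - y)"
    and "a \<le> b" "0 < L"
  obtains x where "x b = x0" "\<And>t. t \<in> {a..b} \<Longrightarrow> (x has_vector_derivative f t (x t)) (at t within {a..b})"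
proof -
  define X where "X = rec_nat (\<lambda>_. x0) (\<lambda>_ y t. x0 - integral {t..b} (\<lambda>s. f s (y s)))"
  have X0: "X 0 = (\<lambda>_. x0)" by (simp add: X_def)
  have XS: "X (Suc k) t = x0 - integral {t..b} (\<lambda>s. f s (X k s))" for k t
    by (simp add: X_def)
  have Xcont: "continuous_on {a..b} (X k)" for k
  proof (induction k)
    case (Suc k)
    have "continuous_on {a..b} (\<lambda>t. x0 - integral {t..b} (\<lambda>s. f s (X k s)))"
      by (intro continuous_intros indefinite_integral_continuous_1' integrable_continuous_real cont Suc)
    then show ?case by (simp add: XS[abs_def])
  qed (simp add: X0)
  have Xderiv: "(X (Suc k) has_vector_derivative f t (X k t)) (at t within {a..b})" if "t \<in> {a..b}" for k t
    using has_vector_derivative_diff[OF has_vector_derivative_const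
        integral_has_vector_derivative'[OF cont[OF Xcont] that], of x0 k]
    by (simp add: XS[abs_def])
  have Xb: "X k b = x0" for k by (cases k) (simp_all add: X0 XS)
  have "compact ((\<lambda>t. X 1 t - X 0 t) ` {a..b})"
    by (intro compact_continuous_image continuous_intros Xcont) simp
  then obtain M where M: "0 < M" "\<And>t. t \<in> {a..b} \<Longrightarrow> norm (X 1 t - X 0 t) \<le> M"
    using compact_imp_bounded bounded_pos[of "(\<lambda>t. X 1 t - X 0 t) ` {a..b}"] by auto
  \<comment> \<open>Each iteration gains a factor \<open>1/2\<close>, since the integral of
    \<open>L * exp (2 * L * (b - s))\<close> over \<open>{t..b}\<close> is at most
    \<open>exp (2 * L * (b - t)) / 2\<close>.\<close>
  have diff: "norm (X (Suc k) t - X k t) \<le> M / 2 ^ k * exp (2 * L * (b - t))" if "t \<in> {a..b}" for k t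
    using that
  proof (induction k arbitrary: t)
    case 0
    have "1 \<le> exp (2 * L * (b - t))" using 0 \<open>0 < L\<close> by simp
    then have "M * 1 \<le> M * exp (2 * L * (b - t))" using M(1) by (intro mult_left_mono) auto
    with M(2)[OF 0] show ?case by simp
  next
    case (Suc k)
    define K where "K = L * (M / 2 ^ k)"
    define G where "G s = - (K / (2 * L)) * exp (2 * L * (b - s))" for s
    have int: "(\<lambda>s. f s (X j s)) integrable_on {t..b}" for j
      using integrable_continuous_real[OF continuous_on_subset[OF cont[OF Xcont]], of t b j] Suc.prems by auto
    have G: "((\<lambda>s. K * exp (2 * L * (b - s))) has_integral (G b - G t)) {t..b}"
    proof (rule fundamental_theorem_of_calculus)
      fix s assume "s \<in> {t..b}"
      have "(G has_real_derivative (K * exp (2 * L * (b - s)))) (at s within {t..b})"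
        unfolding G_def using \<open>0 < L\<close> by (auto intro!: derivative_eq_intros)
      then show "(G has_vector_derivative K * exp (2 * L * (b - s))) (at s within {t..b})"
        by (simp add: has_real_derivative_iff_has_vector_derivative)
    qed (use Suc in auto)
    have "norm (X (Suc (Suc k)) t - X (Suc k) t)
        = norm (integral {t..b} (\<lambda>s. f s (X (Suc k) s) - f s (X k s)))"
      unfolding integral_diff[OF int int] XS[of "Suc k" t] XS[of k t] by (simp add: norm_minus_commute)
    also have "\<dots> \<le> integral {t..b} (\<lambda>s. K * exp (2 * L * (b - s)))"
    proof (rule integral_norm_bound_integral)
      fix s assume "s \<in> {t..b}"
      then have s: "s \<in> {a..b}" using Suc.prems by auto
      have "norm (f s (X (Suc k) s) - f s (X k s)) \<le> L * norm (X (Suc k) s - X k s)" by (rule lip[OF s])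
      also have "\<dots> \<le> L * (M / 2 ^ k * exp (2 * L * (b - s)))"
        using Suc.IH[OF s] \<open>0 < L\<close> by (intro mult_left_mono) auto
      finally show "norm (f s (X (Suc k) s) - f s (X k s)) \<le> K * exp (2 * L * (b - s))"
        by (simp add: K_def)
    qed (use int G in \<open>auto intro: integrable_diff\<close>)
    also have "\<dots> = G b - G t" using G by (rule integral_unique)
    also have "\<dots> \<le> - G t" using \<open>0 < L\<close> M by (simp add: G_def K_def)
    also have "\<dots> = M / 2 ^ Suc k * exp (2 * L * (b - t))" using \<open>0 < L\<close> by (simp add: G_def K_def)
    finally show ?case .
  qed
  define x where "x t = x0 + (\<Sum>k. X (Suc k) t - X k t)" for t
  have "uniform_limit {a..b} (\<lambda>n t. \<Sum>k<n. X (Suc k) t - X k t) (\<lambda>t. \<Sum>k. X (Suc k) t - X k t) sequentially"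
  proof (rule Weierstrass_m_test)
    show "norm (X (Suc k) t - X k t) \<le> M * exp (2 * L * (b - a)) * (1 / 2) ^ k" if "t \<in> {a..b}" for k t
    proof -
      have "M / 2 ^ k * exp (2 * L * (b - t)) \<le> M / 2 ^ k * exp (2 * L * (b - a))"
        using that M \<open>0 < L\<close> by (intro mult_left_mono) auto
      with diff[OF that, of k] show ?thesis by (simp add: power_divide)
    qed
    show "summable (\<lambda>k. M * exp (2 * L * (b - a)) * (1 / 2) ^ k)"
      by (intro summable_mult summable_geometric) simp
  qed
  then have "uniform_limit {a..b} (\<lambda>n t. x0 + (\<Sum>k<n. X (Suc k) t - X k t)) x sequentially"
    unfolding x_def by (intro uniform_limit_intros)
  moreover have "x0 + (\<Sum>k<n. X (Suc k) t - X k t) = X n t" for n t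
    by (subst sum_lessThan_telescope) (simp add: X0)
  ultimately have unif: "uniform_limit {a..b} X x sequentially" by simp
  have unif': "uniform_limit {a..b} (\<lambda>n t. f t (X n t)) (\<lambda>t. f t (x t)) sequentially"
  proof (rule uniform_limitI)
    fix e :: real assume "e > 0"
    then have "\<forall>\<^sub>F n in sequentially. \<forall>t\<in>{a..b}. dist (X n t) (x t) < e / L"
      using unif \<open>0 < L\<close> by (simp add: uniform_limit_iff)
    then show "\<forall>\<^sub>F n in sequentially. \<forall>t\<in>{a..b}. dist (f t (X n t)) (f t (x t)) < e"
    proof (rule eventually_mono, intro ballI)
      fix n t assume *: "\<forall>t\<in>{a..b}. dist (X n t) (x t) < e / L" "t \<in> {a..b}"
      then have "L * norm (X n t - x t) < e"
        using \<open>0 < L\<close> by (simp add: dist_norm pos_less_divide_eq mult.commute)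
      with lip[OF *(2), of "X n t" "x t"] show "dist (f t (X n t)) (f t (x t)) < e"
        by (simp add: dist_norm)
    qed
  qed
  show ?thesis
  proof (rule that)
    show "x b = x0" by (simp add: x_def Xb)
    show "(x has_vector_derivative f t (x t)) (at t within {a..b})" if "t \<in> {a..b}" for t
    proof (rule has_vector_derivative_uniform_limit[OF Xderiv unif' _ that])
      fix t assume "t \<in> {a..b}"
      then show "(\<lambda>n. X (Suc n) t) \<longlonglongrightarrow> x t"
        using tendsto_uniform_limitI[OF unif] by (intro LIMSEQ_Suc) auto
    qed auto
  qed
qed

section \<open>Lipschitz estimates and comparison\<close>

text \<open>For \<open>D = p\<^sup>2 + q\<^sup>2\<close> the hypotheses give
  \<open>\<bar>D'\<bar> \<le> 4 * L * D\<close>. So \<open>D * exp (4 * L * z)\<close> increases,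
  which settles \<open>x \<le> y\<close>, and \<open>D * exp (- 4 * L * z)\<close> decreases, which
  settles the other case.\<close>

lemma two_sided_gronwall:
  fixes p q p' q' :: "real \<Rightarrow> real"
  assumes p: "\<And>z. z \<in> {a..b} \<Longrightarrow> (p has_real_derivative p' z) (at z within {a..b})"
    and q: "\<And>z. z \<in> {a..b} \<Longrightarrow> (q has_real_derivative q' z) (at z within {a..b})"
    and p': "\<And>z. z \<in> {a..b} \<Longrightarrow> \<bar>p' z\<bar> \<le> L * (\<bar>p z\<bar> + \<bar>q z\<bar>)"
    and q': "\<And>z. z \<in> {a..b} \<Longrightarrow> \<bar>q' z\<bar> \<le> L * (\<bar>p z\<bar> + \<bar>q z\<bar>)"
    and L: "0 \<le> L" and xy: "x \<in> {a..b}" "y \<in> {a..b}"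
  shows "(p x)\<^sup>2 + (q x)\<^sup>2 \<le> exp (4 * L * \<bar>x - y\<bar>) * ((p y)\<^sup>2 + (q y)\<^sup>2)"
proof -
  define D where "D z = (p z)\<^sup>2 + (q z)\<^sup>2" for z
  define D' where "D' z = 2 * p z * p' z + 2 * q z * q' z" for z
  have D: "(D has_real_derivative D' z) (at z within {a..b})" if "z \<in> {a..b}" for z
    unfolding D_def[abs_def] D'_def
    by (rule DERIV_cong[OF DERIV_add[OF DERIV_power[OF p[OF that]] DERIV_power[OF q[OF that]]]]) simp
  have bound: "\<bar>D' z\<bar> \<le> 4 * L * D z" if z: "z \<in> {a..b}" for z
  proof -
    have "\<bar>D' z\<bar> \<le> 2 * \<bar>p z\<bar> * \<bar>p' z\<bar> + 2 * \<bar>q z\<bar> * \<bar>q' z\<bar>"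
      unfolding D'_def by (rule order_trans[OF abs_triangle_ineq]) (simp add: abs_mult)
    also have "\<dots> \<le> 2 * \<bar>p z\<bar> * (L * (\<bar>p z\<bar> + \<bar>q z\<bar>)) + 2 * \<bar>q z\<bar> * (L * (\<bar>p z\<bar> + \<bar>q z\<bar>))"
      using p'[OF z] q'[OF z] by (intro add_mono mult_left_mono) auto
    also have "\<dots> = 2 * L * (\<bar>p z\<bar> + \<bar>q z\<bar>)\<^sup>2" by (simp add: power2_eq_square algebra_simps)
    also have "\<dots> \<le> 2 * L * (2 * D z)"
    proof (rule mult_left_mono)
      have "0 \<le> (\<bar>p z\<bar> - \<bar>q z\<bar>)\<^sup>2" by simp
      then show "(\<bar>p z\<bar> + \<bar>q z\<bar>)\<^sup>2 \<le> 2 * D z"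
        by (simp add: D_def power2_sum power2_diff)
    qed (use L in simp)
    finally show ?thesis by simp
  qed
  have E: "((\<lambda>z. exp (k * z)) has_real_derivative (k * exp (k * z))) (at z within {a..b})" for k z :: real
    by (auto intro!: derivative_eq_intros)
  show ?thesis
  proof (cases "x \<le> y")
    case True
    have "D x * exp (4 * L * x) \<le> D y * exp (4 * L * y)"
    proof (rule nondecreasing_if_deriv_nonneg[where f = "\<lambda>z. D z * exp (4 * L * z)" and a = a and b = b])
      show "((\<lambda>z. D z * exp (4 * L * z)) has_real_derivative
          D' z * exp (4 * L * z) + 4 * L * exp (4 * L * z) * D z) (at z within {a..b})" if "z \<in> {a..b}" for z
        by (rule DERIV_mult[OF D[OF that] E])
      fix z assume "z \<in> {a..b}"
      then have "0 \<le> exp (4 * L * z) * (D' z + 4 * L * D z)"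
        using bound[of z] by (intro mult_nonneg_nonneg) (simp, linarith)
      then show "0 \<le> D' z * exp (4 * L * z) + 4 * L * exp (4 * L * z) * D z"
        by (simp add: algebra_simps)
    qed (use xy True in auto)
    then have "D x * exp (4 * L * x) * exp (- (4 * L * x)) \<le> D y * exp (4 * L * y) * exp (- (4 * L * x))"
      by (rule mult_right_mono) simp
    moreover have "exp (4 * L * y) * exp (- (4 * L * x)) = exp (4 * L * \<bar>x - y\<bar>)"
      using True by (simp add: exp_add[symmetric] right_diff_distrib)
    moreover have "exp (4 * L * x) * exp (- (4 * L * x)) = 1" by (simp add: exp_add[symmetric])
    ultimately show ?thesis
      by (simp only: mult.assoc mult_1_right D_def) (simp add: mult.commute)
  next
    case False
    have "- (D y * exp (- (4 * L) * y)) \<le> - (D x * exp (- (4 * L) * x))"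
    proof (rule nondecreasing_if_deriv_nonneg[where f = "\<lambda>z. - (D z * exp (- (4 * L) * z))" and a = a and b = b])
      show "((\<lambda>z. - (D z * exp (- (4 * L) * z))) has_real_derivative
          - (D' z * exp (- (4 * L) * z) + - (4 * L) * exp (- (4 * L) * z) * D z)) (at z within {a..b})"
        if "z \<in> {a..b}" for z
        by (rule DERIV_minus[OF DERIV_mult[OF D[OF that] E]])
      fix z assume "z \<in> {a..b}"
      then have "0 \<le> exp (- (4 * L) * z) * (4 * L * D z - D' z)"
        using bound[of z] by (intro mult_nonneg_nonneg) (simp, linarith)
      then show "0 \<le> - (D' z * exp (- (4 * L) * z) + - (4 * L) * exp (- (4 * L) * z) * D z)"
        by (simp add: algebra_simps)
    qed (use xy False in auto)
    then have "D x * exp (- (4 * L) * x) * exp (4 * L * x) \<le> D y * exp (- (4 * L) * y) * exp (4 * L * x)"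
      by (intro mult_right_mono) auto
    moreover have "exp (- (4 * L) * y) * exp (4 * L * x) = exp (4 * L * \<bar>x - y\<bar>)"
      using False by (simp add: exp_add[symmetric] right_diff_distrib)
    moreover have "exp (- (4 * L) * x) * exp (4 * L * x) = 1" by (simp add: exp_add[symmetric])
    ultimately show ?thesis
      by (simp only: mult.assoc mult_1_right D_def) (simp add: mult.commute)
  qed
qed

section \<open>Lipschitz constants of the vector field\<close>

lemma tan_diff_bound:
  fixes x y c :: real
  assumes "0 < c" "c \<le> cos x" "c \<le> cos y"
  shows "\<bar>tan x - tan y\<bar> \<le> \<bar>x - y\<bar> / c\<^sup>2"
proof -
  have "0 < cos x" using assms by linarith
  moreover have "0 < cos y" using assms by linarith
  ultimately have "tan x - tan y = sin (x - y) / (cos x * cos y)"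
    by (simp add: tan_def sin_diff field_simps)
  then have "\<bar>tan x - tan y\<bar> = \<bar>sin (x - y)\<bar> / (cos x * cos y)"
    using assms by (simp add: abs_mult)
  also have "\<dots> \<le> \<bar>x - y\<bar> / (c * c)"
    using assms abs_sin_x_le_abs_x[of "x - y"] by (intro frac_le mult_mono) auto
  finally show ?thesis by (simp add: power2_eq_square)
qed

lemma cos_diff_bound: "\<bar>cos x - cos y\<bar> \<le> \<bar>x - y\<bar>" for x y :: real
proof -
  have "\<bar>cos x - cos y\<bar> = 2 * (\<bar>sin ((x + y) / 2)\<bar> * \<bar>sin ((y - x) / 2)\<bar>)"
    by (simp add: cos_diff_cos abs_mult)
  also have "\<dots> \<le> 2 * (1 * \<bar>(y - x) / 2\<bar>)"
    by (intro mult_left_mono mult_mono abs_sin_x_le_abs_x) auto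
  finally show ?thesis by simp
qed

lemma inverse_diff_bound:
  fixes x y c :: real
  assumes "0 < c" "c \<le> x" "c \<le> y"
  shows "\<bar>1 / x - 1 / y\<bar> \<le> \<bar>x - y\<bar> / c\<^sup>2"
proof -
  have "1 / x - 1 / y = (y - x) / (x * y)" using assms by (simp add: field_simps)
  then have "\<bar>1 / x - 1 / y\<bar> = \<bar>x - y\<bar> / (x * y)" using assms by (simp add: abs_mult)
  also have "\<dots> \<le> \<bar>x - y\<bar> / (c * c)"
    using assms by (intro frac_le mult_mono) auto
  finally show ?thesis by (simp add: power2_eq_square)
qed

text \<open>A common Lipschitz constant of both components of the vector field, in the sum norm, on
  the region \<open>r \<ge> \<rho>\<close>, \<open>cos \<theta> \<ge> c\<close>,
  \<open>0 \<le> z \<le> Z\<close>.\<close>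

definition field_lipschitz :: "nat \<Rightarrow> real \<Rightarrow> real \<Rightarrow> real \<Rightarrow> real" where
  "field_lipschitz m Z \<rho> c = 1 / c\<^sup>2 + real m * (Z / c\<^sup>2 + 1 / \<rho>\<^sup>2)"

lemma capillary_field_lipschitz:
  fixes x y u v z c \<rho> Z :: real
  assumes "0 < c" "c \<le> cos x" "c \<le> cos y" "0 < \<rho>" "\<rho> \<le> u" "\<rho> \<le> v" "0 \<le> z" "z \<le> Z"
  shows "\<bar>- tan x - - tan y\<bar> \<le> field_lipschitz m Z \<rho> c * (\<bar>u - v\<bar> + \<bar>x - y\<bar>)"
    and "\<bar>real m * (z / cos x - 1 / u) - real m * (z / cos y - 1 / v)\<bar>
          \<le> field_lipschitz m Z \<rho> c * (\<bar>u - v\<bar> + \<bar>x - y\<bar>)"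
proof -
  have nn: "0 \<le> 1 / c\<^sup>2" "0 \<le> 1 / \<rho>\<^sup>2" "0 \<le> Z / c\<^sup>2" using assms by auto
  have "\<bar>- tan x - - tan y\<bar> \<le> 1 / c\<^sup>2 * \<bar>x - y\<bar>"
    using tan_diff_bound[OF assms(1-3)] by simp
  also have "\<dots> \<le> field_lipschitz m Z \<rho> c * (\<bar>u - v\<bar> + \<bar>x - y\<bar>)"
    using nn by (intro mult_mono) (auto simp: field_lipschitz_def)
  finally show "\<bar>- tan x - - tan y\<bar> \<le> field_lipschitz m Z \<rho> c * (\<bar>u - v\<bar> + \<bar>x - y\<bar>)" .
  have "\<bar>cos x - cos y\<bar> / c\<^sup>2 \<le> \<bar>x - y\<bar> / c\<^sup>2" by (intro divide_right_mono cos_diff_bound) simp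
  then have "\<bar>1 / cos x - 1 / cos y\<bar> \<le> \<bar>x - y\<bar> / c\<^sup>2"
    using inverse_diff_bound[OF assms(1-3)] by simp
  then have "z * \<bar>1 / cos x - 1 / cos y\<bar> \<le> Z * (\<bar>x - y\<bar> / c\<^sup>2)"
    using assms by (intro mult_mono) auto
  moreover have "\<bar>z * (1 / cos x - 1 / cos y)\<bar> = z * \<bar>1 / cos x - 1 / cos y\<bar>"
    using assms by (simp add: abs_mult)
  ultimately have 1: "\<bar>z * (1 / cos x - 1 / cos y)\<bar> \<le> Z / c\<^sup>2 * \<bar>x - y\<bar>" by simp
  have 2: "\<bar>1 / u - 1 / v\<bar> \<le> 1 / \<rho>\<^sup>2 * \<bar>u - v\<bar>"
    using inverse_diff_bound[OF assms(4-6)] by simp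
  have "real m * (z / cos x - 1 / u) - real m * (z / cos y - 1 / v)
      = real m * (z * (1 / cos x - 1 / cos y) - (1 / u - 1 / v))" by (simp add: algebra_simps)
  then have "\<bar>real m * (z / cos x - 1 / u) - real m * (z / cos y - 1 / v)\<bar>
      = real m * \<bar>z * (1 / cos x - 1 / cos y) - (1 / u - 1 / v)\<bar>" by (simp only: abs_mult abs_of_nat)
  also have "\<dots> \<le> real m * (Z / c\<^sup>2 * \<bar>x - y\<bar> + 1 / \<rho>\<^sup>2 * \<bar>u - v\<bar>)"
    using 1 2 abs_triangle_ineq4[of "z * (1 / cos x - 1 / cos y)" "1 / u - 1 / v"]
    by (intro mult_left_mono) linarith+
  also have "\<dots> \<le> real m * ((Z / c\<^sup>2 + 1 / \<rho>\<^sup>2) * (\<bar>u - v\<bar> + \<bar>x - y\<bar>))"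
  proof (rule mult_left_mono)
    have "0 \<le> Z / c\<^sup>2 * \<bar>u - v\<bar>" "0 \<le> 1 / \<rho>\<^sup>2 * \<bar>x - y\<bar>" using nn by (intro mult_nonneg_nonneg; simp)+
    then show "Z / c\<^sup>2 * \<bar>x - y\<bar> + 1 / \<rho>\<^sup>2 * \<bar>u - v\<bar> \<le> (Z / c\<^sup>2 + 1 / \<rho>\<^sup>2) * (\<bar>u - v\<bar> + \<bar>x - y\<bar>)"
      unfolding distrib_left distrib_right by linarith
  qed simp
  also have "\<dots> \<le> field_lipschitz m Z \<rho> c * (\<bar>u - v\<bar> + \<bar>x - y\<bar>)"
    unfolding field_lipschitz_def mult.assoc[symmetric] using nn by (intro mult_right_mono) auto
  finally show "\<bar>real m * (z / cos x - 1 / u) - real m * (z / cos y - 1 / v)\<bar>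
          \<le> field_lipschitz m Z \<rho> c * (\<bar>u - v\<bar> + \<bar>x - y\<bar>)" .
qed

lemma capillary_comparison:
  assumes sol: "capillary_on m a b r \<theta>" "capillary_on m a b r' \<theta>'" and "0 < a" "0 < \<rho>" "0 < c"
    and bounds: "\<And>z. z \<in> {a..b} \<Longrightarrow> \<rho> \<le> r z \<and> c \<le> cos (\<theta> z)"
      "\<And>z. z \<in> {a..b} \<Longrightarrow> \<rho> \<le> r' z \<and> c \<le> cos (\<theta>' z)"
    and xy: "x \<in> {a..b}" "y \<in> {a..b}"
  shows "(r x - r' x)\<^sup>2 + (\<theta> x - \<theta>' x)\<^sup>2
    \<le> exp (4 * field_lipschitz m b \<rho> c * \<bar>x - y\<bar>) * ((r y - r' y)\<^sup>2 + (\<theta> y - \<theta>' y)\<^sup>2)"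
proof (rule two_sided_gronwall[OF DERIV_diff DERIV_diff _ _ _ xy])
  fix z assume z: "z \<in> {a..b}"
  note D = capillary_onD[OF sol(1) z] capillary_onD[OF sol(2) z]
  show "(r has_real_derivative (- tan (\<theta> z))) (at z within {a..b})"
    "(r' has_real_derivative (- tan (\<theta>' z))) (at z within {a..b})"
    "(\<theta> has_real_derivative (real m * (z / cos (\<theta> z) - 1 / r z))) (at z within {a..b})"
    "(\<theta>' has_real_derivative (real m * (z / cos (\<theta>' z) - 1 / r' z))) (at z within {a..b})"
    using D by auto
  have "0 \<le> z" "z \<le> b" using z \<open>0 < a\<close> by auto
  note lip = capillary_field_lipschitz[OF \<open>0 < c\<close> _ _ \<open>0 < \<rho>\<close> _ _ this, of "\<theta> z" "\<theta>' z" "r z" "r' z" m]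
  show "\<bar>- tan (\<theta> z) - - tan (\<theta>' z)\<bar> \<le> field_lipschitz m b \<rho> c * (\<bar>r z - r' z\<bar> + \<bar>\<theta> z - \<theta>' z\<bar>)"
    by (rule lip(1)) (use bounds[OF z] in auto)
  show "\<bar>real m * (z / cos (\<theta> z) - 1 / r z) - real m * (z / cos (\<theta>' z) - 1 / r' z)\<bar>
    \<le> field_lipschitz m b \<rho> c * (\<bar>r z - r' z\<bar> + \<bar>\<theta> z - \<theta>' z\<bar>)"
    by (rule lip(2)) (use bounds[OF z] in auto)
next
  have "0 \<le> b" using xy \<open>0 < a\<close> by auto
  then show "0 \<le> field_lipschitz m b \<rho> c" by (simp add: field_lipschitz_def)
qed

section \<open>Confinement by the Hamiltonian and backward solvability\<close>

text \<open>The first term of the Hamiltonian is nonnegative, so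
  \<open>\<rho> ^ m * cos \<theta> \<ge> h\<close>. Since \<open>cos \<theta> \<le> 1\<close>, this
  keeps \<open>\<rho>\<close> away from the axis, with \<open>min 1 h\<close> in place of an
  \<open>m\<close>-th root; since \<open>\<rho> \<le> 2 / w\<close>, it keeps
  \<open>cos \<theta>\<close> away from \<open>0\<close>. The bounds do not depend on
  \<open>z \<ge> w\<close>, which is what allows backward continuation.\<close>

lemma bounds_of_neg_hamiltonian:
  assumes H: "hamiltonian m z \<rho> \<theta> \<le> - h" and "0 < h" "0 < m" "0 < w" "w \<le> z" "0 < \<rho>"
  shows "min 1 h \<le> \<rho>" "h / (2 / w) ^ m \<le> cos \<theta>"
proof -
  have "0 < z" using assms by linarith
  have "hamiltonian m z \<rho> \<theta> < 0" using assms by linarith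
  then have "z * \<rho> \<le> 2" using neg_hamiltonian_imp(2)[of m z \<rho> \<theta>] assms \<open>0 < z\<close> by auto
  moreover have "w * \<rho> \<le> z * \<rho>" using assms by (intro mult_right_mono) auto
  ultimately have "w * \<rho> \<le> 2" by linarith
  then have le: "\<rho> \<le> 2 / w" using \<open>0 < w\<close> by (simp add: pos_le_divide_eq mult.commute)
  have "0 \<le> real m * z * \<rho> ^ Suc m / (real m + 1)" using \<open>0 < z\<close> \<open>0 < \<rho>\<close> by simp
  then have h: "h \<le> \<rho> ^ m * cos \<theta>" using H unfolding hamiltonian_def by linarith
  then have "0 < \<rho> ^ m * cos \<theta>" using \<open>0 < h\<close> by linarith
  then have c: "0 < cos \<theta>" using \<open>0 < \<rho>\<close> by (simp add: zero_less_mult_iff)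
  have "\<rho> ^ m * cos \<theta> \<le> \<rho> ^ m * 1" using \<open>0 < \<rho>\<close> by (intro mult_left_mono) auto
  with h have "h \<le> \<rho> ^ m" by simp
  moreover have "\<rho> ^ m \<le> \<rho> ^ 1" if "\<rho> \<le> 1" using that assms by (intro power_decreasing) auto
  ultimately show "min 1 h \<le> \<rho>" by (cases "\<rho> \<le> 1") auto
  have "\<rho> ^ m * cos \<theta> \<le> (2 / w) ^ m * cos \<theta>" using le c \<open>0 < \<rho>\<close> by (intro mult_right_mono power_mono) auto
  with h have "h \<le> (2 / w) ^ m * cos \<theta>" by linarith
  then show "h / (2 / w) ^ m \<le> cos \<theta>" using \<open>0 < w\<close> by (simp add: pos_divide_le_eq mult.commute)
qed

text \<open>Continuous induction from \<open>b\<close> downwards: at the last point \<open>s\<close>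
  with \<open>0 \<le> g s\<close>, continuity gives \<open>g \<le> 0\<close> on all of
  \<open>{s..b}\<close>, and \<open>step\<close> contradicts the choice of \<open>s\<close>. The
  premise of \<open>step\<close> is the closed condition \<open>g w \<le> 0\<close> in order to be
  available at \<open>s\<close> itself.\<close>

lemma negative_backward:
  fixes g :: "real \<Rightarrow> real"
  assumes cont: "continuous_on {a..b} g" and "g b < 0"
    and step: "\<And>z. z \<in> {a..b} \<Longrightarrow> (\<And>w. w \<in> {z..b} \<Longrightarrow> g w \<le> 0) \<Longrightarrow> g z < 0"
    and z: "z \<in> {a..b}"
  shows "g z < 0"
proof (rule ccontr)
  assume "\<not> g z < 0"
  define S where "S = {w \<in> {a..b}. 0 \<le> g w}"
  have "closed S"
    unfolding S_def using continuous_on_closed_Collect_le[OF continuous_on_const cont, of 0] by simp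
  moreover have "bounded S" by (rule bounded_subset[of "{a..b}"]) (auto simp: S_def)
  moreover have ne: "S \<noteq> {}" using \<open>\<not> g z < 0\<close> z by (auto simp: S_def)
  ultimately obtain s where s: "s \<in> S" "\<And>w. w \<in> S \<Longrightarrow> w \<le> s"
    using compact_attains_sup[of S] by (auto simp: compact_eq_bounded_closed)
  have sab: "s \<in> {a..b}" "0 \<le> g s" using s by (auto simp: S_def)
  have neg: "g w < 0" if "s < w" "w \<le> b" for w
    using s(2)[of w] that sab by (force simp: S_def)
  have "s < b" using sab \<open>g b < 0\<close> by (cases "s = b") auto
  have "g s \<le> 0"
  proof (rule tendsto_upperbound)
    have "continuous (at s within {s..b}) g"
      using continuous_on_subset[OF cont, of "{s..b}"] sab \<open>s < b\<close> by (auto simp: continuous_on_eq_continuous_within)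
    then show "(g \<longlongrightarrow> g s) (at s within {s..b})" by (simp add: continuous_within)
    show "\<forall>\<^sub>F w in at s within {s..b}. g w \<le> 0"
      unfolding eventually_at_filter
    proof (rule always_eventually, intro allI impI)
      fix w assume "w \<noteq> s" "w \<in> {s..b}"
      then show "g w \<le> 0" using neg[of w] by auto
    qed
    show "at s within {s..b} \<noteq> bot"
      using \<open>s < b\<close> by (simp add: trivial_limit_within islimpt_Icc)
  qed
  then have "g w \<le> 0" if "w \<in> {s..b}" for w
    using that neg[of w] by (cases "w = s") auto
  with step[OF sab(1)] sab(2) show False by fastforce
qed

text \<open>Picard iteration needs a globally Lipschitz field, so the field is truncated at half of
  the a priori bounds on \<open>r\<close> and \<open>cos \<theta>\<close>. While the trajectory
  stays in the closed truncated region it solves the true system, its Hamiltonian is at most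
  \<open>- h\<close>, and the a priori bounds then hold with a factor \<open>2\<close> to spare; by
  \<open>negative_backward\<close> it never leaves.\<close>

lemma capillary_backward_solution:
  assumes "0 < m" "0 < a" "a \<le> b" "0 < r0" "- (pi/2) < \<theta>0" "\<theta>0 < pi/2"
    and neg: "hamiltonian m b r0 \<theta>0 < 0"
  obtains r \<theta> where "capillary_on m a b r \<theta>" "r b = r0" "\<theta> b = \<theta>0"
proof -
  define h where "h = - hamiltonian m b r0 \<theta>0"
  define \<rho> where "\<rho> = min 1 h"
  define c where "c = h / (2 / a) ^ m"
  have h: "0 < h" using neg by (simp add: h_def)
  have pos: "0 < \<rho>" "0 < c" using h \<open>0 < a\<close> by (auto simp: \<rho>_def c_def)
  note init = bounds_of_neg_hamiltonian[OF _ h \<open>0 < m\<close> \<open>0 < a\<close> \<open>a \<le> b\<close> \<open>0 < r0\<close>, of \<theta>0]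
  have r0: "\<rho> \<le> r0" and \<theta>0: "c \<le> cos \<theta>0" using init by (auto simp: h_def \<rho>_def c_def)
  have "c \<le> 1" using \<theta>0 cos_le_one[of \<theta>0] by linarith
  \<comment> \<open>The angle at which the truncation \<open>cl\<close> sets in:
    \<open>cos \<alpha> = c / 2\<close>, strictly beyond every angle with cosine at least
    \<open>c\<close>.\<close>
  define \<alpha> where "\<alpha> = arccos (c / 2)"
  have \<alpha>: "0 < \<alpha>" "\<alpha> < pi/2" "cos \<alpha> = c / 2"
    using arccos_lt_bounded[of "c / 2"] arccos_less_arccos[of 0 "c / 2"] pos \<open>c \<le> 1\<close>
    by (auto simp: \<alpha>_def arccos_0)
  have small: "\<bar>x\<bar> < \<alpha>" if "c \<le> cos x" "- (pi/2) \<le> x" "x \<le> pi/2" for x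
  proof -
    have "cos \<alpha> < cos \<bar>x\<bar>" using that \<alpha> pos by simp
    then show ?thesis using that \<alpha> by (subst (asm) cos_mono_less_eq) auto
  qed
  define cl where "cl x = max (- \<alpha>) (min \<alpha> x)" for x
  have cl: "cl x = x" if "\<bar>x\<bar> \<le> \<alpha>" for x using that by (auto simp: cl_def)
  have cl_lip: "\<bar>cl x - cl y\<bar> \<le> \<bar>x - y\<bar>" for x y using \<alpha> by (auto simp: cl_def max_def min_def)
  have cl_cos: "c / 2 \<le> cos (cl x)" for x
  proof -
    have "\<bar>cl x\<bar> \<le> \<alpha>" using \<alpha> by (auto simp: cl_def)
    then have "cos \<alpha> \<le> cos \<bar>cl x\<bar>" using \<alpha> by (intro cos_monotone_0_pi_le) auto
    then show ?thesis using \<alpha> by simp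
  qed
  have cl_cos0: "cos (cl x) \<noteq> 0" for x using cl_cos[of x] pos by auto
  have cl_cont: "continuous_on UNIV cl" unfolding cl_def by (intro continuous_intros)
  define f :: "real \<Rightarrow> real \<times> real \<Rightarrow> real \<times> real" where
    "f t p = (- tan (cl (snd p)), real m * (t / cos (cl (snd p)) - 1 / max (\<rho>/2) (fst p)))" for t p
  define L where "L = field_lipschitz m b (\<rho>/2) (c/2)"
  have L: "0 < L"
    using pos \<open>0 < a\<close> \<open>a \<le> b\<close> unfolding L_def field_lipschitz_def by (intro add_pos_nonneg) auto
  obtain x where xb: "x b = (r0, \<theta>0)"
    and x: "\<And>t. t \<in> {a..b} \<Longrightarrow> (x has_vector_derivative f t (x t)) (at t within {a..b})"
  \<comment> \<open>The factor \<open>4\<close>: each of two components changes by at most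
    \<open>L\<close> times the sum of two coordinate differences, and each difference is at most the
    norm.\<close>
  proof (rule picard_lindelof_backward[of a b f "4 * L" "(r0, \<theta>0)"])
    fix y :: "real \<Rightarrow> real \<times> real" assume y: "continuous_on {a..b} y"
    have "continuous_on {a..b} (\<lambda>t. cl (snd (y t)))"
      using continuous_on_compose2[OF cl_cont continuous_on_snd[OF y]] by simp
    moreover have "max (\<rho>/2) u \<noteq> 0" for u using pos by (auto simp: max_def)
    ultimately show "continuous_on {a..b} (\<lambda>t. f t (y t))"
      unfolding f_def using cl_cos0 by (intro continuous_intros y) auto
  next
    fix t :: real and p q :: "real \<times> real" assume t: "t \<in> {a..b}"
    have rm: "\<bar>max (\<rho>/2) (fst p) - max (\<rho>/2) (fst q)\<bar> \<le> \<bar>fst p - fst q\<bar>" by (auto simp: max_def)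
    have "0 \<le> t" "t \<le> b" using t \<open>0 < a\<close> by auto
    note lip = capillary_field_lipschitz[where c = "c/2" and x = "cl (snd p)" and y = "cl (snd q)" and \<rho> = "\<rho>/2" and
        u = "max (\<rho>/2) (fst p)" and v = "max (\<rho>/2) (fst q)" and z = t and Z = b and m = m, folded L_def]
    have mx: "\<rho>/2 \<le> max (\<rho>/2) u" "0 < c/2" "0 < \<rho>/2" for u using pos by auto
    note lip = lip[OF mx(2) cl_cos cl_cos mx(3) mx(1) mx(1) \<open>0 \<le> t\<close> \<open>t \<le> b\<close>]
    have sum: "L * (\<bar>max (\<rho>/2) (fst p) - max (\<rho>/2) (fst q)\<bar> + \<bar>cl (snd p) - cl (snd q)\<bar>)
        \<le> L * (norm (p - q) + norm (p - q))"
      using L rm cl_lip[of "snd p" "snd q"] dist_fst_le[of p q] dist_snd_le[of p q]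
      by (intro mult_left_mono add_mono) (auto simp: dist_norm)
    have "norm (f t p - f t q) \<le> norm (fst (f t p - f t q)) + norm (snd (f t p - f t q))"
      by (metis norm_Pair_le prod.collapse)
    also have "\<dots> \<le> L * (norm (p - q) + norm (p - q)) + L * (norm (p - q) + norm (p - q))"
      using lip by (intro add_mono order_trans[OF _ sum]) (simp_all add: f_def)
    finally show "norm (f t p - f t q) \<le> 4 * L * norm (p - q)" by simp
  qed (use L \<open>a \<le> b\<close> in auto)
  define r \<theta> where "r t = fst (x t)" and "\<theta> t = snd (x t)" for t
  have dr: "(r has_real_derivative - tan (cl (\<theta> t))) (at t within {a..b})" if "t \<in> {a..b}" for t
    using bounded_linear.has_vector_derivative[OF bounded_linear_fst x[OF that]]
    by (simp add: has_real_derivative_iff_has_vector_derivative r_def[abs_def] \<theta>_def f_def)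
  have d\<theta>: "(\<theta> has_real_derivative real m * (t / cos (cl (\<theta> t)) - 1 / max (\<rho>/2) (r t))) (at t within {a..b})"
    if "t \<in> {a..b}" for t
    using bounded_linear.has_vector_derivative[OF bounded_linear_snd x[OF that]]
    by (simp add: has_real_derivative_iff_has_vector_derivative r_def \<theta>_def[abs_def] f_def)
  have sol: "capillary_on m z b r \<theta>"
    if "z \<in> {a..b}" and inside: "\<And>w. w \<in> {z..b} \<Longrightarrow> max (\<rho>/2 - r w) (\<bar>\<theta> w\<bar> - \<alpha>) \<le> 0" for z
    unfolding capillary_on_def
  proof
    fix w assume w: "w \<in> {z..b}"
    then have wab: "w \<in> {a..b}" and sub: "{z..b} \<subseteq> {a..b}" using that(1) by auto
    have "\<rho>/2 \<le> r w" "\<bar>\<theta> w\<bar> \<le> \<alpha>" using inside[OF w] by auto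
    moreover from this(2) have "- (pi/2) < \<theta> w" "\<theta> w < pi/2" using \<alpha> by linarith+
    ultimately show "0 < r w \<and> - (pi/2) < \<theta> w \<and> \<theta> w < pi/2 \<and>
      (r has_real_derivative - tan (\<theta> w)) (at w within {z..b}) \<and>
      (\<theta> has_real_derivative real m * (w / cos (\<theta> w) - 1 / r w)) (at w within {z..b})"
      using DERIV_subset[OF dr[OF wab] sub] DERIV_subset[OF d\<theta>[OF wab] sub] pos \<alpha>
      by (simp add: cl max_absorb2)
  qed
  have "max (\<rho>/2 - r z) (\<bar>\<theta> z\<bar> - \<alpha>) < 0" if "z \<in> {a..b}" for z
  proof (rule negative_backward[OF _ _ _ that])
    show "continuous_on {a..b} (\<lambda>z. max (\<rho>/2 - r z) (\<bar>\<theta> z\<bar> - \<alpha>))"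
      using DERIV_continuous_on[OF dr] DERIV_continuous_on[OF d\<theta>] by (intro continuous_intros) auto
    show "max (\<rho>/2 - r b) (\<bar>\<theta> b\<bar> - \<alpha>) < 0"
      using r0 \<theta>0 small[of \<theta>0] assms pos by (auto simp: r_def \<theta>_def xb)
    fix z assume z: "z \<in> {a..b}" and inside: "\<And>w. w \<in> {z..b} \<Longrightarrow> max (\<rho>/2 - r w) (\<bar>\<theta> w\<bar> - \<alpha>) \<le> 0"
    note S = sol[OF z inside]
    have "hamiltonian m z (r z) (\<theta> z) \<le> - h"
      using hamiltonian_mono[OF S, of z b] z by (simp add: h_def r_def \<theta>_def xb)
    note B = bounds_of_neg_hamiltonian[OF this h \<open>0 < m\<close> \<open>0 < a\<close>]
    have "0 < r z" "- (pi/2) < \<theta> z" "\<theta> z < pi/2" using capillary_onD[OF S, of z] z by auto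
    then show "max (\<rho>/2 - r z) (\<bar>\<theta> z\<bar> - \<alpha>) < 0"
      using B z pos small[of "\<theta> z"] by (auto simp: \<rho>_def[symmetric] c_def[symmetric])
  qed
  then have "capillary_on m a b r \<theta>" using \<open>a \<le> b\<close> by (intro sol) (auto intro: less_imp_le)
  moreover have "r b = r0" "\<theta> b = \<theta>0" by (auto simp: r_def \<theta>_def xb)
  ultimately show ?thesis by (rule that)
qed

section \<open>Existence\<close>

text \<open>Convergence at the single point \<open>y\<close> suffices: by
  \<open>capillary_comparison\<close> the distance of two members anywhere on the interval is a
  bounded multiple of their distance at \<open>y\<close>, so the sequence is uniformly Cauchy. The
  field is Lipschitz on the common region, so the derivatives converge uniformly as well.\<close>

lemma capillary_limit:
  fixes r \<theta> :: "nat \<Rightarrow> real \<Rightarrow> real"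
  assumes sol: "\<And>n. capillary_on m a b (r n) (\<theta> n)" and pos: "0 < a" "0 < \<rho>" "0 < c"
    and bounds: "\<And>n z. z \<in> {a..b} \<Longrightarrow> \<rho> \<le> r n z \<and> c \<le> cos (\<theta> n z)"
    and y: "y \<in> {a..b}" and conv: "Cauchy (\<lambda>n. r n y)" "Cauchy (\<lambda>n. \<theta> n y)"
  shows "\<And>z. z \<in> {a..b} \<Longrightarrow> convergent (\<lambda>n. r n z) \<and> convergent (\<lambda>n. \<theta> n z)"
    and "capillary_on m a b (\<lambda>z. lim (\<lambda>n. r n z)) (\<lambda>z. lim (\<lambda>n. \<theta> n z))"
proof -
  define L where "L = field_lipschitz m b \<rho> c"
  define E where "E = exp (4 * L * (b - a))"
  have ab: "a \<le> b" "0 < b" using y pos by auto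
  have L: "0 \<le> L" using ab by (simp add: L_def field_lipschitz_def)
  define X where "X n z = (r n z, \<theta> n z)" for n z
  have dist_X: "dist (X k z) (X n z) \<le> sqrt E * dist (X k y) (X n y)" if z: "z \<in> {a..b}" for k n z
  proof -
    have "(r k z - r n z)\<^sup>2 + (\<theta> k z - \<theta> n z)\<^sup>2
      \<le> exp (4 * L * \<bar>z - y\<bar>) * ((r k y - r n y)\<^sup>2 + (\<theta> k y - \<theta> n y)\<^sup>2)"
      unfolding L_def by (rule capillary_comparison[OF sol sol pos bounds bounds z y])
    also have "\<dots> \<le> E * ((r k y - r n y)\<^sup>2 + (\<theta> k y - \<theta> n y)\<^sup>2)"
    proof (rule mult_right_mono)
      have "4 * L * \<bar>z - y\<bar> \<le> 4 * L * (b - a)" using z y L by (intro mult_left_mono) auto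
      then show "exp (4 * L * \<bar>z - y\<bar>) \<le> E" by (simp add: E_def)
    qed simp
    finally show ?thesis
      by (simp add: X_def dist_Pair_Pair dist_real_def real_sqrt_mult[symmetric])
  qed
  have "Cauchy (\<lambda>n. X n y)"
  proof -
    obtain l1 l2 where "(\<lambda>n. r n y) \<longlonglongrightarrow> l1" "(\<lambda>n. \<theta> n y) \<longlonglongrightarrow> l2"
      using conv unfolding Cauchy_convergent_iff convergent_def by blast
    from tendsto_Pair[OF this] show ?thesis unfolding X_def by (rule LIMSEQ_imp_Cauchy)
  qed
  have "uniformly_Cauchy_on {a..b} X"
    unfolding uniformly_Cauchy_on_def
  proof (intro allI impI)
    fix e :: real assume "e > 0"
    have "sqrt E > 0" by (simp add: E_def)
    then obtain N where N: "\<And>k n. k \<ge> N \<Longrightarrow> n \<ge> N \<Longrightarrow> dist (X k y) (X n y) < e / sqrt E"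
      using \<open>Cauchy (\<lambda>n. X n y)\<close> \<open>e > 0\<close> unfolding Cauchy_def by (meson divide_pos_pos)
    show "\<exists>M. \<forall>x\<in>{a..b}. \<forall>k\<ge>M. \<forall>n\<ge>M. dist (X k x) (X n x) < e"
    proof (intro exI[of _ N] ballI allI impI)
      fix z k n assume "z \<in> {a..b}" "N \<le> k" "N \<le> n"
      then have "dist (X k z) (X n z) \<le> sqrt E * dist (X k y) (X n y)" by (intro dist_X)
      also have "\<dots> < sqrt E * (e / sqrt E)"
        using N[OF \<open>N \<le> k\<close> \<open>N \<le> n\<close>] \<open>sqrt E > 0\<close> by (intro mult_strict_left_mono) auto
      finally show "dist (X k z) (X n z) < e" using \<open>sqrt E > 0\<close> by simp
    qed
  qed
  then obtain x where x: "uniform_limit {a..b} X x sequentially"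
    using Cauchy_uniformly_convergent uniformly_convergent_on_def by blast
  have lim_r: "(\<lambda>n. r n z) \<longlonglongrightarrow> fst (x z)" and lim_\<theta>: "(\<lambda>n. \<theta> n z) \<longlonglongrightarrow> snd (x z)" if "z \<in> {a..b}" for z
    using tendsto_fst[OF tendsto_uniform_limitI[OF x that]] tendsto_snd[OF tendsto_uniform_limitI[OF x that]]
    by (simp_all add: X_def)
  then show "convergent (\<lambda>n. r n z) \<and> convergent (\<lambda>n. \<theta> n z)" if "z \<in> {a..b}" for z
    using that by (auto simp: convergent_def)
  define R \<Theta> where "R z = lim (\<lambda>n. r n z)" and "\<Theta> z = lim (\<lambda>n. \<theta> n z)" for z
  have R: "R z = fst (x z)" and \<Theta>: "\<Theta> z = snd (x z)" if "z \<in> {a..b}" for z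
    using limI[OF lim_r[OF that]] limI[OF lim_\<theta>[OF that]] by (simp_all add: R_def \<Theta>_def)
  have limits: "(\<lambda>n. r n z) \<longlonglongrightarrow> R z" "(\<lambda>n. \<theta> n z) \<longlonglongrightarrow> \<Theta> z" if "z \<in> {a..b}" for z
    using lim_r[OF that] lim_\<theta>[OF that] that by (simp_all add: R \<Theta>)
  have lb: "\<rho> \<le> R z" "c \<le> cos (\<Theta> z)" "- (pi/2) < \<Theta> z" "\<Theta> z < pi/2" if z: "z \<in> {a..b}" for z
  proof -
    show "\<rho> \<le> R z" by (rule LIMSEQ_le_const[OF limits(1)[OF z]]) (use bounds[OF z] in auto)
    show c: "c \<le> cos (\<Theta> z)"
      by (rule LIMSEQ_le_const[OF tendsto_cos[OF limits(2)[OF z]]]) (use bounds[OF z] in auto)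
    have "- (pi/2) \<le> \<Theta> z"
      by (rule LIMSEQ_le_const[OF limits(2)[OF z]]) (use capillary_onD[OF sol z] in \<open>auto intro: less_imp_le\<close>)
    moreover have "\<Theta> z \<le> pi/2"
      by (rule LIMSEQ_le_const2[OF limits(2)[OF z]]) (use less_imp_le[OF capillary_onD(3)[OF sol z]] in blast)
    \<comment> \<open>Limits preserve only the weak inequalities for the angle; the uniform bound
      \<open>c \<le> cos\<close> makes them strict again.\<close>
    moreover have "\<Theta> z \<noteq> - (pi/2)" "\<Theta> z \<noteq> pi/2"
      using c pos by (metis cos_pi_half cos_minus less_le_not_le)+
    ultimately show "- (pi/2) < \<Theta> z" "\<Theta> z < pi/2" by auto
  qed
  have field: "\<bar>- tan (\<theta> n z) - - tan (\<Theta> z)\<bar> \<le> L * (2 * dist (X n z) (x z))"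
      "\<bar>real m * (z / cos (\<theta> n z) - 1 / r n z) - real m * (z / cos (\<Theta> z) - 1 / R z)\<bar> \<le> L * (2 * dist (X n z) (x z))"
    if z: "z \<in> {a..b}" for n z
  proof -
    have "0 \<le> z" "z \<le> b" using z pos by auto
    note lip = capillary_field_lipschitz[OF pos(3) _ lb(2)[OF z] pos(2) _ lb(1)[OF z] this, of "\<theta> n z" "r n z" m, folded L_def]
    have "\<bar>r n z - R z\<bar> \<le> dist (X n z) (x z)" "\<bar>\<theta> n z - \<Theta> z\<bar> \<le> dist (X n z) (x z)"
      using dist_fst_le[of "X n z" "x z"] dist_snd_le[of "X n z" "x z"]
      by (simp_all add: X_def R[OF z] \<Theta>[OF z] dist_real_def)
    then have "L * (\<bar>r n z - R z\<bar> + \<bar>\<theta> n z - \<Theta> z\<bar>) \<le> L * (2 * dist (X n z) (x z))"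
      using L by (intro mult_left_mono) auto
    then show "\<bar>- tan (\<theta> n z) - - tan (\<Theta> z)\<bar> \<le> L * (2 * dist (X n z) (x z))"
      "\<bar>real m * (z / cos (\<theta> n z) - 1 / r n z) - real m * (z / cos (\<Theta> z) - 1 / R z)\<bar> \<le> L * (2 * dist (X n z) (x z))"
      using lip bounds[OF z, of n] by (meson order_trans)+
  qed
  have unif: "uniform_limit {a..b} g g' sequentially"
    if "\<And>n z. z \<in> {a..b} \<Longrightarrow> \<bar>g n z - g' z\<bar> \<le> L * (2 * dist (X n z) (x z))" for g :: "nat \<Rightarrow> real \<Rightarrow> real" and g'
  proof (rule uniform_limitI)
    fix e :: real assume "e > 0"
    have "\<forall>\<^sub>F n in sequentially. \<forall>z\<in>{a..b}. dist (X n z) (x z) < e / (2 * L + 1)"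
      using x \<open>e > 0\<close> L unfolding uniform_limit_iff by (simp add: add_nonneg_pos)
    then show "\<forall>\<^sub>F n in sequentially. \<forall>z\<in>{a..b}. dist (g n z) (g' z) < e"
    proof (rule eventually_mono, intro ballI)
      fix n z assume *: "\<forall>z\<in>{a..b}. dist (X n z) (x z) < e / (2 * L + 1)" "z \<in> {a..b}"
      have "\<bar>g n z - g' z\<bar> \<le> L * (2 * dist (X n z) (x z))" by (rule that[OF *(2)])
      also have "\<dots> \<le> (2 * L + 1) * dist (X n z) (x z)" by (simp add: algebra_simps)
      also have "\<dots> < e" using * L by (simp add: pos_less_divide_eq mult.commute)
      finally show "dist (g n z) (g' z) < e" by (simp add: dist_real_def)
    qed
  qed
  show "capillary_on m a b (\<lambda>z. lim (\<lambda>n. r n z)) (\<lambda>z. lim (\<lambda>n. \<theta> n z))"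
    unfolding capillary_on_def R_def[symmetric] \<Theta>_def[symmetric]
  proof
    fix z assume z: "z \<in> {a..b}"
    have "(R has_vector_derivative - tan (\<Theta> z)) (at z within {a..b})"
      by (rule has_vector_derivative_uniform_limit[OF _ unif[OF field(1)] limits(1) z])
        (use capillary_onD(5)[OF sol] in \<open>auto simp: has_real_derivative_iff_has_vector_derivative\<close>)
    moreover have "(\<Theta> has_vector_derivative real m * (z / cos (\<Theta> z) - 1 / R z)) (at z within {a..b})"
      by (rule has_vector_derivative_uniform_limit[OF _ unif[OF field(2)] limits(2) z])
        (use capillary_onD(6)[OF sol] in \<open>auto simp: has_real_derivative_iff_has_vector_derivative\<close>)
    ultimately show "0 < R z \<and> - (pi/2) < \<Theta> z \<and> \<Theta> z < pi/2 \<and>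
      (R has_real_derivative - tan (\<Theta> z)) (at z within {a..b}) \<and>
      (\<Theta> has_real_derivative real m * (z / cos (\<Theta> z) - 1 / R z)) (at z within {a..b})"
      using lb[OF z] pos by (simp add: has_real_derivative_iff_has_vector_derivative)
  qed
qed

lemma capillary_solution_if_on:
  assumes "\<And>k::nat. k0 \<le> k \<Longrightarrow> capillary_on m (1 / real k) (real k) r \<theta>"
  shows "capillary_solution (Suc m) r \<theta>"
  unfolding capillary_solution_def
proof (intro allI impI)
  fix z :: real assume "0 < z"
  obtain k1 :: nat where "max z (1 / z) < real k1" using reals_Archimedean2 by blast
  define k where "k = max k0 k1"
  have k: "z < real k" "1 / z < real k" using \<open>max z (1 / z) < real k1\<close> by (auto simp: k_def)
  then have "1 / real k < z" using \<open>0 < z\<close> by (simp add: field_simps)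
  then have "at z within {1 / real k..real k} = at z" using k by (intro at_within_Icc_at) auto
  then show "0 < r z \<and> - (pi/2) < \<theta> z \<and> \<theta> z < pi/2 \<and>
    (r has_real_derivative - tan (\<theta> z)) (at z) \<and>
    (\<theta> has_real_derivative (real (Suc m) - 1) * (z / cos (\<theta> z) - 1 / r z)) (at z)"
    using capillary_onD[OF assms, of k z] \<open>1 / real k < z\<close> k by (simp add: k_def)
qed

theorem capillary_solution_exists:
  assumes m: "0 < m"
  obtains r \<theta> where "capillary_solution (Suc m) r \<theta>"
proof -
  obtain \<kappa> C where C: "0 < C"
    and decay: "\<And>a b r \<theta>. capillary_on m a b r \<theta> \<Longrightarrow> 0 < a \<Longrightarrow> a \<le> b \<Longrightarrow> hamiltonian m b (r b) (\<theta> b) < 0 \<Longrightarrow>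
      excess m (a * r a) (cos (\<theta> a)) \<le> C / a ^ 4 + 3 * (a / b) powr \<kappa> * excess m (b * r b) (cos (\<theta> b))"
    using excess_decay[OF m] by metis
  have e1: "excess m 1 1 = 0" by (simp add: excess_decomposition)
  \<comment> \<open>The final data have \<open>R = 1\<close> and \<open>cos \<theta> = 1\<close>, so
    their excess is zero: the Hamiltonian is negative there, and the final term in
    \<open>decay\<close> disappears.\<close>
  have "\<exists>r \<theta>. capillary_on m (1 / real N) (real N) r \<theta> \<and> r (real N) = 1 / real N \<and> \<theta> (real N) = 0"
    if "0 < N" for N :: nat
  proof -
    have N: "1 \<le> real N" using that by simp
    have "1 / real N \<le> 1" using N by simp
    then have le: "1 / real N \<le> real N" using N by linarith
    have "hamiltonian m (real N) (1 / real N) 0 < 0"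
      using N e1 by (subst hamiltonian_eq_excess) (auto simp: divide_less_0_iff)
    from capillary_backward_solution[OF m _ le _ _ _ this] N show ?thesis
      by (metis divide_pos_pos less_le_trans neg_less_0_iff_less pi_half_gt_zero zero_less_one)
  qed
  then obtain r \<theta> where sol: "\<And>N. 0 < N \<Longrightarrow> capillary_on m (1 / real N) (real N) (r N) (\<theta> N)"
    and final: "\<And>N. 0 < N \<Longrightarrow> r N (real N) = 1 / real N" "\<And>N. 0 < N \<Longrightarrow> \<theta> N (real N) = 0"
    by metis
  \<comment> \<open>For \<open>k \<ge> k0\<close>, \<open>C / k ^ 4\<close> is at most half of the
    threshold \<open>1 / (m + 1)\<close> at which the Hamiltonian vanishes. Hence at
    \<open>z = k\<close> the Hamiltonian is at most \<open>- h k\<close> for all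
    \<open>N \<ge> k\<close>; by monotonicity this confines these approximations on
    \<open>{1 / k..k}\<close> uniformly in \<open>N\<close>.\<close>
  obtain k0 :: nat where "max 1 (2 * (real m + 1) * C) < real k0" using reals_Archimedean2 by blast
  then have k0: "0 < k0" "2 * (real m + 1) * C < real k0" by auto
  define h where "h k = 1 / (2 * (real m + 1)) / real k ^ m" for k :: nat
  define \<rho> where "\<rho> k = min 1 (h k)" for k
  define c where "c k = h k / (2 / (1 / real k)) ^ m" for k
  have pos: "0 < h k" "0 < \<rho> k" "0 < c k" if "0 < k" for k
    using that by (auto simp: h_def \<rho>_def c_def)
  have sub: "capillary_on m (1 / real k) (real k) (r N) (\<theta> N)" if "0 < k" "k \<le> N" for k N
    by (rule capillary_on_subset[OF sol]) (use that in \<open>auto simp: frac_le\<close>)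
  have ham: "hamiltonian m (real k) (r N (real k)) (\<theta> N (real k)) \<le> - h k" if k: "k0 \<le> k" "k \<le> N" for k N
  proof -
    have "0 < k" "0 < N" using k k0 by auto
    have "real k \<le> real k ^ 4" using \<open>0 < k\<close> self_le_power[of "real k" 4] by simp
    then have "2 * (real m + 1) * C \<le> real k ^ 4" using k0 k by linarith
    then have "C \<le> 1 / (2 * (real m + 1)) * real k ^ 4" by (simp add: pos_le_divide_eq mult.commute)
    then have small: "C / real k ^ 4 \<le> 1 / (2 * (real m + 1))"
      using \<open>0 < k\<close> by (simp add: pos_divide_le_eq)
    have order_arith: "y - p \<le> - q" if "y \<le> x" "x \<le> q" "p = 2 * q" for p q x y :: real using that by linarith
    have half: "1 / x = 2 * (1 / (2 * x))" for x :: real by simp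
    have "hamiltonian m (real N) (r N (real N)) (\<theta> N (real N)) < 0"
      using \<open>0 < N\<close> e1 by (subst hamiltonian_eq_excess) (auto simp: final divide_less_0_iff)
    moreover have "capillary_on m (real k) (real N) (r N) (\<theta> N)"
    proof (rule capillary_on_subset[OF sol[OF \<open>0 < N\<close>]])
      have "1 / real N \<le> 1" "1 \<le> real k" using \<open>0 < k\<close> \<open>0 < N\<close> by auto
      then show "1 / real N \<le> real k" by linarith
    qed simp
    ultimately have "excess m (real k * r N (real k)) (cos (\<theta> N (real k))) \<le> C / real k ^ 4"
      using decay[of "real k" "real N" "r N" "\<theta> N"] \<open>0 < k\<close> \<open>0 < N\<close> k e1 by (simp add: final)
    then have "excess m (real k * r N (real k)) (cos (\<theta> N (real k))) - 1 / (real m + 1) \<le> - (1 / (2 * (real m + 1)))"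
      using small half[of "real m + 1"] order_arith by blast
    then have "(excess m (real k * r N (real k)) (cos (\<theta> N (real k))) - 1 / (real m + 1)) / real k ^ m
        \<le> - (1 / (2 * (real m + 1))) / real k ^ m"
      by (rule divide_right_mono) simp
    then show ?thesis using \<open>0 < k\<close> by (simp add: hamiltonian_eq_excess h_def)
  qed
  have bounds: "\<rho> k \<le> r N z \<and> c k \<le> cos (\<theta> N z)"
    if k: "k0 \<le> k" "k \<le> N" and z: "z \<in> {1 / real k..real k}" for k N z
  proof -
    have "0 < k" using k k0 by auto
    note S = sub[OF \<open>0 < k\<close> k(2)]
    have "hamiltonian m z (r N z) (\<theta> N z) \<le> - h k"
      using hamiltonian_mono[OF S, of z "real k"] ham[OF k] z by auto
    from bounds_of_neg_hamiltonian[OF this pos(1)[OF \<open>0 < k\<close>] m, of "1 / real k"] capillary_onD(1)[OF S z] z \<open>0 < k\<close>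
    show ?thesis by (simp add: \<rho>_def c_def)
  qed
  \<comment> \<open>Compactness is needed at the one point \<open>z = 1\<close> only;
    \<open>capillary_limit\<close> carries convergence from there to every interval, so one
    subsequence works for all of them and no diagonal argument arises.\<close>
  define p where "p n = (r (n + k0) 1, \<theta> (n + k0) 1)" for n
  have mem: "(1::real) \<in> {1 / real k..real k}" if "0 < k" for k using that by auto
  have "p n \<in> {0..2} \<times> {- (pi/2)..pi/2}" for n
  proof -
    have S: "capillary_on m (1 / real k0) (real k0) (r (n + k0)) (\<theta> (n + k0))" using sub k0 by auto
    have "hamiltonian m 1 (r (n + k0) 1) (\<theta> (n + k0) 1) \<le> - h k0"
      using hamiltonian_mono[OF S, of 1 "real k0"] ham[of k0 "n + k0"] k0 by auto
    then have "hamiltonian m 1 (r (n + k0) 1) (\<theta> (n + k0) 1) < 0" using pos(1)[OF k0(1)] by linarith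
    from neg_hamiltonian_imp(2)[OF this m] capillary_onD(1-3)[OF S mem[OF k0(1)]]
    show ?thesis by (simp add: p_def)
  qed
  moreover have "compact ({0..2} \<times> {- (pi/2)..pi/2} :: (real \<times> real) set)"
    by (intro compact_Times compact_Icc)
  ultimately obtain l \<sigma> where \<sigma>: "strict_mono \<sigma>" and l: "(p \<circ> \<sigma>) \<longlonglongrightarrow> l"
    unfolding compact_def by metis
  define rs \<theta>s where "rs n = r (\<sigma> n + k0)" and "\<theta>s n = \<theta> (\<sigma> n + k0)" for n
  have Cauchy_1: "Cauchy (\<lambda>n. rs (n + k) 1)" "Cauchy (\<lambda>n. \<theta>s (n + k) 1)" for k
    using tendsto_fst[OF l] tendsto_snd[OF l]
    by (auto simp: p_def rs_def \<theta>s_def intro!: LIMSEQ_imp_Cauchy LIMSEQ_ignore_initial_segment)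
  \<comment> \<open>Only approximations with index at least \<open>k\<close> are known to live on
    \<open>{1 / k..k}\<close>. Shifting the subsequence by \<open>k\<close> ensures this and does
    not change its limit, so the limit functions for different \<open>k\<close> coincide.\<close>
  have large: "k \<le> \<sigma> (n + k) + k0" for k n
    using seq_suble[OF \<sigma>, of "n + k"] by linarith
  have "capillary_on m (1 / real k) (real k) (\<lambda>z. lim (\<lambda>n. rs n z)) (\<lambda>z. lim (\<lambda>n. \<theta>s n z))" if k: "k0 \<le> k" for k
  proof -
    have "0 < k" using k k0 by auto
    have sol_k: "capillary_on m (1 / real k) (real k) (rs (n + k)) (\<theta>s (n + k))" for n
      unfolding rs_def \<theta>s_def using sub[OF \<open>0 < k\<close> large] .
    have bounds_k: "\<rho> k \<le> rs (n + k) z \<and> c k \<le> cos (\<theta>s (n + k) z)" if "z \<in> {1 / real k..real k}" for n z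
      unfolding rs_def \<theta>s_def using bounds[OF k large that] .
    have inv: "0 < 1 / real k" using \<open>0 < k\<close> by simp
    have limit1: "convergent (\<lambda>n. rs (n + k) z) \<and> convergent (\<lambda>n. \<theta>s (n + k) z)"
      if "z \<in> {1 / real k..real k}" for z
      by (rule capillary_limit(1)[where r = "\<lambda>n. rs (n + k)" and \<theta> = "\<lambda>n. \<theta>s (n + k)",
        OF sol_k inv pos(2,3)[OF \<open>0 < k\<close>] _ mem[OF \<open>0 < k\<close>] Cauchy_1 that]) (rule bounds_k)
    have limit2: "capillary_on m (1 / real k) (real k) (\<lambda>z. lim (\<lambda>n. rs (n + k) z)) (\<lambda>z. lim (\<lambda>n. \<theta>s (n + k) z))"
      by (rule capillary_limit(2)[where r = "\<lambda>n. rs (n + k)" and \<theta> = "\<lambda>n. \<theta>s (n + k)",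
        OF sol_k inv pos(2,3)[OF \<open>0 < k\<close>] _ mem[OF \<open>0 < k\<close>] Cauchy_1]) (rule bounds_k)
    have eq: "lim (\<lambda>n. rs (n + k) z) = lim (\<lambda>n. rs n z)" "lim (\<lambda>n. \<theta>s (n + k) z) = lim (\<lambda>n. \<theta>s n z)"
      if "z \<in> {1 / real k..real k}" for z
      using limit1[OF that]
      by (auto simp: convergent_LIMSEQ_iff intro!: limI[symmetric] intro: LIMSEQ_offset[of _ k])
    show ?thesis
      unfolding capillary_on_def
    proof
      fix z assume z: "z \<in> {1 / real k..real k}"
      note D = capillary_onD[OF limit2 z, unfolded eq[OF z]]
      show "0 < lim (\<lambda>n. rs n z) \<and> - (pi/2) < lim (\<lambda>n. \<theta>s n z) \<and> lim (\<lambda>n. \<theta>s n z) < pi/2 \<and>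
        ((\<lambda>z. lim (\<lambda>n. rs n z)) has_real_derivative - tan (lim (\<lambda>n. \<theta>s n z))) (at z within {1 / real k..real k}) \<and>
        ((\<lambda>z. lim (\<lambda>n. \<theta>s n z)) has_real_derivative
          real m * (z / cos (lim (\<lambda>n. \<theta>s n z)) - 1 / lim (\<lambda>n. rs n z))) (at z within {1 / real k..real k})"
        using D(1-3) has_field_derivative_transform_within[OF D(5) zero_less_one z eq(1)]
          has_field_derivative_transform_within[OF D(6) zero_less_one z eq(2)] by blast
    qed
  qed
  then show ?thesis by (rule that[OF capillary_solution_if_on])
qed

section \<open>Decay of global solutions\<close>

lemma global_neg_hamiltonian:
  assumes sol: "capillary_solution (Suc m) r \<theta>" and m: "0 < m" and "0 < w"
  shows "hamiltonian m w (r w) (\<theta> w) < 0"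
proof (rule ccontr)
  assume "\<not> hamiltonian m w (r w) (\<theta> w) < 0"
  \<comment> \<open>On this length a slope of at least \<open>w / 2\<close> raises the angle by
    \<open>\<pi>\<close>, which the open range of \<open>\<theta>\<close> forbids.\<close>
  define b where "b = w + 2 * pi / w"
  have "w \<le> b" using \<open>0 < w\<close> by (simp add: b_def)
  have S: "capillary_on m w b r \<theta>" by (rule capillary_solution_imp_on[OF sol \<open>0 < w\<close>])
  have "\<theta> w - w / 2 * w \<le> \<theta> b - w / 2 * b"
  proof (rule nondecreasing_if_deriv_nonneg[where f = "\<lambda>z. \<theta> z - w / 2 * z" and a = w and b = b])
    show "((\<lambda>z. \<theta> z - w / 2 * z) has_real_derivative real m * (z / cos (\<theta> z) - 1 / r z) - w / 2) (at z within {w..b})"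
      if "z \<in> {w..b}" for z
      by (rule DERIV_diff[OF capillary_onD(6)[OF S that] DERIV_cmult_Id])
    fix z assume z: "z \<in> {w..b}"
    note D = capillary_onD[OF S z]
    have "0 < z" "w \<le> z" using z \<open>0 < w\<close> by auto
    define \<mu> c \<rho> where "\<mu> = real m" and "c = cos (\<theta> z)" and "\<rho> = r z"
    have pos: "1 \<le> \<mu>" "0 < c" "c \<le> 1" "0 < \<rho>" using m D by (auto simp: \<mu>_def c_def \<rho>_def)
    have "0 \<le> hamiltonian m z (r z) (\<theta> z)"
      using hamiltonian_mono[OF S, of w z] z \<open>\<not> hamiltonian m w (r w) (\<theta> w) < 0\<close> by auto
    then have "\<rho> ^ m * c \<le> \<mu> * z * (\<rho> * \<rho> ^ m) / (\<mu> + 1)" by (simp add: hamiltonian_def \<mu>_def c_def \<rho>_def)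
    then have "\<rho> ^ m * ((\<mu> + 1) * c) \<le> \<rho> ^ m * (\<mu> * z * \<rho>)" using pos by (simp add: pos_le_divide_eq algebra_simps)
    then have "(\<mu> + 1) * c \<le> \<mu> * z * \<rho>" using pos by (simp add: mult_le_cancel_left_pos)
    \<comment> \<open>A nonnegative Hamiltonian bounds the restoring term \<open>1 / \<rho>\<close>
      by the fraction \<open>\<mu> / (\<mu> + 1)\<close> of \<open>z / c\<close>, so the remaining
      rate is \<open>\<mu> / (\<mu> + 1) * (z / c)\<close>, at least \<open>z / 2\<close>.\<close>
    then have "1 / \<rho> \<le> \<mu> * z / ((\<mu> + 1) * c)" using pos by (simp add: pos_le_divide_eq pos_divide_le_eq)
    then have "\<mu> * (z / c - \<mu> * z / ((\<mu> + 1) * c)) \<le> \<mu> * (z / c - 1 / \<rho>)"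
      using pos by (intro mult_left_mono) auto
    moreover have "\<mu> * (z / c - \<mu> * z / ((\<mu> + 1) * c)) = \<mu> / (\<mu> + 1) * (z / c)"
      using pos by (simp add: divide_simps) (simp add: algebra_simps)
    moreover have "1 / 2 * z \<le> \<mu> / (\<mu> + 1) * (z / c)"
    proof (rule mult_mono)
      show "1 / 2 \<le> \<mu> / (\<mu> + 1)" using pos by (simp add: pos_le_divide_eq)
      have "z * c \<le> z * 1" using pos \<open>0 < z\<close> by (intro mult_left_mono) auto
      then show "z \<le> z / c" using pos by (simp add: pos_le_divide_eq)
    qed (use pos \<open>0 < z\<close> in auto)
    ultimately have "w / 2 \<le> \<mu> * (z / c - 1 / \<rho>)" using \<open>w \<le> z\<close> by linarith
    then show "0 \<le> real m * (z / cos (\<theta> z) - 1 / r z) - w / 2" by (simp add: \<mu>_def c_def \<rho>_def)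
  qed (use \<open>w \<le> b\<close> in auto)
  moreover have "w / 2 * b = w / 2 * w + pi" using \<open>0 < w\<close> by (simp add: b_def field_simps)
  ultimately have "\<theta> w + pi \<le> \<theta> b" by linarith
  then show False using capillary_onD(2)[OF S, of w] capillary_onD(3)[OF S, of b] \<open>w \<le> b\<close> by auto
qed

text \<open>For a global solution the excess stays at most \<open>1\<close>, so the final term of
  \<open>excess_decay\<close> vanishes as \<open>b\<close> tends to infinity. The constant is the
  same for all global solutions, as the comparison of two of them requires.\<close>

theorem global_decay:
  assumes m: "0 < m"
  obtains C where "0 < C"
    "\<And>r \<theta> z. capillary_solution (Suc m) r \<theta> \<Longrightarrow> 0 < z \<Longrightarrow> \<bar>z * r z - 1\<bar> \<le> C / z\<^sup>2 \<and> \<bar>sin (\<theta> z)\<bar> \<le> C / z\<^sup>2"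
proof -
  obtain \<kappa> C where \<kappa>: "0 < \<kappa>" and C: "0 < C"
    and decay: "\<And>a b r \<theta>. capillary_on m a b r \<theta> \<Longrightarrow> 0 < a \<Longrightarrow> a \<le> b \<Longrightarrow> hamiltonian m b (r b) (\<theta> b) < 0 \<Longrightarrow>
      excess m (a * r a) (cos (\<theta> a)) \<le> C / a ^ 4 + 3 * (a / b) powr \<kappa> * excess m (b * r b) (cos (\<theta> b))"
    using excess_decay[OF m] by metis
  obtain K where K: "0 < K"
    and sinK: "\<And>R c s. 0 < R \<Longrightarrow> 0 < c \<Longrightarrow> c \<le> 1 \<Longrightarrow> s\<^sup>2 + c\<^sup>2 = 1 \<Longrightarrow> s\<^sup>2 \<le> K * excess m R c"
    using sin_squared_le_excess[OF m] by metis
  \<comment> \<open>The two entries convert the bound on the excess into bounds on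
    \<open>(R - 1)\<^sup>2\<close> and \<open>(sin \<theta>)\<^sup>2\<close>; the square root then
    halves the exponent of \<open>z ^ 4\<close>.\<close>
  define Q where "Q = max ((real m + 1) * C) (K * C)"
  have "0 < Q" using C by (simp add: Q_def less_max_iff_disj)
  show ?thesis
  proof (rule that[of "sqrt Q"])
    fix r \<theta> and z :: real assume sol: "capillary_solution (Suc m) r \<theta>" and z: "0 < z"
    have S: "capillary_on m z b r \<theta>" for b by (rule capillary_solution_imp_on[OF sol z])
    have D: "0 < r y" "0 < cos (\<theta> y)" if "z \<le> y" for y
      using capillary_onD(1,4)[OF S[of y], of y] that by auto
    define e where "e y = excess m (y * r y) (cos (\<theta> y))" for y
    have le: "e z \<le> C / z ^ 4 + 3 * (z / b) powr \<kappa>" if "z \<le> b" for b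
    proof -
      have neg: "hamiltonian m b (r b) (\<theta> b) < 0" using global_neg_hamiltonian[OF sol m, of b] z that by auto
      have "e b \<le> 1" unfolding e_def using neg_hamiltonian_imp(3)[OF neg m] D[OF that] z that by auto
      then have "3 * (z / b) powr \<kappa> * e b \<le> 3 * (z / b) powr \<kappa> * 1" by (intro mult_left_mono) auto
      then show ?thesis using decay[OF S z that neg] by (simp add: e_def)
    qed
    have "((\<lambda>b. C / z ^ 4 + 3 * (z / b) powr \<kappa>) \<longlongrightarrow> C / z ^ 4 + 3 * 0) at_top"
    proof (intro tendsto_intros tendsto_zero_powrI)
      show "((\<lambda>b. z / b) \<longlongrightarrow> 0) at_top"
        by (rule real_tendsto_divide_at_top[OF tendsto_const filterlim_ident])
      show "\<forall>\<^sub>F b in at_top. 0 \<le> z / b"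
        using eventually_ge_at_top[of 0] by eventually_elim (use z in auto)
    qed (use \<kappa> in auto)
    moreover have "\<forall>\<^sub>F b in at_top. e z \<le> C / z ^ 4 + 3 * (z / b) powr \<kappa>"
      using eventually_ge_at_top[of z] by eventually_elim (rule le)
    ultimately have "e z \<le> C / z ^ 4 + 3 * 0"
      by (rule tendsto_lowerbound) simp
    then have ez: "e z \<le> C / z ^ 4" by simp
    have root: "\<bar>x\<bar> \<le> sqrt Q / z\<^sup>2" if "x\<^sup>2 \<le> p * e z" "0 < p" "p * C \<le> Q" for x p
    proof (rule power2_le_imp_le)
      have "x\<^sup>2 \<le> p * (C / z ^ 4)" using that(1,2) ez by (meson mult_left_mono less_imp_le order_trans)
      also have "\<dots> \<le> Q / z ^ 4" using that(3) by (simp add: divide_right_mono)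
      also have "\<dots> = (sqrt Q / z\<^sup>2)\<^sup>2" using \<open>0 < Q\<close> by (simp add: power_divide)
      finally show "\<bar>x\<bar>\<^sup>2 \<le> (sqrt Q / z\<^sup>2)\<^sup>2" by simp
    qed (use \<open>0 < Q\<close> in simp)
    have "(z * r z - 1)\<^sup>2 \<le> (real m + 1) * e z"
      unfolding e_def using D[of z] z by (intro excess_lower_bounds(1)[OF m]) auto
    moreover have "(sin (\<theta> z))\<^sup>2 \<le> K * e z"
      unfolding e_def using D[of z] z by (intro sinK) auto
    ultimately show "\<bar>z * r z - 1\<bar> \<le> sqrt Q / z\<^sup>2 \<and> \<bar>sin (\<theta> z)\<bar> \<le> sqrt Q / z\<^sup>2"
      using K by (intro conjI root[of _ "real m + 1"] root[of _ K]) (auto simp: Q_def)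
  qed (use \<open>0 < Q\<close> in simp)
qed

lemma inverse_square_tendsto_0: "((\<lambda>z::real. C / z\<^sup>2) \<longlongrightarrow> 0) at_top"
  by (rule real_tendsto_divide_at_top[OF tendsto_const filterlim_pow_at_top[OF _ filterlim_ident]]) simp

lemma capillary_asymptotics:
  assumes sol: "capillary_solution (Suc m) r \<theta>" and m: "0 < m"
  shows "r \<sim>[at_top] (\<lambda>z. 1 / z)" and "(\<theta> \<longlongrightarrow> 0) at_top"
proof -
  obtain C where C: "\<And>z. 0 < z \<Longrightarrow> \<bar>z * r z - 1\<bar> \<le> C / z\<^sup>2 \<and> \<bar>sin (\<theta> z)\<bar> \<le> C / z\<^sup>2"
    using global_decay[OF m] sol by metis
  have pos: "\<forall>\<^sub>F z::real in at_top. 0 < z" by (rule eventually_gt_at_top)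
  have "((\<lambda>z. z * r z - 1) \<longlongrightarrow> 0) at_top"
    by (rule Lim_null_comparison[OF eventually_mono[OF pos] inverse_square_tendsto_0[of C]]) (use C in auto)
  from tendsto_add[OF this tendsto_const[of 1]] have "((\<lambda>z. z * r z) \<longlongrightarrow> 1) at_top" by simp
  then have "((\<lambda>z. r z / (1 / z)) \<longlongrightarrow> 1) at_top" by (simp add: mult.commute)
  then show "r \<sim>[at_top] (\<lambda>z. 1 / z)" by (rule asymp_equivI')
  have "((\<lambda>z. sin (\<theta> z)) \<longlongrightarrow> 0) at_top"
    by (rule Lim_null_comparison[OF eventually_mono[OF pos] inverse_square_tendsto_0[of C]]) (use C in auto)
  from isCont_tendsto_compose[OF isCont_arcsin[of 0] this]
  have "((\<lambda>z. arcsin (sin (\<theta> z))) \<longlongrightarrow> 0) at_top" by simp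
  moreover have "\<forall>\<^sub>F z in at_top. arcsin (sin (\<theta> z)) = \<theta> z"
    using pos
  proof eventually_elim
    case (elim z)
    then have "- (pi/2) < \<theta> z" "\<theta> z < pi/2" using sol by (simp_all add: capillary_solution_def)
    then show ?case by (intro arcsin_sin) auto
  qed
  ultimately show "(\<theta> \<longlongrightarrow> 0) at_top" by (rule Lim_transform_eventually)
qed

section \<open>Separation of two solutions\<close>

text \<open>With \<open>t = tan \<theta>\<close> and \<open>R = z * r\<close>, the system reads \<open>t' = m * z * tangent_rate g R\<close>
  and \<open>R' = R / z - z * t\<close>, where \<open>g = 1 / cos \<theta>\<close>, that is, \<open>g\<^sup>2 = 1 + t\<^sup>2\<close>.\<close>

definition tangent_rate :: "real \<Rightarrow> real \<Rightarrow> real" where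
  "tangent_rate g R = g ^ 3 - g\<^sup>2 / R"

section \<open>Taylor estimates for the tangent rate\<close>

lemma secant_bounds:
  fixes g t :: real
  assumes "0 < g" "g\<^sup>2 = 1 + t\<^sup>2" "\<bar>t\<bar> \<le> \<delta>" "\<delta> \<le> 1 / 2"
  shows "1 \<le> g" "g - 1 \<le> t\<^sup>2 / 2" "t\<^sup>2 \<le> \<delta>\<^sup>2" "t\<^sup>2 \<le> 1 / 4" "g \<le> 9 / 8"
proof -
  have "1\<^sup>2 \<le> g\<^sup>2" using assms by simp
  then show "1 \<le> g" using power2_le_imp_le[of 1 g] assms by simp
  have "0 \<le> (g - 1)\<^sup>2" by simp
  then show g: "g - 1 \<le> t\<^sup>2 / 2" using assms(2) by (simp add: power2_diff)
  show "t\<^sup>2 \<le> \<delta>\<^sup>2" using power_mono[OF assms(3), of 2] by simp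
  moreover have "\<delta>\<^sup>2 \<le> (1 / 2)\<^sup>2" using assms by (intro power_mono) auto
  ultimately show "t\<^sup>2 \<le> 1 / 4" by (simp add: power_divide)
  with g show "g \<le> 9 / 8" by linarith
qed

lemma tangent_rate_bound:
  fixes g t x \<delta> :: real
  assumes g: "0 < g" "g\<^sup>2 = 1 + t\<^sup>2" and small: "\<bar>t\<bar> \<le> \<delta>" "\<bar>x\<bar> \<le> \<delta>" "\<delta> \<le> 1 / 2"
  shows "\<bar>tangent_rate g (1 + x) - x\<bar> \<le> 6 * \<delta>\<^sup>2"
proof -
  note b = secant_bounds[OF g small(1,3)]
  have R: "1 / 2 \<le> 1 + x" using small by linarith
  have x2: "x\<^sup>2 \<le> \<delta>\<^sup>2" using power_mono[OF small(2), of 2] by simp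
  have "g ^ 3 - 1 = (g - 1) * (g\<^sup>2 + g + 1)" by (simp add: algebra_simps eval_nat_numeral)
  also have "\<dots> \<le> (t\<^sup>2 / 2) * 4" using b g by (intro mult_mono) auto
  finally have 1: "g ^ 3 - 1 \<le> 2 * \<delta>\<^sup>2" using b by simp
  have 2: "0 \<le> g ^ 3 - 1" using b by simp
  have "g\<^sup>2 / (1 + x) - (1 - x) = (t\<^sup>2 + x\<^sup>2) / (1 + x)"
    using R g(2) by (simp add: field_simps power2_eq_square)
  moreover have "(t\<^sup>2 + x\<^sup>2) / (1 + x) \<le> (\<delta>\<^sup>2 + \<delta>\<^sup>2) / (1 / 2)" using R b x2 by (intro frac_le) auto
  moreover have "0 \<le> (t\<^sup>2 + x\<^sup>2) / (1 + x)" using R by (intro divide_nonneg_nonneg) auto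
  ultimately have "0 \<le> g\<^sup>2 / (1 + x) - (1 - x)" "g\<^sup>2 / (1 + x) - (1 - x) \<le> 4 * \<delta>\<^sup>2" by auto
  moreover have "tangent_rate g (1 + x) - x = (g ^ 3 - 1) - (g\<^sup>2 / (1 + x) - (1 - x))"
    by (simp add: tangent_rate_def)
  ultimately show ?thesis using 1 2 zero_le_power2[of \<delta>] by (auto simp: abs_le_iff)
qed

text \<open>The second-order Taylor polynomial of the rate is
  \<open>x - x\<^sup>2 + t\<^sup>2 / 2\<close>, and the subtracted expression is its difference at
  two points. The rate enters multiplied by \<open>m * z\<close>, with \<open>\<delta>\<close> of
  order \<open>z^(-2)\<close>: the quadratic remainder factor is then of order
  \<open>z^(-3)\<close>, hence integrable, whereas a linear expansion would leave order
  \<open>1 / z\<close>.\<close>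

lemma tangent_rate_diff_bound:
  fixes g1 g2 t1 t2 x1 x2 \<delta> :: real
  assumes g1: "0 < g1" "g1\<^sup>2 = 1 + t1\<^sup>2" and g2: "0 < g2" "g2\<^sup>2 = 1 + t2\<^sup>2"
    and small: "\<bar>t1\<bar> \<le> \<delta>" "\<bar>x1\<bar> \<le> \<delta>" "\<bar>t2\<bar> \<le> \<delta>" "\<bar>x2\<bar> \<le> \<delta>" "\<delta> \<le> 1 / 2"
  shows "\<bar>tangent_rate g1 (1 + x1) - tangent_rate g2 (1 + x2)
      - ((1 - (x1 + x2)) * (x1 - x2) + (t1 + t2) / 2 * (t1 - t2))\<bar>
    \<le> 28 * \<delta>\<^sup>2 * (\<bar>x1 - x2\<bar> + \<bar>t1 - t2\<bar>)"
proof -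
  note b1 = secant_bounds[OF g1 small(1,5)] and b2 = secant_bounds[OF g2 small(3,5)]
  have \<delta>: "0 \<le> \<delta>" using small by linarith
  have R1: "1 / 2 \<le> 1 + x1" and R2: "1 / 2 \<le> 1 + x2" using small by linarith+
  have \<delta>2: "\<delta>\<^sup>2 \<le> \<delta> / 2" using \<delta> small(5) mult_left_mono[of \<delta> "1/2" \<delta>] by (simp add: power2_eq_square)
  \<comment> \<open>\<open>q\<close> is the divided difference of \<open>g ^ 3\<close> with respect
    to \<open>t\<^sup>2\<close>, close to \<open>3/2\<close>; \<open>p\<close> is the coefficient of
    \<open>x1 - x2\<close> that comes from \<open>g\<^sup>2 / R\<close>, close to
    \<open>1 - (x1 + x2)\<close>. Both are exact, so only these two factors need estimates.\<close>
  define q where "q = (g1\<^sup>2 + g1 * g2 + g2\<^sup>2) / (g1 + g2)"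
  define p where "p = (1 + t2\<^sup>2) / ((1 + x1) * (1 + x2))"
  have "(g1 - g2) * (g1 + g2) = t1\<^sup>2 - t2\<^sup>2" using g1 g2 by (simp add: algebra_simps power2_eq_square)
  then have gd: "g1 - g2 = (t1 + t2) * (t1 - t2) / (g1 + g2)"
    using g1 g2 by (simp add: field_simps power2_eq_square)
  have "g1 ^ 3 - g2 ^ 3 = (g1 - g2) * (g1\<^sup>2 + g1 * g2 + g2\<^sup>2)" by (simp add: algebra_simps eval_nat_numeral)
  then have cube: "g1 ^ 3 - g2 ^ 3 = (t1 + t2) * (t1 - t2) * q" unfolding gd by (simp add: q_def)
  have quot: "g1\<^sup>2 / (1 + x1) - g2\<^sup>2 / (1 + x2) = (t1 + t2) * (t1 - t2) / (1 + x1) - p * (x1 - x2)"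
    unfolding g1 g2 p_def using R1 R2 by (simp add: divide_simps) (simp add: algebra_simps power2_eq_square)
  have split: "tangent_rate g1 (1 + x1) - tangent_rate g2 (1 + x2)
      - ((1 - (x1 + x2)) * (x1 - x2) + (t1 + t2) / 2 * (t1 - t2))
    = (p - (1 - (x1 + x2))) * (x1 - x2) + (t1 + t2) * (q - 1 / (1 + x1) - 1 / 2) * (t1 - t2)"
    using cube quot unfolding tangent_rate_def by (simp add: algebra_simps)
  have "q - 3 / 2 = (3 * ((g1 - 1) + (g2 - 1)) + 2 * ((g1 - 1)\<^sup>2 + (g1 - 1) * (g2 - 1) + (g2 - 1)\<^sup>2)) / (2 * (g1 + g2))"
    unfolding q_def using g1 g2 by (simp add: field_simps power2_eq_square)
  moreover have "0 \<le> 3 * ((g1 - 1) + (g2 - 1)) + 2 * ((g1 - 1)\<^sup>2 + (g1 - 1) * (g2 - 1) + (g2 - 1)\<^sup>2)"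
    using b1 b2 by simp
  moreover have "3 * ((g1 - 1) + (g2 - 1)) + 2 * ((g1 - 1)\<^sup>2 + (g1 - 1) * (g2 - 1) + (g2 - 1)\<^sup>2) \<le> 6 * \<delta>\<^sup>2"
  proof -
    have h: "0 \<le> g1 - 1" "g1 - 1 \<le> \<delta>\<^sup>2 / 2" "0 \<le> g2 - 1" "g2 - 1 \<le> \<delta>\<^sup>2 / 2" "g1 - 1 \<le> 1/8" "g2 - 1 \<le> 1 / 8"
      using b1 b2 by auto
    have "(g1 - 1) * (g1 - 1) \<le> (g1 - 1) * 1" "(g1 - 1) * (g2 - 1) \<le> (g1 - 1) * 1" "(g2 - 1) * (g2 - 1) \<le> (g2 - 1) * 1"
      using h by (intro mult_left_mono; linarith)+
    moreover have "3 * (p + q) + 2 * (x + y + w) \<le> 6 * d"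
      if "x \<le> p * 1" "y \<le> p * 1" "w \<le> q * 1" "p \<le> d / 2" "q \<le> d / 2" for p q x y w d :: real
      using that by simp
    ultimately show ?thesis using h unfolding power2_eq_square[of "g1 - 1"] power2_eq_square[of "g2 - 1"] by blast
  qed
  moreover have "4 \<le> 2 * (g1 + g2)" using b1(1) b2(1) by simp
  moreover have "0 \<le> w \<and> w \<le> p / 4" if "w = y / x" "0 \<le> y" "y \<le> p" "4 \<le> x" for w x y p :: real
    using that frac_le[of p y 4 x] by auto
  ultimately have q: "0 \<le> q - 3 / 2" "q - 3 / 2 \<le> 6 * \<delta>\<^sup>2 / 4"
    by blast+
  have "1 - 1 / (1 + x1) = x1 / (1 + x1)" using R1 by (simp add: field_simps)
  then have "\<bar>1 - 1 / (1 + x1)\<bar> = \<bar>x1\<bar> / (1 + x1)" using R1 by simp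
  also have "\<dots> \<le> \<delta> / (1 / 2)" using R1 small by (intro frac_le) auto
  finally have "\<bar>q - 1 / (1 + x1) - 1 / 2\<bar> \<le> 3 * \<delta>" using q \<delta>2 by (simp add: abs_le_iff)
  moreover have "\<bar>t1 + t2\<bar> \<le> 2 * \<delta>" using small by linarith
  ultimately have "\<bar>t1 + t2\<bar> * \<bar>q - 1 / (1 + x1) - 1 / 2\<bar> \<le> 2 * \<delta> * (3 * \<delta>)"
    using \<delta> by (intro mult_mono) auto
  then have Q: "\<bar>t1 + t2\<bar> * \<bar>q - 1 / (1 + x1) - 1 / 2\<bar> \<le> 28 * \<delta>\<^sup>2"
    using zero_le_square[of \<delta>] unfolding power2_eq_square by linarith
  define \<sigma> where "\<sigma> = x1 + x2"
  have \<sigma>: "\<bar>\<sigma>\<bar> \<le> 2 * \<delta>" using small by (simp add: \<sigma>_def)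
  have s2: "\<sigma>\<^sup>2 \<le> 4 * \<delta>\<^sup>2" using power_mono[OF \<sigma>, of 2] by (simp add: power_mult_distrib)
  have "\<bar>x1 * x2\<bar> \<le> \<delta>\<^sup>2" unfolding abs_mult power2_eq_square using small \<delta> by (intro mult_mono) auto
  moreover have "\<bar>1 - \<sigma>\<bar> \<le> 2" using \<sigma> small by linarith
  ultimately have "\<bar>x1 * x2 * (1 - \<sigma>)\<bar> \<le> \<delta>\<^sup>2 * 2" unfolding abs_mult[of _ "1 - \<sigma>"] by (intro mult_mono) auto
  moreover have "\<bar>p + q - w\<bar> \<le> 7 * d" if "\<bar>w\<bar> \<le> d * 2" "p \<le> d" "q \<le> 4 * d" "0 \<le> p" "0 \<le> q" for p q w d :: real
    using that by (simp add: abs_le_iff)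
  ultimately have num: "\<bar>t2\<^sup>2 + \<sigma>\<^sup>2 - x1 * x2 * (1 - \<sigma>)\<bar> \<le> 7 * \<delta>\<^sup>2"
    using b2(3) s2 by simp
  have den: "1 / 4 \<le> (1 + x1) * (1 + x2)" using R1 R2 mult_mono[of "1/2" "1 + x1" "1/2" "1 + x2"] by simp
  have "p - (1 - (x1 + x2)) = (t2\<^sup>2 + \<sigma>\<^sup>2 - x1 * x2 * (1 - \<sigma>)) / ((1 + x1) * (1 + x2))"
    unfolding p_def \<sigma>_def using R1 R2 by (simp add: divide_simps) (simp add: algebra_simps power2_eq_square)
  then have "\<bar>p - (1 - (x1 + x2))\<bar> = \<bar>t2\<^sup>2 + \<sigma>\<^sup>2 - x1 * x2 * (1 - \<sigma>)\<bar> / ((1 + x1) * (1 + x2))"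
    using den by (simp add: abs_divide)
  also have "\<dots> \<le> 7 * \<delta>\<^sup>2 / (1 / 4)" using num den by (intro frac_le) auto
  finally have P: "\<bar>p - (1 - (x1 + x2))\<bar> \<le> 28 * \<delta>\<^sup>2" by simp
  show ?thesis
    unfolding split distrib_left
  proof (rule order_trans[OF abs_triangle_ineq], unfold abs_mult, rule add_mono)
    show "\<bar>p - (1 - (x1 + x2))\<bar> * \<bar>x1 - x2\<bar> \<le> 28 * \<delta>\<^sup>2 * \<bar>x1 - x2\<bar>"
      by (rule mult_right_mono[OF P]) simp
    show "\<bar>t1 + t2\<bar> * \<bar>q - 1 / (1 + x1) - 1 / 2\<bar> * \<bar>t1 - t2\<bar> \<le> 28 * \<delta>\<^sup>2 * \<bar>t1 - t2\<bar>"
      by (rule mult_right_mono[OF Q]) simp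
  qed
qed

text \<open>The cubic corrections in \<open>separation\<close> remove the oscillating terms of order \<open>1 / z\<close> from
  the derivative of \<open>\<mu> * u\<^sup>2 + v\<^sup>2\<close>, whose sign could not be controlled otherwise.\<close>

definition separation :: "real \<Rightarrow> real \<Rightarrow> real \<Rightarrow> real \<Rightarrow> real \<Rightarrow> real" where
  "separation \<mu> u v B a = \<mu> * u\<^sup>2 + v\<^sup>2
     - 4 * \<mu> * (1 - \<mu>) / 3 * (B * u\<^sup>2) + (4 + 2 * \<mu>) / 3 * (B * v\<^sup>2) - 4 * (1 - \<mu>) / 3 * (a * (u * v))"

text \<open>The quadratic form leaves the terms
  \<open>- 4 * \<mu> * z * B * u * v + 2 * \<mu> * z * a * v\<^sup>2\<close>. Under the fast flow
  \<open>u' = - z * v\<close>, \<open>v' = \<mu> * z * u\<close>, \<open>B' = - z * a\<close>,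
  \<open>a' = \<mu> * z * B\<close>, the cubic terms produce multiples of
  \<open>z * B * u * v\<close>, \<open>z * a * v\<^sup>2\<close> and
  \<open>z * a * u\<^sup>2\<close>. Requiring cancellation gives three linear equations whose unique
  solution is the three coefficients in \<open>separation\<close>. The slow drive
  \<open>1 / z\<close> in \<open>B'\<close> adds
  \<open>- \<mu> * \<gamma> * u\<^sup>2 / z + \<beta> * v\<^sup>2 / z\<close>.\<close>

lemma separation_deriv:
  assumes u: "(u has_real_derivative u z / z - z * v z) (at z within S)"
    and v: "(v has_real_derivative \<mu> * z * ((1 - 2 * B z) * u z + a z * v z) + e1) (at z within S)"
    and B: "(B has_real_derivative (1 + B z) / z - z * a z) (at z within S)"
    and a: "(a has_real_derivative \<mu> * z * B z + e2) (at z within S)"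
    and "z \<noteq> 0"
  defines "\<gamma> \<equiv> 4 * (1 - \<mu>) / 3" and "\<beta> \<equiv> (4 + 2 * \<mu>) / 3"
    and "\<zeta> \<equiv> \<mu> * z * (a z * v z - 2 * B z * u z)"
  shows "((\<lambda>z. separation \<mu> (u z) (v z) (B z) (a z)) has_real_derivative
      (2 * \<mu> - \<mu> * \<gamma>) * (u z)\<^sup>2 / z + \<beta> * (v z)\<^sup>2 / z
      + (2 * (v z * e1) - 3 * (\<mu> * \<gamma>) * (B z * (u z)\<^sup>2 / z)
         + \<beta> * (B z * (v z)\<^sup>2 / z + 2 * (B z * v z * \<zeta>) + 2 * (B z * v z * e1))
         - \<gamma> * (e2 * u z * v z + a z * v z * u z / z + a z * u z * \<zeta> + a z * u z * e1))) (at z within S)"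
proof -
  note d = DERIV_diff[OF DERIV_add[OF DERIV_diff[OF DERIV_add[OF DERIV_cmult[OF DERIV_power[OF u, of 2], of \<mu>] DERIV_power[OF v, of 2]]
      DERIV_cmult[OF DERIV_mult[OF B DERIV_power[OF u, of 2]], of "4 * \<mu> * (1 - \<mu>) / 3"]]
      DERIV_cmult[OF DERIV_mult[OF B DERIV_power[OF v, of 2]], of "(4 + 2 * \<mu>) / 3"]]
      DERIV_cmult[OF DERIV_mult[OF a DERIV_mult[OF u v]], of "4 * (1 - \<mu>) / 3"]]
  show ?thesis
    unfolding separation_def
    by (rule DERIV_cong[OF d])
      (use \<open>z \<noteq> 0\<close> in \<open>simp add: \<gamma>_def \<beta>_def \<zeta>_def divide_simps, simp add: algebra_simps power2_eq_square\<close>)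
qed

text \<open>For \<open>\<mu> \<ge> 1\<close> one has \<open>\<gamma> \<le> 0 \<le> \<beta>\<close>,
  so the first two summands are nonnegative. Each elementary product in the rest is at most
  \<open>(E + \<delta> / z) * (\<bar>u\<bar> + \<bar>v\<bar>)\<^sup>2\<close>; for those with
  \<open>\<zeta>\<close> because \<open>3 * \<mu> * z * \<delta>\<^sup>2 \<le> E\<close>. The
  numbers \<open>2\<close>, \<open>3\<close>, \<open>5\<close>, \<open>4\<close> count the
  products.\<close>

lemma separation_rate_bound:
  fixes \<mu> z u v B a e1 e2 E \<delta> \<beta> \<gamma> :: real
  assumes \<mu>: "1 \<le> \<mu>" and z: "0 < z" and \<delta>: "\<delta> \<le> 1 / 2" and B: "\<bar>B\<bar> \<le> \<delta>" and a: "\<bar>a\<bar> \<le> \<delta>"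
    and E: "28 * \<mu> * z * \<delta>\<^sup>2 \<le> E" and e1: "\<bar>e1\<bar> \<le> E * (\<bar>u\<bar> + \<bar>v\<bar>)" and e2: "\<bar>e2\<bar> \<le> E"
  defines "\<gamma> \<equiv> 4 * (1 - \<mu>) / 3" and "\<beta> \<equiv> (4 + 2 * \<mu>) / 3" and "\<zeta> \<equiv> \<mu> * z * (a * v - 2 * B * u)"
  shows "- (2 + 3 * \<bar>\<mu> * \<gamma>\<bar> + 5 * \<bar>\<beta>\<bar> + 4 * \<bar>\<gamma>\<bar>) * ((E + \<delta> / z) * (\<bar>u\<bar> + \<bar>v\<bar>)\<^sup>2)
    \<le> (2 * \<mu> - \<mu> * \<gamma>) * u\<^sup>2 / z + \<beta> * v\<^sup>2 / z
      + (2 * (v * e1) - 3 * (\<mu> * \<gamma>) * (B * u\<^sup>2 / z)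
         + \<beta> * (B * v\<^sup>2 / z + 2 * (B * v * \<zeta>) + 2 * (B * v * e1))
         - \<gamma> * (e2 * u * v + a * v * u / z + a * u * \<zeta> + a * u * e1))"
proof -
  define W where "W = \<bar>u\<bar> + \<bar>v\<bar>"
  define N where "N = (E + \<delta> / z) * W\<^sup>2"
  have uW: "\<bar>u\<bar> \<le> W" "\<bar>v\<bar> \<le> W" "0 \<le> W" by (auto simp: W_def)
  have d0: "0 \<le> \<delta>" using B by linarith
  have E0: "0 \<le> E" using e2 by linarith
  have dz: "0 \<le> \<delta> / z" using d0 z by simp
  have N1: "E * W\<^sup>2 \<le> N" "\<delta> / z * W\<^sup>2 \<le> N"
    unfolding N_def using E0 dz by (intro mult_right_mono; simp)+
  have prod2: "\<bar>p * q\<bar> \<le> P * Q" if "\<bar>p\<bar> \<le> P" "\<bar>q\<bar> \<le> Q" for p q P Q :: real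
    unfolding abs_mult using that by (intro mult_mono) auto
  have W2: "W * W = W\<^sup>2" by (simp add: power2_eq_square)
  have uv: "\<bar>u * v\<bar> \<le> W\<^sup>2" "\<bar>u\<^sup>2\<bar> \<le> W\<^sup>2" "\<bar>v\<^sup>2\<bar> \<le> W\<^sup>2"
    using prod2[OF uW(1,2)] prod2[OF uW(1,1)] prod2[OF uW(2,2)] by (simp_all add: power2_eq_square)
  have over_z: "\<bar>p * q / z\<bar> \<le> N" if "\<bar>p\<bar> \<le> \<delta>" "\<bar>q\<bar> \<le> W\<^sup>2" for p q
  proof -
    have "\<bar>p * q / z\<bar> = \<bar>p * q\<bar> / z" using z by simp
    also have "\<dots> \<le> \<delta> * W\<^sup>2 / z" using prod2[OF that] z by (intro divide_right_mono) auto
    also have "\<dots> \<le> N" using N1(2) by simp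
    finally show ?thesis .
  qed
  have with_E: "\<bar>p * q\<bar> \<le> N" if "\<bar>p\<bar> \<le> W" "\<bar>q\<bar> \<le> E * W" for p q
    using prod2[OF that] N1(1) W2 by (simp add: mult.left_commute)
  have "\<bar>a * v - 2 * B * u\<bar> \<le> \<bar>a * v\<bar> + 2 * \<bar>B * u\<bar>"
    using abs_triangle_ineq4[of "a * v" "2 * B * u"] by (simp add: abs_mult)
  also have "\<dots> \<le> 3 * \<delta> * W" using prod2[OF a uW(2)] prod2[OF B uW(1)] by simp
  finally have "\<bar>\<mu> * z\<bar> * \<bar>a * v - 2 * B * u\<bar> \<le> \<mu> * z * (3 * \<delta> * W)"
    using \<mu> z by (intro mult_mono) auto
  then have \<zeta>: "\<bar>\<zeta>\<bar> \<le> 3 * \<mu> * z * \<delta> * W" by (simp add: \<zeta>_def abs_mult mult.assoc mult.left_commute)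
  have with_\<zeta>: "\<bar>p * q * \<zeta>\<bar> \<le> N" if "\<bar>p\<bar> \<le> \<delta>" "\<bar>q\<bar> \<le> W" for p q
  proof -
    have "\<bar>p * q * \<zeta>\<bar> \<le> \<delta> * W * (3 * \<mu> * z * \<delta> * W)" by (rule prod2[OF prod2[OF that] \<zeta>])
    also have "\<dots> = 3 * \<mu> * z * \<delta>\<^sup>2 * W\<^sup>2" by (simp add: power2_eq_square)
    also have "\<dots> \<le> E * W\<^sup>2"
    proof (rule mult_right_mono)
      have "0 \<le> \<mu> * z * \<delta>\<^sup>2" using \<mu> z by simp
      then show "3 * \<mu> * z * \<delta>\<^sup>2 \<le> E" using E by linarith
    qed simp
    finally show ?thesis using N1(1) by linarith
  qed
  have dW: "\<bar>p * q\<bar> \<le> W" if "\<bar>p\<bar> \<le> \<delta>" "\<bar>q\<bar> \<le> W" for p q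
  proof -
    have "\<delta> * W \<le> 1 * W" using \<delta> uW(3) by (intro mult_right_mono) auto
    with prod2[OF that] show ?thesis by linarith
  qed
  have e1W: "\<bar>e1\<bar> \<le> E * W" using e1 by (simp add: W_def)
  have T: "\<bar>v * e1\<bar> \<le> N" "\<bar>B * u\<^sup>2 / z\<bar> \<le> N" "\<bar>B * v\<^sup>2 / z\<bar> \<le> N" "\<bar>B * v * \<zeta>\<bar> \<le> N" "\<bar>B * v * e1\<bar> \<le> N"
      "\<bar>a * u * \<zeta>\<bar> \<le> N" "\<bar>a * u * e1\<bar> \<le> N"
    using with_E[OF uW(2) e1W] over_z[OF B uv(2)] over_z[OF B uv(3)] with_\<zeta>[OF B uW(2)] with_E[OF dW[OF B uW(2)] e1W]
      with_\<zeta>[OF a uW(1)] with_E[OF dW[OF a uW(1)] e1W] by auto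
  have T6: "\<bar>e2 * u * v\<bar> \<le> N" using prod2[OF e2 uv(1)] N1(1) by (simp add: mult.assoc)
  have T7: "\<bar>a * v * u / z\<bar> \<le> N" using over_z[OF a uv(1)] by (simp only: mult.assoc mult.commute[of v u])
  have S1: "\<bar>3 * (\<mu> * \<gamma>) * (B * u\<^sup>2 / z)\<bar> \<le> 3 * \<bar>\<mu> * \<gamma>\<bar> * N"
    by (rule prod2[OF _ T(2)]) (simp add: abs_mult)
  have S2: "\<bar>\<beta> * (B * v\<^sup>2 / z + 2 * (B * v * \<zeta>) + 2 * (B * v * e1))\<bar> \<le> \<bar>\<beta>\<bar> * (5 * N)"
    by (rule prod2) (use T(3-5) in \<open>simp_all only: abs_le_iff\<close>, linarith+)
  have S3: "\<bar>\<gamma> * (e2 * u * v + a * v * u / z + a * u * \<zeta> + a * u * e1)\<bar> \<le> \<bar>\<gamma>\<bar> * (4 * N)"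
    by (rule prod2) (use T(6-7) T6 T7 in \<open>simp_all only: abs_le_iff\<close>, linarith+)
  have "\<gamma> \<le> 0" "0 \<le> \<beta>" using \<mu> by (auto simp: \<gamma>_def \<beta>_def)
  then have "\<mu> * \<gamma> \<le> 0" using \<mu> by (simp add: mult_nonneg_nonpos)
  then have "0 \<le> 2 * \<mu> - \<mu> * \<gamma>" using \<mu> by linarith
  then have "0 \<le> (2 * \<mu> - \<mu> * \<gamma>) * u\<^sup>2 / z"
    using z by (intro divide_nonneg_nonneg mult_nonneg_nonneg) auto
  moreover have "0 \<le> \<beta> * v\<^sup>2 / z" using \<open>0 \<le> \<beta>\<close> z by simp
  moreover have "(2 + 3 * \<bar>\<mu> * \<gamma>\<bar> + 5 * \<bar>\<beta>\<bar> + 4 * \<bar>\<gamma>\<bar>) * N = 2 * N + 3 * \<bar>\<mu> * \<gamma>\<bar> * N + \<bar>\<beta>\<bar> * (5 * N) + \<bar>\<gamma>\<bar> * (4 * N)"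
    by (simp add: algebra_simps)
  ultimately show ?thesis
    unfolding W_def[symmetric] N_def[symmetric] minus_mult_left[symmetric]
    using T(1) S1 S2 S3 by (simp only: abs_le_iff) linarith
qed

lemma separation_bounds:
  fixes \<mu> u v B a \<delta> :: real
  assumes "1 \<le> \<mu>" "\<bar>B\<bar> \<le> \<delta>" "\<bar>a\<bar> \<le> \<delta>"
    and "(\<bar>4 * \<mu> * (1 - \<mu>) / 3\<bar> + \<bar>(4 + 2 * \<mu>) / 3\<bar> + \<bar>4 * (1 - \<mu>) / 3\<bar>) * \<delta> \<le> 1 / 2"
  shows "(u\<^sup>2 + v\<^sup>2) / 2 \<le> separation \<mu> u v B a" "separation \<mu> u v B a \<le> (\<mu> + 1) * (u\<^sup>2 + v\<^sup>2)"
proof -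
  define S where "S = u\<^sup>2 + v\<^sup>2"
  have S: "0 \<le> S" "u\<^sup>2 \<le> S" "v\<^sup>2 \<le> S" by (auto simp: S_def)
  have "0 \<le> (u - v)\<^sup>2" "0 \<le> (u + v)\<^sup>2" by auto
  then have uv: "\<bar>u * v\<bar> \<le> S" unfolding S_def using S(2,3) by (auto simp: power2_diff power2_sum abs_le_iff)
  have corr: "\<bar>k * (p * q)\<bar> \<le> \<bar>k\<bar> * (\<delta> * S)" if "\<bar>p\<bar> \<le> \<delta>" "\<bar>q\<bar> \<le> S" for k p q
    unfolding abs_mult using that S by (intro mult_left_mono mult_mono) auto
  have "\<bar>u\<^sup>2\<bar> \<le> S" "\<bar>v\<^sup>2\<bar> \<le> S" using S by auto
  note T = corr[OF assms(2) this(1), of "4 * \<mu> * (1 - \<mu>) / 3"] corr[OF assms(2) this(2), of "(4 + 2 * \<mu>) / 3"]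
    corr[OF assms(3) uv, of "4 * (1 - \<mu>) / 3"]
  have "(\<bar>4 * \<mu> * (1 - \<mu>) / 3\<bar> + \<bar>(4 + 2 * \<mu>) / 3\<bar> + \<bar>4 * (1 - \<mu>) / 3\<bar>) * \<delta> * S \<le> 1 / 2 * S"
    using assms(4) S by (intro mult_right_mono) auto
  then have sum: "\<bar>4 * \<mu> * (1 - \<mu>) / 3\<bar> * (\<delta> * S) + \<bar>(4 + 2 * \<mu>) / 3\<bar> * (\<delta> * S) + \<bar>4 * (1 - \<mu>) / 3\<bar> * (\<delta> * S) \<le> S / 2"
    by (simp only: distrib_right mult.assoc)
  have lower: "S \<le> \<mu> * u\<^sup>2 + v\<^sup>2" using mult_right_mono[OF assms(1), of "u\<^sup>2"] by (simp add: S_def)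
  have upper: "\<mu> * u\<^sup>2 + v\<^sup>2 \<le> \<mu> * S"
    using mult_right_mono[OF assms(1), of "v\<^sup>2"] by (simp add: S_def distrib_left)
  have arith: "s / 2 \<le> x - p + q - w \<and> x - p + q - w \<le> y + s"
    if "\<bar>p\<bar> \<le> p'" "\<bar>q\<bar> \<le> q'" "\<bar>w\<bar> \<le> w'" "p' + q' + w' \<le> s / 2" "s \<le> x" "x \<le> y" "0 \<le> s"
    for p q w p' q' w' s x y :: real
    using that by linarith
  from arith[OF T sum lower upper S(1)]
  show "(u\<^sup>2 + v\<^sup>2) / 2 \<le> separation \<mu> u v B a" "separation \<mu> u v B a \<le> (\<mu> + 1) * (u\<^sup>2 + v\<^sup>2)"
    unfolding separation_def S_def by (simp_all add: distrib_right)
qed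

section \<open>Uniqueness\<close>

lemma capillary_solution_scaled_deriv:
  assumes sol: "capillary_solution (Suc m) r \<theta>" and z: "0 < z"
  shows "((\<lambda>z. z * r z - 1) has_real_derivative (z * r z) / z - z * tan (\<theta> z)) (at z within S)"
    and "((\<lambda>z. tan (\<theta> z)) has_real_derivative
          real m * z * tangent_rate (1 / cos (\<theta> z)) (1 + (z * r z - 1))) (at z within S)"
proof -
  have D: "0 < r z" "0 < cos (\<theta> z)" "(r has_real_derivative (- tan (\<theta> z))) (at z)"
    "(\<theta> has_real_derivative (real m * (z / cos (\<theta> z) - 1 / r z))) (at z)"
    using sol z by (auto simp: capillary_solution_def intro: cos_gt_zero_pi)
  have "((\<lambda>z. z * r z - 1) has_real_derivative (z * r z) / z - z * tan (\<theta> z)) (at z)"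
    by (rule DERIV_cong[OF DERIV_diff[OF DERIV_mult[OF DERIV_ident D(3)] DERIV_const]]) (use z in simp)
  then show "((\<lambda>z. z * r z - 1) has_real_derivative (z * r z) / z - z * tan (\<theta> z)) (at z within S)"
    by (rule has_field_derivative_at_within)
  have "cos (\<theta> z) \<noteq> 0" using D by simp
  have "inverse ((cos (\<theta> z))\<^sup>2) * (real m * (z / cos (\<theta> z) - 1 / r z))
      = real m * z * tangent_rate (1 / cos (\<theta> z)) (1 + (z * r z - 1))"
    unfolding tangent_rate_def using D z by (simp add: field_simps eval_nat_numeral)
  from DERIV_cong[OF DERIV_chain2[OF DERIV_tan[OF \<open>cos (\<theta> z) \<noteq> 0\<close>] D(4)] this]
  show "((\<lambda>z. tan (\<theta> z)) has_real_derivative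
          real m * z * tangent_rate (1 / cos (\<theta> z)) (1 + (z * r z - 1))) (at z within S)"
    by (rule has_field_derivative_at_within)
qed

lemma tan_bound_of_sin_bound:
  fixes \<theta> s :: real
  assumes "0 < cos \<theta>" "\<bar>sin \<theta>\<bar> \<le> s" "s \<le> 1 / 2"
  shows "\<bar>tan \<theta>\<bar> \<le> 2 * s"
proof -
  have "\<bar>sin \<theta>\<bar>\<^sup>2 \<le> (1 / 2)\<^sup>2" using assms by (intro power_mono) auto
  then have "(1 / 2)\<^sup>2 \<le> (cos \<theta>)\<^sup>2" by (simp add: cos_squared_eq power_divide)
  then have c: "1 / 2 \<le> cos \<theta>" using power2_le_imp_le less_imp_le[OF assms(1)] by blast
  have "\<bar>tan \<theta>\<bar> = \<bar>sin \<theta>\<bar> / cos \<theta>" using assms by (simp add: tan_def)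
  also have "\<dots> \<le> s / (1 / 2)" using assms c by (intro frac_le) auto
  finally show ?thesis by simp
qed

lemma secant_square: "cos \<theta> \<noteq> 0 \<Longrightarrow> (1 / cos \<theta>)\<^sup>2 = 1 + (tan \<theta>)\<^sup>2" for \<theta> :: real
  by (simp add: tan_sec divide_inverse)

lemma capillary_solutions_eventually_agree:
  assumes sol: "capillary_solution (Suc m) r \<theta>" "capillary_solution (Suc m) r' \<theta>'" and m: "0 < m"
  obtains w where "0 < w" "\<And>z. w \<le> z \<Longrightarrow> r z = r' z \<and> \<theta> z = \<theta>' z"
proof -
  obtain C where C: "0 < C"
    and decay: "\<And>r \<theta> z. capillary_solution (Suc m) r \<theta> \<Longrightarrow> 0 < z \<Longrightarrow> \<bar>z * r z - 1\<bar> \<le> C / z\<^sup>2 \<and> \<bar>sin (\<theta> z)\<bar> \<le> C / z\<^sup>2"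
    using global_decay[OF m] by metis
  define \<mu> where "\<mu> = real m"
  have \<mu>: "1 \<le> \<mu>" using m by (simp add: \<mu>_def)
  \<comment> \<open>The factor \<open>2\<close> pays for passing from the bound on the sine to one
    on the tangent.\<close>
  define k where "k = 2 * C"
  define \<delta> where "\<delta> z = k / z\<^sup>2" for z :: real
  define A where "A = \<bar>4 * \<mu> * (1 - \<mu>) / 3\<bar> + \<bar>(4 + 2 * \<mu>) / 3\<bar> + \<bar>4 * (1 - \<mu>) / 3\<bar>"
  \<comment> \<open>Since \<open>z \<le> z\<^sup>2\<close> for \<open>z \<ge> 1\<close>, from
    \<open>w\<close> on both \<open>\<delta> z\<close> and \<open>A * \<delta> z\<close> are at most
    \<open>1/2\<close>, as the Taylor estimates and \<open>separation_bounds\<close>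
    require.\<close>
  define w where "w = max 1 (2 * k * (1 + A))"
  have "0 \<le> A" "0 < k" using C by (auto simp: A_def k_def)
  have w: "1 \<le> w" by (simp add: w_def)
  have small: "0 \<le> \<delta> z" "\<delta> z \<le> 1 / 2" "A * \<delta> z \<le> 1 / 2" if "w \<le> z" for z
  proof -
    have "1 \<le> z" "2 * k * (1 + A) \<le> z" using that by (auto simp: w_def)
    moreover have "z \<le> z\<^sup>2" using \<open>1 \<le> z\<close> self_le_power[of z 2] by simp
    ultimately have "2 * k * (1 + A) \<le> z\<^sup>2" by linarith
    then have *: "\<delta> z * (1 + A) \<le> 1 / 2" using \<open>1 \<le> z\<close> by (simp add: \<delta>_def pos_divide_le_eq)
    show d0: "0 \<le> \<delta> z" using \<open>0 < k\<close> by (simp add: \<delta>_def)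
    have "0 \<le> \<delta> z * A" using d0 \<open>0 \<le> A\<close> by simp
    then show "\<delta> z \<le> 1 / 2" "A * \<delta> z \<le> 1 / 2" using * d0 by (auto simp: distrib_left mult.commute)
  qed
  have close: "\<bar>z * r z - 1\<bar> \<le> \<delta> z \<and> \<bar>tan (\<theta> z)\<bar> \<le> \<delta> z \<and> 0 < cos (\<theta> z)"
    if S: "capillary_solution (Suc m) r \<theta>" and z: "w \<le> z" for r \<theta> z
  proof -
    have "0 < z" using z w by linarith
    have c: "0 < cos (\<theta> z)" using S \<open>0 < z\<close> by (auto simp: capillary_solution_def intro: cos_gt_zero_pi)
    have dC: "\<delta> z = 2 * (C / z\<^sup>2)" by (simp add: \<delta>_def k_def)
    have "0 \<le> C / z\<^sup>2" using C by simp
    then show ?thesis using decay[OF S \<open>0 < z\<close>] tan_bound_of_sin_bound[OF c, of "C / z\<^sup>2"] small[OF z] c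
      unfolding dC by auto
  qed
  define x1 x2 t1 t2 where "x1 z = z * r z - 1" and "x2 z = z * r' z - 1"
    and "t1 z = tan (\<theta> z)" and "t2 z = tan (\<theta>' z)" for z
  define f1 f2 where "f1 z = tangent_rate (1 / cos (\<theta> z)) (1 + x1 z)"
    and "f2 z = tangent_rate (1 / cos (\<theta>' z)) (1 + x2 z)" for z
  define u v B a where "u z = x1 z - x2 z" and "v z = t1 z - t2 z"
    and "B z = (x1 z + x2 z) / 2" and "a z = (t1 z + t2 z) / 2" for z
  define D where "D z = separation \<mu> (u z) (v z) (B z) (a z)" for z
  define \<gamma> \<beta> where "\<gamma> = 4 * (1 - \<mu>) / 3" and "\<beta> = (4 + 2 * \<mu>) / 3"
  \<comment> \<open>Here \<open>28 * \<mu> * k\<^sup>2 + k\<close> is the numerator of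
    \<open>E + \<delta> z / z\<close> over \<open>z ^ 3\<close>. The inequality
    \<open>(\<bar>u\<bar> + \<bar>v\<bar>)\<^sup>2 \<le> 4 * D\<close> contributes a factor
    \<open>4\<close>, half of which is put into \<open>M\<close> so that the rate
    \<open>2 * M / z ^ 3\<close> is the derivative of \<open>- M / z\<^sup>2\<close>.\<close>
  define M where "M = 2 * (2 + 3 * \<bar>\<mu> * \<gamma>\<bar> + 5 * \<bar>\<beta>\<bar> + 4 * \<bar>\<gamma>\<bar>) * (28 * \<mu> * k\<^sup>2 + k)"
  have "0 \<le> M" using \<mu> \<open>0 < k\<close> by (simp add: M_def)
  have x1_small: "\<bar>x1 z\<bar> \<le> \<delta> z" "\<bar>t1 z\<bar> \<le> \<delta> z" "0 < cos (\<theta> z)"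
    and x2_small: "\<bar>x2 z\<bar> \<le> \<delta> z" "\<bar>t2 z\<bar> \<le> \<delta> z" "0 < cos (\<theta>' z)" if "w \<le> z" for z
    using close[OF sol(1) that] close[OF sol(2) that] by (simp_all add: x1_def x2_def t1_def t2_def)
  have Ba: "\<bar>B z\<bar> \<le> \<delta> z" "\<bar>a z\<bar> \<le> \<delta> z" if "w \<le> z" for z
    using x1_small[OF that] x2_small[OF that] by (auto simp: B_def a_def)
  have D_bounds: "((u z)\<^sup>2 + (v z)\<^sup>2) / 2 \<le> D z" "D z \<le> (\<mu> + 1) * ((u z)\<^sup>2 + (v z)\<^sup>2)" if "w \<le> z" for z
    using separation_bounds[OF \<mu> Ba[OF that]] small(3)[OF that] by (simp_all add: D_def A_def)
  have D_deriv: "\<exists>d. (D has_real_derivative d) (at z within S) \<and> - (2 * M / z ^ 3) * D z \<le> d" if z: "w \<le> z" for z S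
  proof -
    have "0 < z" using z w by linarith
    note dx1 = capillary_solution_scaled_deriv[OF sol(1) \<open>0 < z\<close>, of S, folded x1_def t1_def \<mu>_def, folded f1_def]
    note dx2 = capillary_solution_scaled_deriv[OF sol(2) \<open>0 < z\<close>, of S, folded x2_def t2_def \<mu>_def, folded f2_def]
    define E where "E = 28 * \<mu> * z * (\<delta> z)\<^sup>2"
    define e1 where "e1 = \<mu> * z * (f1 z - f2 z - ((1 - 2 * B z) * u z + a z * v z))"
    define e2 where "e2 = \<mu> * z * (((f1 z - x1 z) + (f2 z - x2 z)) / 2)"
    have du: "(u has_real_derivative u z / z - z * v z) (at z within S)"
      unfolding u_def[abs_def] by (rule DERIV_cong[OF DERIV_diff[OF dx1(1) dx2(1)]])
        (use \<open>0 < z\<close> in \<open>simp add: v_def t1_def t2_def x1_def x2_def field_simps\<close>)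
    have dv: "(v has_real_derivative \<mu> * z * ((1 - 2 * B z) * u z + a z * v z) + e1) (at z within S)"
      unfolding v_def[abs_def] by (rule DERIV_cong[OF DERIV_diff[OF dx1(2) dx2(2)]])
        (simp add: e1_def v_def algebra_simps)
    have dB: "(B has_real_derivative (1 + B z) / z - z * a z) (at z within S)"
      unfolding B_def[abs_def] by (rule DERIV_cong[OF DERIV_cdivide[OF DERIV_add[OF dx1(1) dx2(1)]]])
        (use \<open>0 < z\<close> in \<open>simp add: a_def t1_def t2_def x1_def x2_def field_simps\<close>)
    have da: "(a has_real_derivative \<mu> * z * B z + e2) (at z within S)"
      unfolding a_def[abs_def] by (rule DERIV_cong[OF DERIV_cdivide[OF DERIV_add[OF dx1(2) dx2(2)]]])
        (simp add: e2_def B_def field_simps)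
    have g: "0 < 1 / cos (\<theta> z)" "(1 / cos (\<theta> z))\<^sup>2 = 1 + (t1 z)\<^sup>2"
      "0 < 1 / cos (\<theta>' z)" "(1 / cos (\<theta>' z))\<^sup>2 = 1 + (t2 z)\<^sup>2"
      using x1_small(3)[OF z] x2_small(3)[OF z] by (auto simp: t1_def t2_def secant_square)
    note sm = small(2)[OF z]
    have twoB: "2 * B z = x1 z + x2 z" by (simp add: B_def)
    have "\<bar>f1 z - f2 z - ((1 - (x1 z + x2 z)) * (x1 z - x2 z) + (t1 z + t2 z) / 2 * (t1 z - t2 z))\<bar>
        \<le> 28 * (\<delta> z)\<^sup>2 * (\<bar>x1 z - x2 z\<bar> + \<bar>t1 z - t2 z\<bar>)"
      unfolding f1_def f2_def
      by (rule tangent_rate_diff_bound[OF g x1_small(2,1)[OF z] x2_small(2,1)[OF z] sm])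
    then have "\<bar>f1 z - f2 z - ((1 - 2 * B z) * u z + a z * v z)\<bar> \<le> 28 * (\<delta> z)\<^sup>2 * (\<bar>u z\<bar> + \<bar>v z\<bar>)"
      by (simp only: twoB u_def a_def v_def)
    then have "\<mu> * z * \<bar>f1 z - f2 z - ((1 - 2 * B z) * u z + a z * v z)\<bar> \<le> \<mu> * z * (28 * (\<delta> z)\<^sup>2 * (\<bar>u z\<bar> + \<bar>v z\<bar>))"
      using \<mu> \<open>0 < z\<close> by (intro mult_left_mono) auto
    then have e1: "\<bar>e1\<bar> \<le> E * (\<bar>u z\<bar> + \<bar>v z\<bar>)"
      using \<mu> \<open>0 < z\<close> by (simp add: e1_def E_def abs_mult mult_ac)
    have "\<bar>f1 z - x1 z\<bar> \<le> 6 * (\<delta> z)\<^sup>2"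
      unfolding f1_def by (rule tangent_rate_bound[OF g(1,2) x1_small(2,1)[OF z] sm])
    moreover have "\<bar>f2 z - x2 z\<bar> \<le> 6 * (\<delta> z)\<^sup>2"
      unfolding f2_def by (rule tangent_rate_bound[OF g(3,4) x2_small(2,1)[OF z] sm])
    ultimately have "\<bar>((f1 z - x1 z) + (f2 z - x2 z)) / 2\<bar> \<le> 28 * (\<delta> z)\<^sup>2"
      using zero_le_power2[of "\<delta> z"] by (simp add: abs_le_iff del: zero_le_power2)
    then have "\<mu> * z * \<bar>((f1 z - x1 z) + (f2 z - x2 z)) / 2\<bar> \<le> \<mu> * z * (28 * (\<delta> z)\<^sup>2)"
      using \<mu> \<open>0 < z\<close> by (intro mult_left_mono) auto
    then have e2: "\<bar>e2\<bar> \<le> E"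
      using \<mu> \<open>0 < z\<close> by (simp add: e2_def E_def abs_mult mult_ac)
    have "E + \<delta> z / z = (28 * \<mu> * k\<^sup>2 + k) / z ^ 3"
      using \<open>0 < z\<close> by (simp add: E_def \<delta>_def field_simps eval_nat_numeral)
    moreover have "(\<bar>u z\<bar> + \<bar>v z\<bar>)\<^sup>2 \<le> 4 * D z"
    proof -
      have "0 \<le> (\<bar>u z\<bar> - \<bar>v z\<bar>)\<^sup>2" by simp
      then have "(\<bar>u z\<bar> + \<bar>v z\<bar>)\<^sup>2 \<le> 2 * ((u z)\<^sup>2 + (v z)\<^sup>2)" by (simp add: power2_sum power2_diff)
      then show ?thesis using D_bounds(1)[OF z] by linarith
    qed
    ultimately have "(2 + 3 * \<bar>\<mu> * \<gamma>\<bar> + 5 * \<bar>\<beta>\<bar> + 4 * \<bar>\<gamma>\<bar>) * ((E + \<delta> z / z) * (\<bar>u z\<bar> + \<bar>v z\<bar>)\<^sup>2)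
        \<le> (2 + 3 * \<bar>\<mu> * \<gamma>\<bar> + 5 * \<bar>\<beta>\<bar> + 4 * \<bar>\<gamma>\<bar>) * ((28 * \<mu> * k\<^sup>2 + k) / z ^ 3 * (4 * D z))"
      using \<mu> \<open>0 < k\<close> \<open>0 < z\<close> by (simp only:) (intro mult_left_mono; simp)
    also have "\<dots> = 2 * M / z ^ 3 * D z" by (simp add: M_def)
    finally have "- (2 * M / z ^ 3) * D z
      \<le> - (2 + 3 * \<bar>\<mu> * \<gamma>\<bar> + 5 * \<bar>\<beta>\<bar> + 4 * \<bar>\<gamma>\<bar>) * ((E + \<delta> z / z) * (\<bar>u z\<bar> + \<bar>v z\<bar>)\<^sup>2)"
      unfolding minus_mult_left[symmetric] by (rule le_imp_neg_le)
    also note separation_rate_bound[OF \<mu> \<open>0 < z\<close> sm Ba[OF z] _ e1 e2, unfolded E_def[symmetric] \<gamma>_def[symmetric] \<beta>_def[symmetric], OF order_refl]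
    finally show ?thesis
      using separation_deriv[OF du dv dB da, folded \<gamma>_def \<beta>_def D_def] \<open>0 < z\<close> by blast
  qed
  have D_zero: "D z \<le> 0" if z: "w \<le> z" for z
  proof -
    have "0 < z" using z w by linarith
    \<comment> \<open>As \<open>2 * M / z ^ 3\<close> is integrable at infinity, the integrating
      factor \<open>exp (- M / z\<^sup>2)\<close> stays bounded, and \<open>D z\<close> is
      controlled by \<open>D b\<close>, which tends to \<open>0\<close> for large
      \<open>b\<close>.\<close>
    have le: "D z * exp (- M / z\<^sup>2) \<le> (\<mu> + 1) * (8 * (k / b\<^sup>2)\<^sup>2)" if b: "z \<le> b" for b
    proof -
      have "w \<le> b" using z b by linarith
      obtain d where d: "\<And>y. w \<le> y \<Longrightarrow> (D has_real_derivative d y) (at y within {z..b})"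
          "\<And>y. w \<le> y \<Longrightarrow> - (2 * M / y ^ 3) * D y \<le> d y"
        using D_deriv[of _ "{z..b}"] by metis
      have "D z * exp (- M / z\<^sup>2) \<le> D b * exp (- M / b\<^sup>2)"
      proof (rule nondecreasing_if_deriv_nonneg[where f = "\<lambda>y. D y * exp (- M / y\<^sup>2)" and a = z and b = b])
        fix y assume y: "y \<in> {z..b}"
        then have "w \<le> y" "0 < y" using z \<open>0 < z\<close> by auto
        have "((\<lambda>y. exp (- M / y\<^sup>2)) has_real_derivative 2 * M / y ^ 3 * exp (- M / y\<^sup>2)) (at y within {z..b})"
          using \<open>0 < y\<close> by (auto intro!: derivative_eq_intros simp: field_simps eval_nat_numeral)
        from DERIV_mult[OF d(1)[OF \<open>w \<le> y\<close>] this]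
        show "((\<lambda>y. D y * exp (- M / y\<^sup>2)) has_real_derivative
            d y * exp (- M / y\<^sup>2) + 2 * M / y ^ 3 * exp (- M / y\<^sup>2) * D y) (at y within {z..b})" .
        have "0 \<le> exp (- M / y\<^sup>2) * (d y + 2 * M / y ^ 3 * D y)"
          using d(2)[OF \<open>w \<le> y\<close>] by (intro mult_nonneg_nonneg) (simp, linarith)
        then show "0 \<le> d y * exp (- M / y\<^sup>2) + 2 * M / y ^ 3 * exp (- M / y\<^sup>2) * D y"
          by (simp add: algebra_simps)
      qed (use b in auto)
      also have "\<dots> \<le> D b * 1"
      proof (rule mult_left_mono)
        show "exp (- M / b\<^sup>2) \<le> 1" using \<open>0 \<le> M\<close> by simp
        show "0 \<le> D b" by (rule order_trans[OF _ D_bounds(1)[OF \<open>w \<le> b\<close>]]) simp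
      qed
      also have "D b \<le> (\<mu> + 1) * ((u b)\<^sup>2 + (v b)\<^sup>2)" by (rule D_bounds(2)[OF \<open>w \<le> b\<close>])
      also have "\<dots> \<le> (\<mu> + 1) * (8 * (\<delta> b)\<^sup>2)"
      proof (rule mult_left_mono)
        have "\<bar>u b\<bar> \<le> 2 * \<delta> b" "\<bar>v b\<bar> \<le> 2 * \<delta> b"
          using x1_small[OF \<open>w \<le> b\<close>] x2_small[OF \<open>w \<le> b\<close>] by (auto simp: u_def v_def)
        from power_mono[OF this(1), of 2] power_mono[OF this(2), of 2]
        show "(u b)\<^sup>2 + (v b)\<^sup>2 \<le> 8 * (\<delta> b)\<^sup>2" by (simp add: power_mult_distrib)
      qed (use \<mu> in simp)
      finally show ?thesis by (simp add: \<delta>_def)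
    qed
    have "((\<lambda>b. (\<mu> + 1) * (8 * (k / b\<^sup>2)\<^sup>2)) \<longlongrightarrow> (\<mu> + 1) * (8 * 0\<^sup>2)) at_top"
      by (intro tendsto_intros inverse_square_tendsto_0)
    moreover have "\<forall>\<^sub>F b in at_top. D z * exp (- M / z\<^sup>2) \<le> (\<mu> + 1) * (8 * (k / b\<^sup>2)\<^sup>2)"
      using eventually_ge_at_top[of z] by eventually_elim (rule le)
    ultimately have "D z * exp (- M / z\<^sup>2) \<le> (\<mu> + 1) * (8 * 0\<^sup>2)"
      by (rule tendsto_lowerbound) simp
    then show ?thesis by (simp add: mult_le_0_iff)
  qed
  show ?thesis
  proof (rule that[of w])
    fix z assume z: "w \<le> z"
    have "(u z)\<^sup>2 + (v z)\<^sup>2 \<le> 0" using order_trans[OF D_bounds(1)[OF z] D_zero[OF z]] by simp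
    then have "u z = 0" "v z = 0" by (simp_all add: sum_power2_le_zero_iff)
    have "0 < z" using z w by linarith
    have "r z = r' z" using \<open>u z = 0\<close> \<open>0 < z\<close> by (simp add: u_def x1_def x2_def)
    moreover have "\<theta> z = \<theta>' z"
    proof -
      have "- (pi/2) < \<theta> z" "\<theta> z < pi/2" "- (pi/2) < \<theta>' z" "\<theta>' z < pi/2"
        using sol \<open>0 < z\<close> unfolding capillary_solution_def by blast+
      then have "arctan (tan (\<theta> z)) = \<theta> z" "arctan (tan (\<theta>' z)) = \<theta>' z" by (simp_all only: arctan_tan)
      moreover have "tan (\<theta> z) = tan (\<theta>' z)" using \<open>v z = 0\<close> by (simp add: v_def t1_def t2_def)
      ultimately show ?thesis by metis
    qed
    ultimately show "r z = r' z \<and> \<theta> z = \<theta>' z" ..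
  qed (use w in simp)
qed

text \<open>Agreement for large \<open>z\<close> propagates downwards: at \<open>b\<close> both
  solutions have the same negative Hamiltonian, so both are confined on \<open>{z..b}\<close> to one
  region where the field is Lipschitz, however small \<open>z\<close> is.\<close>

theorem capillary_solution_unique:
  assumes sol: "capillary_solution (Suc m) r \<theta>" "capillary_solution (Suc m) r' \<theta>'" and m: "0 < m" and z: "0 < z"
  shows "r z = r' z \<and> \<theta> z = \<theta>' z"
proof -
  obtain w where w: "0 < w" "\<And>z. w \<le> z \<Longrightarrow> r z = r' z \<and> \<theta> z = \<theta>' z"
    using capillary_solutions_eventually_agree[OF sol m] by metis
  define b where "b = max w z"
  have b: "w \<le> b" "z \<le> b" by (auto simp: b_def)
  note S = capillary_solution_imp_on[OF sol(1) z, of b] capillary_solution_imp_on[OF sol(2) z, of b]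
  define h where "h = - hamiltonian m b (r b) (\<theta> b)"
  have h: "0 < h" using global_neg_hamiltonian[OF sol(1) m, of b] z b by (simp add: h_def)
  have h': "h = - hamiltonian m b (r' b) (\<theta>' b)" using w(2)[OF b(1)] by (simp add: h_def)
  have bounds: "min 1 h \<le> r y \<and> h / (2 / z) ^ m \<le> cos (\<theta> y)" if "y \<in> {z..b}" for y
    using bounds_of_neg_hamiltonian[OF _ h m z, of y "r y" "\<theta> y"] hamiltonian_mono[OF S(1), of y b]
      capillary_onD(1)[OF S(1) that] that by (auto simp: h_def)
  have bounds': "min 1 h \<le> r' y \<and> h / (2 / z) ^ m \<le> cos (\<theta>' y)" if "y \<in> {z..b}" for y
    using bounds_of_neg_hamiltonian[OF _ h m z, of y "r' y" "\<theta>' y"] hamiltonian_mono[OF S(2), of y b]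
      capillary_onD(1)[OF S(2) that] that by (auto simp: h')
  have "(r z - r' z)\<^sup>2 + (\<theta> z - \<theta>' z)\<^sup>2
    \<le> exp (4 * field_lipschitz m b (min 1 h) (h / (2 / z) ^ m) * \<bar>z - b\<bar>) * ((r b - r' b)\<^sup>2 + (\<theta> b - \<theta>' b)\<^sup>2)"
    by (rule capillary_comparison[OF S z _ _ bounds bounds']) (use h z b in auto)
  also have "\<dots> = 0" using w(2)[OF b(1)] by simp
  finally show ?thesis by (simp add: sum_power2_le_zero_iff)
qed

theorem theorem1:
  fixes n :: nat
  assumes "n \<ge> 2"
  shows "\<exists>r \<theta>. capillary_solution n r \<theta> \<and>
            (\<forall>r' \<theta>'. capillary_solution n r' \<theta>' \<longrightarrow> (\<forall>z>0. r' z = r z \<and> \<theta>' z = \<theta> z)) \<and>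
            r \<sim>[at_top] (\<lambda>z. 1 / z) \<and>
            (\<theta> \<longlongrightarrow> 0) at_top"
proof -
  obtain m where n: "n = Suc m" and m: "0 < m" using assms by (cases n) auto
  obtain r \<theta> where sol: "capillary_solution n r \<theta>"
    using capillary_solution_exists[OF m] unfolding n by blast
  show ?thesis
    using sol capillary_solution_unique[of m _ _ r \<theta>] capillary_asymptotics[of m r \<theta>] m unfolding n by blast
qed

end
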